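(* For $0<s<1/2$ there is a constant $M$ such that for all $h$ and all $u\in X_h$: $$\lfloor u\rfloor_s\le M\,h^{-s}\,|u| .$$
   Context: Domain: $S=\mathbb R^n/\mathbb L$, $\mathbb L=\sum_{i=1}^n\mathbb Z e_i$ for a basis $(e_i)$ of $\mathbb R^n$, with the flat Euclidean metric. $O=\mathrm L^2\mathrm{Alt}^\bullet(S)$ is the space of $\mathrm L^2$ differential forms of all degrees, with norm $|\cdot|$; $\mathrm d$ is the exterior derivative; $X=\{u\in O:\mathrm d u\in O\}$. For $s\in\,]0,1[$ the Slobodetskij semi-norm is $\lfloor u\rfloor_s^2=\iint_{S\times S}\frac{|u(x)-u(y)|^2}{|x-y|^{n+2s}}\,\mathrm dx\,\mathrm dy$ (forms are identified with their coefficient fields). Meshes: $(\mathcal T_h)$ is a sequence of cellular complexes on $S$, indexed by $h>0$ with $h\to0$, where $h$ is the largest diameter of a cell of $\mathcal T_h$. It is quasi-uniform: each $\mathcal T_h$ has a simplicial refinement, these refinements being quasi-uniform in the usual sense (uniformly shape-regular simplices with diameters uniformly comparable to $h$), and each cell of $\mathcal T_h$ is composed of a uniformly bounded number of simplices. Finite element spaces: for each $h$, $X_h=\bigoplus_{k=0}^n X_h^k\subset X$ is the space of a finite element system on $\mathcal T_h$: to each cell $T$ (of any dimension) and each $k$ is attached a finite dimensional space $X^k(T)$ of $k$-forms on $T$, smooth up to the boundary, such that $\mathrm d X^k(T)\subset X^{k+1}(T)$ and pullback to a subcell $T'\subset T$ maps $X^k(T)$ into $X^k(T')$; $X_h^k$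 consists of the $k$-forms on $S$ having, on every cell $T$, a single-valued pullback belonging to $X^k(T)$. The system is compatible: for each $T$ the sequence $0\to\mathbb R\to X^0(T)\to\cdots\to X^{\dim T}(T)\to0$ (with maps $\mathrm d$) is exact, and any family of elements of the $X^k(T')$, $T'$ ranging over proper subcells of $T$, compatible under pullback, extends to an element of $X^k(T)$. In the $h$-setting: after scaling by $h^{-1}$, the macro-elements (unions of cells touching a given cell) with their local spaces range in a compact family (finitely many combinatorial types, uniformly bounded dimensions). The local spaces contain the polynomial forms of degree up to a fixed integer $p\ge0$. *)

theory Defs
  imports "HOL-Analysis.Analysis"
begin

section \<open>The flat torus\<close>

text \<open>
  Functions on \<open>S = \<real>\<^sup>n/\<bbbL>\<close> are periodic functions on \<open>\<real>\<^sup>n\<close>, and subsets of \<open>S\<close> are handled through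
  their lifts to \<open>\<real>\<^sup>n\<close>.  Integrals over \<open>S\<close> are integrals over a fundamental parallelepiped.
\<close>

type_synonym 'n point = "real^'n"

definition lattice_basis :: "('n::finite \<Rightarrow> 'n point) \<Rightarrow> bool" where
  "lattice_basis e \<longleftrightarrow> inj e \<and> independent (range e) \<and> span (range e) = UNIV"

definition lattice :: "('n::finite \<Rightarrow> 'n point) \<Rightarrow> ('n point) set" where
  "lattice e = {\<Sum>i\<in>UNIV. real_of_int (z i) *\<^sub>R e i | z. True}"

definition fundamental_domain :: "('n::finite \<Rightarrow> 'n point) \<Rightarrow> ('n point) set" where
  "fundamental_domain e = {\<Sum>i\<in>UNIV. t i *\<^sub>R e i | t. \<forall>i. 0 \<le> t i \<and> t i < (1::real)}"

definition torus_dist :: "('n::finite \<Rightarrow> 'n point) \<Rightarrow> 'n point \<Rightarrow> 'n point \<Rightarrow> real" where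
  "torus_dist e x y = infdist (x - y) (lattice e)"

definition torus_diameter :: "('n::finite \<Rightarrow> 'n point) \<Rightarrow> ('n point) set \<Rightarrow> real" where
  "torus_diameter e A = (SUP (x, y) \<in> A \<times> A. torus_dist e x y)"

definition periodic :: "('n::finite \<Rightarrow> 'n point) \<Rightarrow> ('n point \<Rightarrow> 'b) \<Rightarrow> bool" where
  "periodic e u \<longleftrightarrow> (\<forall>l\<in>lattice e. \<forall>x. u (x + l) = u x)"


section \<open>Differential forms\<close>

text \<open>
  A form of mixed degree is identified with its coefficient field: the component of \<open>u x\<close> at the
  index set \<open>I = {i\<^sub>1 < \<dots> < i\<^sub>k}\<close> is the coefficient of \<open>dx\<^sub>i\<^sub>1 \<and> \<dots> \<and> dx\<^sub>i\<^sub>k\<close>.  The linear order on the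
  index type only serves to fix the signs.  The norm of \<^typ>\<open>real^('n set)\<close> is the
  Euclidean norm of the exterior algebra.
\<close>

type_synonym 'n form = "'n point \<Rightarrow> real^('n set)"

definition homogeneous :: "nat \<Rightarrow> 'n::finite form \<Rightarrow> bool" where
  "homogeneous k u \<longleftrightarrow> (\<forall>x I. card I \<noteq> k \<longrightarrow> u x $ I = 0)"

primrec partial :: "'n::finite list \<Rightarrow> ('n point \<Rightarrow> 'b::real_normed_vector) \<Rightarrow> 'n point \<Rightarrow> 'b" where
  "partial [] f = f"
| "partial (i # is) f = (\<lambda>x. frechet_derivative (partial is f) (at x) (axis i 1))"

definition smooth :: "('n::finite point \<Rightarrow> 'b::real_normed_vector) \<Rightarrow> bool" where
  "smooth f \<longleftrightarrow> (\<forall>is x. partial is f differentiable (at x))"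

definition smooth_convergence ::
    "(nat \<Rightarrow> 'n::finite point \<Rightarrow> 'b::real_normed_vector) \<Rightarrow> ('n point \<Rightarrow> 'b) \<Rightarrow> bool" where
  "smooth_convergence F f \<longleftrightarrow>
     (\<forall>is R. uniform_limit (cball 0 R) (\<lambda>m. partial is (F m)) (partial is f) sequentially)"

definition insertion_sign :: "'n::linorder \<Rightarrow> 'n set \<Rightarrow> real" where
  "insertion_sign i I = (- 1) ^ card {j \<in> I. j < i}"

definition ext_deriv :: "'n::{finite,linorder} form \<Rightarrow> 'n form" where
  "ext_deriv u = (\<lambda>x. \<chi> I. \<Sum>i\<in>I. insertion_sign i I * partial [i] u x $ (I - {i}))"

text \<open>The formal adjoint of \<^const>\<open>ext_deriv\<close>.\<close>

definition coderiv :: "'n::{finite,linorder} form \<Rightarrow> 'n form" where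
  "coderiv u = (\<lambda>x. \<chi> I. - (\<Sum>i\<in>-I. insertion_sign i I * partial [i] u x $ (insert i I)))"

text \<open>
  \<open>pullback_alt A w\<close> is the alternating form \<open>w (A \<cdot>, \<dots>, A \<cdot>)\<close>; its coefficients are combinations of
  those of \<open>w\<close> with minors of \<open>A\<close>.
\<close>

definition minor_det ::
    "('n point \<Rightarrow> 'n point) \<Rightarrow> 'n::{finite,linorder} set \<Rightarrow> 'n set \<Rightarrow> real" where
  "minor_det A I J = (\<Sum>\<pi> | \<pi> permutes {..<card J}. of_int (sign \<pi>) *
     (\<Prod>r<card J. A (axis (sorted_list_of_set J ! r) 1) $ (sorted_list_of_set I ! \<pi> r)))"

definition pullback_alt ::
    "('n point \<Rightarrow> 'n point) \<Rightarrow> real^('n::{finite,linorder} set) \<Rightarrow> real^('n set)" where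
  "pullback_alt A w = (\<chi> J. \<Sum>I | card I = card J. w $ I * minor_det A I J)"

definition polynomial_form :: "nat \<Rightarrow> 'n::finite form \<Rightarrow> bool" where
  "polynomial_form p u \<longleftrightarrow>
     (\<exists>c. \<forall>x. u x = (\<Sum>a | sum a UNIV \<le> p. (\<Prod>i\<in>UNIV. (x $ i) ^ a i) *\<^sub>R c (a :: 'n \<Rightarrow> nat)))"


section \<open>Square integrable forms and the Slobodetskij semi-norm\<close>

definition ennreal_sqrt :: "ennreal \<Rightarrow> ennreal" where
  "ennreal_sqrt a = (if a = \<infinity> then \<infinity> else ennreal (sqrt (enn2real a)))"

definition L2_norm :: "('n::finite \<Rightarrow> 'n point) \<Rightarrow> 'n form \<Rightarrow> ennreal" where
  "L2_norm e u = ennreal_sqrt (\<integral>\<^sup>+x\<in>fundamental_domain e. ennreal ((norm (u x))\<^sup>2) \<partial>lborel)"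

definition L2_forms :: "('n::finite \<Rightarrow> 'n point) \<Rightarrow> 'n form set" where
  "L2_forms e = {u \<in> borel_measurable borel. periodic e u \<and> L2_norm e u < \<infinity>}"

definition weak_ext_deriv ::
    "('n::{finite,linorder} \<Rightarrow> 'n point) \<Rightarrow> 'n form \<Rightarrow> 'n form \<Rightarrow> bool" where
  "weak_ext_deriv e u v \<longleftrightarrow> (\<forall>\<phi>. smooth \<phi> \<and> periodic e \<phi> \<longrightarrow>
     (LINT x:fundamental_domain e|lborel. u x \<bullet> coderiv \<phi> x) =
     (LINT x:fundamental_domain e|lborel. v x \<bullet> \<phi> x))"

definition ext_deriv_domain :: "('n::{finite,linorder} \<Rightarrow> 'n point) \<Rightarrow> 'n form set" where
  "ext_deriv_domain e = {u \<in> L2_forms e. \<exists>v\<in>L2_forms e. weak_ext_deriv e u v}"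

definition slobodetskij :: "('n::finite \<Rightarrow> 'n point) \<Rightarrow> real \<Rightarrow> 'n form \<Rightarrow> ennreal" where
  "slobodetskij e s u = ennreal_sqrt
     (\<integral>\<^sup>+x\<in>fundamental_domain e. (\<integral>\<^sup>+y\<in>fundamental_domain e.
        ennreal ((norm (u x - u y))\<^sup>2 / torus_dist e x y powr (real CARD('n) + 2 * s))
      \<partial>lborel) \<partial>lborel)"


section \<open>Meshes\<close>

text \<open>A complex on \<open>S\<close> is given by the set of all lifts of its finitely many cells.\<close>

definition periodic_family :: "('n::finite \<Rightarrow> 'n point) \<Rightarrow> ('n point) set set \<Rightarrow> bool" where
  "periodic_family e \<C> \<longleftrightarrow>
     (\<exists>F. finite F \<and> \<C> = {(+) l ` T | l T. l \<in> lattice e \<and> T \<in> F})"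

definition cell_chart ::
    "('n point) set \<Rightarrow> ('n point \<Rightarrow> 'n point) \<Rightarrow> ('n::finite point) set \<Rightarrow> bool" where
  "cell_chart V f T \<longleftrightarrow> subspace V \<and> (\<exists>g. homeomorphism (cball 0 1 \<inter> V) T f g)"

definition is_cell :: "('n::finite point) set \<Rightarrow> bool" where
  "is_cell T \<longleftrightarrow> (\<exists>V f. cell_chart V f T)"

text \<open>
  The set \<open>f ` (sphere 0 1 \<inter> V)\<close> does not depend on the chart, by invariance of domain;
  it is empty for cells of dimension 0.
\<close>

definition cell_boundary :: "('n::finite point) set \<Rightarrow> ('n point) set" where
  "cell_boundary T = \<Union>{f ` (sphere 0 1 \<inter> V) | V f. cell_chart V f T}"

definition cell_interior :: "('n::finite point) set \<Rightarrow> ('n point) set" where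
  "cell_interior T = T - cell_boundary T"

text \<open>The third condition says that a lifted cell is mapped injectively to \<open>S\<close>.\<close>

definition cellular_complex :: "('n::finite \<Rightarrow> 'n point) \<Rightarrow> ('n point) set set \<Rightarrow> bool" where
  "cellular_complex e \<T> \<longleftrightarrow>
     periodic_family e \<T> \<and>
     (\<forall>T\<in>\<T>. is_cell T) \<and>
     (\<forall>T\<in>\<T>. \<forall>l\<in>lattice e - {0}. T \<inter> (+) l ` T = {}) \<and>
     (\<forall>T\<in>\<T>. \<forall>T'\<in>\<T>. T \<noteq> T' \<longrightarrow> cell_interior T \<inter> cell_interior T' = {}) \<and>
     (\<forall>T\<in>\<T>. \<exists>\<B>\<subseteq>\<T>. cell_boundary T = \<Union>\<B>) \<and>
     \<Union>\<T> = UNIV"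

definition mesh_width :: "('n::finite \<Rightarrow> 'n point) \<Rightarrow> ('n point) set set \<Rightarrow> real \<Rightarrow> bool" where
  "mesh_width e \<T> h \<longleftrightarrow>
     (\<forall>T\<in>\<T>. torus_diameter e T \<le> h) \<and> (\<exists>T\<in>\<T>. torus_diameter e T = h)"

text \<open>The library's \<^const>\<open>simplicial_complex\<close> is finite, hence does not apply to the lifts.\<close>

definition periodic_triangulation :: "('n::finite \<Rightarrow> 'n point) \<Rightarrow> ('n point) set set \<Rightarrow> bool" where
  "periodic_triangulation e \<S> \<longleftrightarrow>
     periodic_family e \<S> \<and>
     (\<forall>\<sigma>\<in>\<S>. \<exists>m. int m simplex \<sigma>) \<and>
     (\<forall>\<sigma>\<in>\<S>. \<forall>\<tau>. \<tau> face_of \<sigma> \<and> \<tau> \<noteq> {} \<longrightarrow> \<tau> \<in> \<S>) \<and>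
     (\<forall>\<sigma>\<in>\<S>. \<forall>\<tau>\<in>\<S>. (\<sigma> \<inter> \<tau>) face_of \<sigma>) \<and>
     \<Union>\<S> = UNIV"

definition simplicial_refinement ::
    "('n::finite \<Rightarrow> 'n point) \<Rightarrow> ('n point) set set \<Rightarrow> ('n point) set set \<Rightarrow> bool" where
  "simplicial_refinement e \<T> \<S> \<longleftrightarrow>
     periodic_triangulation e \<S> \<and>
     (\<forall>T\<in>\<T>. T = \<Union>{\<sigma>\<in>\<S>. \<sigma> \<subseteq> T}) \<and>
     (\<forall>\<sigma>\<in>\<S>. \<exists>T\<in>\<T>. \<sigma> \<subseteq> T)"

text \<open>
  Only the simplices of full dimension need to be controlled, as the others are faces of these.
\<close>

definition quasi_uniform ::
    "(nat \<Rightarrow> ('n::finite point) set set) \<Rightarrow> (nat \<Rightarrow> ('n point) set set) \<Rightarrow> (nat \<Rightarrow> real) \<Rightarrow> bool" where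
  "quasi_uniform \<T> \<S> h \<longleftrightarrow>
     (\<exists>\<kappa>>0. \<forall>j. \<forall>\<sigma>\<in>\<S> j. aff_dim \<sigma> = int CARD('n) \<longrightarrow>
        diameter \<sigma> \<le> \<kappa> * h j \<and> h j \<le> \<kappa> * diameter \<sigma> \<and>
        (\<exists>x. cball x (diameter \<sigma> / \<kappa>) \<subseteq> \<sigma>)) \<and>
     (\<exists>N. \<forall>j. \<forall>T\<in>\<T> j. finite {\<sigma>\<in>\<S> j. \<sigma> \<subseteq> T} \<and> card {\<sigma>\<in>\<S> j. \<sigma> \<subseteq> T} \<le> N)"


section \<open>Forms on cells\<close>

text \<open>
  Cells are unions of simplices, so they have a tangent space \<open>V\<close> at the points of a dense relatively
  open subset.  The pullback to \<open>T\<close> of an ambient form restricts, at each such point, the alternating form to \<open>V\<close>.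
  Alternating forms on \<open>V\<close> are encoded as alternating forms on \<open>\<real>\<^sup>n\<close> by composition with the
  orthogonal projection onto \<open>V\<close>, which is \<^term>\<open>closest_point V\<close>; at the other points the value is
  set to 0.
\<close>

definition tangent_at :: "('n::finite point) set \<Rightarrow> 'n point \<Rightarrow> ('n point) set \<Rightarrow> bool" where
  "tangent_at T x V \<longleftrightarrow>
     subspace V \<and> (\<exists>\<epsilon>>0. T \<inter> ball x \<epsilon> = (+) x ` V \<inter> ball x \<epsilon>)"

definition pullback_to :: "('n point) set \<Rightarrow> 'n::{finite,linorder} form \<Rightarrow> 'n form" where
  "pullback_to T \<omega> = (\<lambda>x. if \<exists>V. tangent_at T x V
     then pullback_alt (closest_point (THE V. tangent_at T x V)) (\<omega> x) else 0)"

text \<open>Smooth up to the boundary: extends to a smooth form on \<open>\<real>\<^sup>n\<close>.\<close>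

definition smooth_cell_forms :: "nat \<Rightarrow> ('n point) set \<Rightarrow> 'n::{finite,linorder} form set" where
  "smooth_cell_forms k T = pullback_to T ` {\<omega>. smooth \<omega> \<and> homogeneous k \<omega>}"

text \<open>
  The exterior derivative on a cell and the pullback to a subcell are computed with any smooth
  extension; the results do not depend on its choice.
\<close>

definition extension :: "('n point) set \<Rightarrow> 'n::{finite,linorder} form \<Rightarrow> 'n form" where
  "extension T u = (SOME \<omega>. smooth \<omega> \<and> pullback_to T \<omega> = u)"

definition cell_deriv :: "('n point) set \<Rightarrow> 'n::{finite,linorder} form \<Rightarrow> 'n form" where
  "cell_deriv T u = pullback_to T (ext_deriv (extension T u))"

definition cell_pullback ::
    "('n point) set \<Rightarrow> ('n point) set \<Rightarrow> 'n::{finite,linorder} form \<Rightarrow> 'n form" where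
  "cell_pullback T T' u = pullback_to T' (extension T u)"

definition form_span :: "nat \<Rightarrow> (nat \<Rightarrow> 'n::finite form) \<Rightarrow> 'n form set" where
  "form_span N f = {\<lambda>x. \<Sum>i<N. c i *\<^sub>R f i x | c. True}"

definition form_independent :: "nat \<Rightarrow> (nat \<Rightarrow> 'n::finite form) \<Rightarrow> bool" where
  "form_independent N f \<longleftrightarrow>
     (\<forall>c. (\<forall>x. (\<Sum>i<N. c i *\<^sub>R f i x) = 0) \<longrightarrow> (\<forall>i<N. c i = 0))"


section \<open>Finite element systems\<close>

definition fe_system ::
    "('n::{finite,linorder} \<Rightarrow> 'n point) \<Rightarrow> ('n point) set set
      \<Rightarrow> (nat \<Rightarrow> ('n point) set \<Rightarrow> 'n form set) \<Rightarrow> bool" where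
  "fe_system e \<T> X \<longleftrightarrow>
     (\<forall>T\<in>\<T>. \<forall>k. X k T \<subseteq> smooth_cell_forms k T) \<and>
     (\<forall>T\<in>\<T>. \<forall>k. \<exists>N f. X k T = form_span N f) \<and>
     (\<forall>T\<in>\<T>. \<forall>k. cell_deriv T ` X k T \<subseteq> X (Suc k) T) \<and>
     (\<forall>T\<in>\<T>. \<forall>T'\<in>\<T>. \<forall>k. T' \<subseteq> T \<longrightarrow> cell_pullback T T' ` X k T \<subseteq> X k T') \<and>
     (\<forall>T\<in>\<T>. \<forall>k. \<forall>l\<in>lattice e. X k ((+) l ` T) = (\<lambda>u x. u (x - l)) ` X k T)"

text \<open>
  Exactness is required for all \<open>k\<close>: since \<open>(dim T + 1)\<close>-forms on \<open>T\<close> vanish, this includes the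
  surjectivity of \<open>d\<close> onto the forms of degree \<open>dim T\<close>.  The constant function \<open>c\<close> is the form with the single
  coefficient \<open>c\<close> at the index set \<open>{}\<close>.
\<close>

definition exact_on_cell ::
    "(nat \<Rightarrow> ('n point) set \<Rightarrow> 'n::{finite,linorder} form set) \<Rightarrow> ('n point) set \<Rightarrow> bool" where
  "exact_on_cell X T \<longleftrightarrow>
     {u \<in> X 0 T. cell_deriv T u = (\<lambda>x. 0)} = {pullback_to T (\<lambda>x. axis {} c) | c. True} \<and>
     (\<forall>k. {u \<in> X (Suc k) T. cell_deriv T u = (\<lambda>x. 0)} = cell_deriv T ` X k T)"

definition extends_from_boundary ::
    "('n point) set set \<Rightarrow> (nat \<Rightarrow> ('n point) set \<Rightarrow> 'n::{finite,linorder} form set)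
      \<Rightarrow> ('n point) set \<Rightarrow> bool" where
  "extends_from_boundary \<T> X T \<longleftrightarrow>
     (\<forall>k \<phi>. (\<forall>T'\<in>\<T>. T' \<subset> T \<longrightarrow> \<phi> T' \<in> X k T') \<and>
            (\<forall>T'\<in>\<T>. \<forall>T''\<in>\<T>. T'' \<subseteq> T' \<and> T' \<subset> T \<longrightarrow> cell_pullback T' T'' (\<phi> T') = \<phi> T'')
        \<longrightarrow> (\<exists>u\<in>X k T. \<forall>T'\<in>\<T>. T' \<subset> T \<longrightarrow> cell_pullback T T' u = \<phi> T'))"

definition compatible_system ::
    "('n point) set set \<Rightarrow> (nat \<Rightarrow> ('n point) set \<Rightarrow> 'n::{finite,linorder} form set) \<Rightarrow> bool" where
  "compatible_system \<T> X \<longleftrightarrow>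
     (\<forall>T\<in>\<T>. exact_on_cell X T \<and> extends_from_boundary \<T> X T)"

definition contains_polynomials ::
    "nat \<Rightarrow> ('n point) set set \<Rightarrow> (nat \<Rightarrow> ('n point) set \<Rightarrow> 'n::{finite,linorder} form set) \<Rightarrow> bool" where
  "contains_polynomials p \<T> X \<longleftrightarrow>
     (\<forall>T\<in>\<T>. \<forall>k \<omega>. polynomial_form p \<omega> \<and> homogeneous k \<omega> \<longrightarrow> pullback_to T \<omega> \<in> X k T)"

text \<open>
  Single-valued pullbacks: the pullbacks \<open>\<phi> T\<close> of \<open>u\<close> to all cells form a family that is compatible
  under further pullback.  Forms on \<open>S\<close> are identified when they agree almost everywhere, so \<open>u\<close> itself is
  only tied to the cells of full dimension.
\<close>

definition fe_space_deg ::
    "('n::{finite,linorder} \<Rightarrow> 'n point) \<Rightarrow> ('n point) set set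
      \<Rightarrow> (nat \<Rightarrow> ('n point) set \<Rightarrow> 'n form set) \<Rightarrow> nat \<Rightarrow> 'n form set" where
  "fe_space_deg e \<T> X k =
     {u \<in> borel_measurable borel. periodic e u \<and> homogeneous k u \<and>
        (\<exists>\<phi>. (\<forall>T\<in>\<T>. \<phi> T \<in> X k T) \<and>
             (\<forall>T\<in>\<T>. \<forall>T'\<in>\<T>. T' \<subseteq> T \<longrightarrow> cell_pullback T T' (\<phi> T) = \<phi> T') \<and>
             (\<forall>T\<in>\<T>. AE x in lborel. x \<in> interior T \<longrightarrow> u x = \<phi> T x))}"

definition fe_space ::
    "('n::{finite,linorder} \<Rightarrow> 'n point) \<Rightarrow> ('n point) set set
      \<Rightarrow> (nat \<Rightarrow> ('n point) set \<Rightarrow> 'n form set) \<Rightarrow> 'n form set" where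
  "fe_space e \<T> X =
     {\<lambda>x. \<Sum>k\<le>CARD('n). w k x | w. \<forall>k\<le>CARD('n). w k \<in> fe_space_deg e \<T> X k}"


section \<open>Compactness of the scaled macro-elements\<close>

definition macro_element ::
    "('n::finite point) set set \<Rightarrow> ('n point) set \<Rightarrow> ('n point) set set" where
  "macro_element \<T> T = {T''\<in>\<T>. \<exists>T'\<in>\<T>. T'' \<subseteq> T' \<and> T' \<inter> T \<noteq> {}}"

text \<open>
  A combinatorial type consists of the cells of a macro-element together with the dimensions of their
  local spaces.  A combinatorial cell is the set of its simplices, and a combinatorial simplex is the set
  of its vertices, which are numbered.  A macro-element of this type is given by the positions of
  the vertices and by a basis of each local space, consisting of pullbacks of ambient smooth forms.
\<close>

type_synonym comb_cell = "nat set set"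
type_synonym macro_type = "comb_cell set \<times> (comb_cell \<Rightarrow> nat \<Rightarrow> nat)"
type_synonym 'n macro_datum = "(nat \<Rightarrow> 'n point) \<times> (comb_cell \<Rightarrow> nat \<Rightarrow> nat \<Rightarrow> 'n form)"

definition realization :: "(nat \<Rightarrow> 'n::finite point) \<Rightarrow> comb_cell \<Rightarrow> ('n point) set" where
  "realization \<nu> c = (\<Union>A\<in>c. convex hull (\<nu> ` A))"

definition is_macro_type :: "macro_type \<Rightarrow> bool" where
  "is_macro_type = (\<lambda>(Cs, N). finite Cs \<and> (\<forall>c\<in>Cs. finite c \<and> (\<forall>A\<in>c. finite A \<and> A \<noteq> {})))"

definition is_macro_datum :: "macro_type \<Rightarrow> 'n::{finite,linorder} macro_datum \<Rightarrow> bool" where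
  "is_macro_datum = (\<lambda>(Cs, N) (\<nu>, f).
     \<forall>c\<in>Cs. (\<forall>A\<in>c. inj_on \<nu> A \<and> \<not> affine_dependent (\<nu> ` A)) \<and>
       (\<forall>k. (\<forall>i<N c k. smooth (f c k i) \<and> homogeneous k (f c k i)) \<and>
            form_independent (N c k) (\<lambda>i. pullback_to (realization \<nu> c) (f c k i))))"

definition macro_convergence ::
    "macro_type \<Rightarrow> (nat \<Rightarrow> 'n::finite macro_datum) \<Rightarrow> 'n macro_datum \<Rightarrow> bool" where
  "macro_convergence = (\<lambda>(Cs, N) D (\<nu>, f).
     (\<forall>v\<in>\<Union>(\<Union>Cs). (\<lambda>m. fst (D m) v) \<longlonglongrightarrow> \<nu> v) \<and>
     (\<forall>c\<in>Cs. \<forall>k. \<forall>i<N c k. smooth_convergence (\<lambda>m. snd (D m) c k i) (f c k i)))"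

definition compact_macro_family :: "macro_type \<Rightarrow> 'n::{finite,linorder} macro_datum set \<Rightarrow> bool" where
  "compact_macro_family \<tau> K \<longleftrightarrow>
     (\<forall>D\<in>K. is_macro_datum \<tau> D) \<and>
     (\<forall>D :: nat \<Rightarrow> 'n macro_datum. (\<forall>m. D m \<in> K) \<longrightarrow>
        (\<exists>D'\<in>K. \<exists>r. strict_mono r \<and> macro_convergence \<tau> (D \<circ> r) D'))"

text \<open>
  The scaling by \<open>h\<^sup>-\<^sup>1\<close> is combined with a translation to a base point \<open>a\<close>.  Its inverse is
  \<open>y \<mapsto> a + h y\<close>, and \<open>h\<^sup>k\<close> is the factor that the pullback by that map produces on \<open>k\<close>-forms.
\<close>

definition scaled_macro_element ::
    "('n point) set set \<Rightarrow> ('n point) set set \<Rightarrow> (nat \<Rightarrow> ('n point) set \<Rightarrow> 'n::{finite,linorder} form set)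
      \<Rightarrow> real \<Rightarrow> ('n point) set \<Rightarrow> macro_type \<Rightarrow> 'n macro_datum \<Rightarrow> bool" where
  "scaled_macro_element \<T> \<S> X h T = (\<lambda>(Cs, N) (\<nu>, f). \<exists>a.
     bij_betw (\<lambda>c. (\<lambda>y. a + h *\<^sub>R y) ` realization \<nu> c) Cs (macro_element \<T> T) \<and>
     (\<forall>c\<in>Cs. let T' = (\<lambda>y. a + h *\<^sub>R y) ` realization \<nu> c in
        (\<lambda>A. (\<lambda>y. a + h *\<^sub>R y) ` (convex hull (\<nu> ` A))) ` c = {\<sigma>\<in>\<S>. \<sigma> \<subseteq> T'} \<and>
        (\<forall>k. (\<lambda>u y. h ^ k *\<^sub>R u (a + h *\<^sub>R y)) ` X k T' =
           form_span (N c k) (\<lambda>i. pullback_to (realization \<nu> c) (f c k i)))))"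

definition compact_macro_elements ::
    "(nat \<Rightarrow> ('n point) set set) \<Rightarrow> (nat \<Rightarrow> ('n point) set set)
      \<Rightarrow> (nat \<Rightarrow> nat \<Rightarrow> ('n point) set \<Rightarrow> 'n::{finite,linorder} form set) \<Rightarrow> (nat \<Rightarrow> real) \<Rightarrow> bool" where
  "compact_macro_elements \<T> \<S> X h \<longleftrightarrow>
     (\<exists>Types K. finite Types \<and>
        (\<forall>\<tau>\<in>Types. is_macro_type \<tau> \<and> compact_macro_family \<tau> (K \<tau>)) \<and>
        (\<forall>j. \<forall>T\<in>\<T> j. \<exists>\<tau>\<in>Types. \<exists>D\<in>K \<tau>. scaled_macro_element (\<T> j) (\<S> j) (X j) (h j) T \<tau> D))"

end

theory Submission
  imports Defs
begin

text \<open>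
  Everything follows from the translation estimate
  \<open>\<integral>\<^sub>S \<bar>u(x + z) - u(x)\<bar>\<^sup>2 dx \<le> K min(1, \<bar>z\<bar>/h) \<bar>u\<bar>\<^sup>2\<close> on \<open>X\<^sub>h\<close>, by integration against
  \<open>\<bar>z\<bar>\<close> to the power \<open>- n - 2s\<close>; the integral converges at \<open>0\<close> because \<open>2s < 1\<close> and at infinity because \<open>s > 0\<close>.
  For the estimate, let \<open>\<sigma>\<close> be a simplex of full dimension, inside a cell \<open>T\<close>.  On \<open>T\<close> the form \<open>u\<close> is
  smooth and, by compactness of the scaled macro-elements, bounded by \<open>A\<close> and Lipschitz with constant \<open>A/h\<close>,
  where \<open>A\<^sup>2 h\<^sup>n\<close> is at most a constant times the integral of \<open>\<bar>u\<bar>\<^sup>2\<close> over \<open>T\<close>.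
  If \<open>x\<close> and \<open>x + z\<close> lie in \<open>\<sigma>\<close>, the Lipschitz bound applies; the points of \<open>\<sigma>\<close> that leave \<open>\<sigma>\<close> under the
  translation by \<open>z\<close> fill a volume of order \<open>\<bar>z\<bar> h\<^sup>n/h\<close>, and there the bound by \<open>A\<close> suffices.

  The compactness argument needs that a combination of basis forms vanishing on all simplices of full
  dimension is zero.  This holds since a cell of full dimension is the closure of its interior, by
  invariance of domain, hence is covered by its simplices of full dimension, a property that passes to limits.
\<close>


section \<open>Periodic functions and the lattice\<close>

text \<open>Elements of \<open>fe_space\<close> may jump across faces. A jump contributes to the
  translation estimate linearly in \<open>norm z / h\<close>, not quadratically as a Lipschitz bound
  does, and this makes 1/2 the threshold for \<open>s\<close>. Translations are studied on
  simplices, because convexity controls how much volume leaves them. The inverse estimate is made on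
  whole cells, because the local bases are independent there. Two mismatches shape the rest. Local
  spaces consist of pullbacks, which are set to 0 where the cell has no tangent space, whereas sup
  and Lipschitz bounds hold for the ambient smooth forms behind them; the two agree at interior
  points of a cell. Moreover, a limit of scaled macro-elements is known to have non-degenerate
  simplices and independent pullbacks, but not to consist of cells, so the topological property of
  cells has to be rewritten in terms of vertex sets before limits are taken. The torus is treated on
  lifts throughout: instead of choosing representatives, one sums over the lattice and applies
  Tonelli.\<close>

lemmas cball_borel [measurable] = borel_closed[OF closed_cball]
lemmas ball_borel [measurable] = borel_open[OF open_ball]

lemma lattice_coords:
  fixes e :: "'n::finite \<Rightarrow> 'n point"
  assumes "lattice_basis e"
  obtains B :: "'n point \<Rightarrow> 'n point" where "linear B"
    and "\<And>t. B (\<Sum>i\<in>UNIV. t i *\<^sub>R e i) = (\<chi> i. t i)"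
    and "\<And>x. x = (\<Sum>i\<in>UNIV. (B x $ i) *\<^sub>R e i)"
proof -
  define A :: "'n point \<Rightarrow> 'n point" where "A = (\<lambda>t. \<Sum>i\<in>UNIV. (t $ i) *\<^sub>R e i)"
  have lin: "linear A"
    unfolding A_def by (rule linearI) (simp_all add: scaleR_add_left sum.distrib scaleR_sum_right)
  have "x \<in> range A" for x
  proof -
    have "x \<in> span (range e)"
      using assms by (simp add: lattice_basis_def)
    then obtain r where "x = (\<Sum>v\<in>range e. r v *\<^sub>R v)"
      unfolding span_finite[OF finite_imageI[OF finite_class.finite_UNIV]] by auto
    also have "\<dots> = (\<Sum>i\<in>UNIV. r (e i) *\<^sub>R e i)"
      using assms by (simp add: sum.reindex lattice_basis_def)
    also have "\<dots> = A (\<chi> i. r (e i))"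
      by (simp add: A_def)
    finally show ?thesis by blast
  qed
  then have "surj A" by auto
  then obtain B where B: "linear B" "\<forall>x. B (A x) = x" "\<forall>x. A (B x) = x"
    using lin linear_surjective_isomorphism by blast
  show thesis
  proof
    show "B (\<Sum>i\<in>UNIV. t i *\<^sub>R e i) = (\<chi> i. t i)" for t
      using B(2)[rule_format, of "\<chi> i. t i"] by (simp add: A_def)
    show "x = (\<Sum>i\<in>UNIV. (B x $ i) *\<^sub>R e i)" for x
      using B(3) by (simp add: A_def)
  qed (fact B(1))
qed

lemma lattice_uminus: "l \<in> lattice e \<Longrightarrow> - l \<in> lattice e"
  unfolding lattice_def
proof clarify
  fix z :: "'a \<Rightarrow> int"
  show "\<exists>za. - (\<Sum>i\<in>UNIV. real_of_int (z i) *\<^sub>R e i)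
        = (\<Sum>i\<in>UNIV. real_of_int (za i) *\<^sub>R e i) \<and> True"
    by (rule exI[of _ "\<lambda>i. - z i"]) (simp add: sum_negf)
qed

lemma lattice_nonempty: "lattice e \<noteq> {}"
  by (auto simp: lattice_def)

lemma countable_lattice: "countable (lattice e)"
proof -
  have "lattice e = range (\<lambda>z. \<Sum>i\<in>UNIV. real_of_int (z i) *\<^sub>R e i)"
    by (auto simp: lattice_def)
  then show ?thesis by simp
qed

lemma fundamental_domain_bounded: "bounded (fundamental_domain e)"
proof -
  have "norm x \<le> (\<Sum>i\<in>UNIV. norm (e i))" if x: "x \<in> fundamental_domain e" for x
  proof -
    obtain t where "x = (\<Sum>i\<in>UNIV. t i *\<^sub>R e i) \<and> (\<forall>i. 0 \<le> t i \<and> t i < (1::real))"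
      using x unfolding fundamental_domain_def mem_Collect_eq by (elim exE)
    then have t: "x = (\<Sum>i\<in>UNIV. t i *\<^sub>R e i)" "\<forall>i. 0 \<le> t i \<and> t i < 1" by simp_all
    have "norm x \<le> (\<Sum>i\<in>UNIV. norm (t i *\<^sub>R e i))"
      unfolding t(1) by (rule norm_sum)
    also have "\<dots> \<le> (\<Sum>i\<in>UNIV. norm (e i))"
      using t(2) by (intro sum_mono) (simp add: mult_left_le_one_le less_imp_le)
    finally show ?thesis .
  qed
  then show ?thesis by (auto simp: bounded_iff)
qed

lemma fundamental_domain_borel [measurable]:
  fixes e :: "'n::finite \<Rightarrow> 'n point"
  assumes "lattice_basis e"
  shows "fundamental_domain e \<in> sets borel"
proof -
  obtain B where B: "linear B" "\<And>t. B (\<Sum>i\<in>UNIV. t i *\<^sub>R e i) = (\<chi> i. t i)"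
    "\<And>x. x = (\<Sum>i\<in>UNIV. (B x $ i) *\<^sub>R e i)"
    using lattice_coords[OF assms] by metis
  have [measurable]: "(\<lambda>x. B x $ i) \<in> borel_measurable borel" for i
    by (intro borel_measurable_continuous_onI continuous_intros linear_continuous_on linear_conv_bounded_linear[THEN iffD1] B)
  have "fundamental_domain e = (\<Inter>i. {x \<in> space borel. 0 \<le> B x $ i \<and> B x $ i < 1})"
    (is "_ = ?R")
  proof
    show "fundamental_domain e \<subseteq> ?R"
      by (auto simp: fundamental_domain_def B(2))
    show "?R \<subseteq> fundamental_domain e"
    proof
      fix x assume "x \<in> ?R"
      then have "\<forall>i. 0 \<le> B x $ i \<and> B x $ i < 1" by simp
      then show "x \<in> fundamental_domain e"
        unfolding fundamental_domain_def using B(3) by blast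
    qed
  qed
  also have "\<dots> \<in> sets borel"
    by measurable
  finally show ?thesis .
qed

lemma fundamental_domain_tiling:
  fixes e :: "'n::finite \<Rightarrow> 'n point"
  assumes "lattice_basis e"
  shows "\<exists>!l. l \<in> lattice e \<and> x + l \<in> fundamental_domain e"
proof -
  obtain B where B: "linear B" "\<And>t. B (\<Sum>i\<in>UNIV. t i *\<^sub>R e i) = (\<chi> i. t i)"
    "\<And>x. x = (\<Sum>i\<in>UNIV. (B x $ i) *\<^sub>R e i)"
    using lattice_coords[OF assms] by metis
  have char: "y \<in> fundamental_domain e \<longleftrightarrow> (\<forall>i. 0 \<le> B y $ i \<and> B y $ i < 1)" for y
  proof
    show "y \<in> fundamental_domain e \<Longrightarrow> \<forall>i. 0 \<le> B y $ i \<and> B y $ i < 1"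
      by (auto simp: fundamental_domain_def B(2))
    show "\<forall>i. 0 \<le> B y $ i \<and> B y $ i < 1 \<Longrightarrow> y \<in> fundamental_domain e"
      unfolding fundamental_domain_def using B(3) by blast
  qed
  define l where "l = (\<Sum>i\<in>UNIV. real_of_int (- \<lfloor>B x $ i\<rfloor>) *\<^sub>R e i)"
  show ?thesis
  proof (rule ex1I[of _ l])
    have "B (x + l) $ i = B x $ i - of_int \<lfloor>B x $ i\<rfloor>" for i
      by (simp only: linear_add[OF B(1)] l_def B(2)) simp
    moreover have "0 \<le> r - of_int \<lfloor>r\<rfloor> \<and> r - of_int \<lfloor>r\<rfloor> < 1" for r :: real
      by linarith
    ultimately have "x + l \<in> fundamental_domain e"
      unfolding char by metis
    moreover have "l \<in> lattice e"
      unfolding l_def lattice_def mem_Collect_eq by (rule exI[of _ "\<lambda>i. - \<lfloor>B x $ i\<rfloor>"]) simp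
    ultimately show "l \<in> lattice e \<and> x + l \<in> fundamental_domain e" by simp
  next
    fix m assume m: "m \<in> lattice e \<and> x + m \<in> fundamental_domain e"
    then obtain z where z: "m = (\<Sum>i\<in>UNIV. real_of_int (z i) *\<^sub>R e i)"
      by (auto simp: lattice_def)
    have "z i = - \<lfloor>B x $ i\<rfloor>" for i
    proof -
      have "B (x + m) $ i = B x $ i + of_int (z i)"
        by (simp only: linear_add[OF B(1)] z B(2)) simp
      then have "0 \<le> B x $ i + of_int (z i)" "B x $ i + of_int (z i) < 1"
        using m char[of "x + m"] by metis+
      then have "\<lfloor>B x $ i\<rfloor> = - z i"
        by (intro floor_unique) auto
      then show ?thesis by simp
    qed
    then show "m = l"
      by (simp add: z l_def)
  qed
qed

section \<open>Unfolding of integrals along the lattice\<close>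

lemma nn_integral_lattice_indicator:
  fixes e :: "'n::finite \<Rightarrow> 'n point"
  assumes "lattice_basis e"
  shows "(\<integral>\<^sup>+l. indicator (fundamental_domain e) (x + l) \<partial>count_space (lattice e)) = (1::ennreal)"
proof -
  obtain l where l: "l \<in> lattice e" "x + l \<in> fundamental_domain e"
    using ex1_implies_ex[OF fundamental_domain_tiling[OF assms, of x]] by (elim exE conjE)
  have uniq: "m = l" if "m \<in> lattice e" "x + m \<in> fundamental_domain e" for m
    using Uniq_D[OF ex1_iff_ex_Uniq[THEN iffD1, THEN conjunct2, OF fundamental_domain_tiling[OF assms, of x]]]
      l that by simp
  have "(\<integral>\<^sup>+m. indicator (fundamental_domain e) (x + m) \<partial>count_space (lattice e)) =
     (\<integral>\<^sup>+m. indicator {l} m \<partial>count_space (lattice e))"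
  proof (rule nn_integral_cong)
    fix m assume "m \<in> space (count_space (lattice e))"
    then have "x + m \<in> fundamental_domain e \<longleftrightarrow> m \<in> {l}"
      using l(2) uniq[of m] by force
    then show "indicator (fundamental_domain e) (x + m) = (indicator {l} m :: ennreal)"
      by (simp only: indicator_def)
  qed
  also have "\<dots> = 1"
    using l(1) by (simp add: nn_integral_indicator)
  finally show ?thesis .
qed

lemma nn_integral_lattice_uminus:
  fixes f :: "'n::finite point \<Rightarrow> ennreal"
  shows "(\<integral>\<^sup>+l. f (- l) \<partial>count_space (lattice e)) = (\<integral>\<^sup>+l. f l \<partial>count_space (lattice e))"
proof -
  have "bij_betw uminus (lattice e) (lattice e)"
    by (rule bij_betwI[where g = uminus]) (auto intro: lattice_uminus)
  then show ?thesis by (rule nn_integral_bij_count_space)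
qed

lemma nn_integral_translate:
  fixes f :: "'a::euclidean_space \<Rightarrow> ennreal"
  assumes [measurable]: "f \<in> borel_measurable borel"
  shows "(\<integral>\<^sup>+x. f (x + a) \<partial>lborel) = (\<integral>\<^sup>+x. f x \<partial>lborel)"
proof -
  have "(\<integral>\<^sup>+x. f x \<partial>lborel) = (\<integral>\<^sup>+x. f x \<partial>distr lborel borel ((+) a))"
    by (simp add: lborel_distr_plus)
  also have "\<dots> = (\<integral>\<^sup>+x. f (x + a) \<partial>lborel)"
    by (subst nn_integral_distr) (auto simp: add.commute)
  finally show ?thesis by simp
qed

text \<open>The indicators of the lattice translates of the fundamental domain add up to 1. This
  factor is inserted, Tonelli is applied, and each term is moved back by a translation; finally
  \<open>l\<close> is replaced by \<open>- l\<close>. Only measurability of \<open>g\<close> is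
  involved, so singular kernels can be unfolded too.\<close>

lemma nn_integral_unfold_lattice:
  fixes g :: "'n::finite point \<Rightarrow> ennreal"
  assumes e: "lattice_basis e" and [measurable]: "g \<in> borel_measurable borel"
  shows "(\<integral>\<^sup>+x. g x \<partial>lborel) =
     (\<integral>\<^sup>+x. indicator (fundamental_domain e) x * (\<integral>\<^sup>+l. g (x + l) \<partial>count_space (lattice e)) \<partial>lborel)"
proof -
  note [measurable] = fundamental_domain_borel[OF e]
  let ?F = "fundamental_domain e"
  have "(\<integral>\<^sup>+x. g x \<partial>lborel) = (\<integral>\<^sup>+x. (\<integral>\<^sup>+l. indicator ?F (x + l) * g x \<partial>count_space (lattice e)) \<partial>lborel)"
    by (simp add: nn_integral_multc nn_integral_lattice_indicator[OF e])
  also have "\<dots> = (\<integral>\<^sup>+l. (\<integral>\<^sup>+x. indicator ?F (x + l) * g x \<partial>lborel) \<partial>count_space (lattice e))"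
    by (rule nn_integral_count_space_nn_integral[OF countable_lattice]) measurable
  also have "\<dots> = (\<integral>\<^sup>+l. (\<integral>\<^sup>+x. indicator ?F x * g (x + - l) \<partial>lborel) \<partial>count_space (lattice e))"
  proof (rule nn_integral_cong)
    fix l
    show "(\<integral>\<^sup>+x. indicator ?F (x + l) * g x \<partial>lborel) = (\<integral>\<^sup>+x. indicator ?F x * g (x + - l) \<partial>lborel)"
      using nn_integral_translate[of "\<lambda>x. indicator ?F (x + l) * g x" "- l"] by simp
  qed
  also have "\<dots> = (\<integral>\<^sup>+l. (\<integral>\<^sup>+x. indicator ?F x * g (x + l) \<partial>lborel) \<partial>count_space (lattice e))"
    by (rule nn_integral_lattice_uminus)
  also have "\<dots> = (\<integral>\<^sup>+x. (\<integral>\<^sup>+l. indicator ?F x * g (x + l) \<partial>count_space (lattice e)) \<partial>lborel)"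
    by (rule nn_integral_count_space_nn_integral[OF countable_lattice, symmetric]) measurable
  also have "\<dots> = (\<integral>\<^sup>+x. indicator ?F x * (\<integral>\<^sup>+l. g (x + l) \<partial>count_space (lattice e)) \<partial>lborel)"
    by (simp add: nn_integral_cmult)
  finally show ?thesis .
qed

text \<open>A translate of the fundamental domain is again one: unfolding \<open>g\<close> times the
  indicator of the translate leaves, by periodicity, a lattice sum of indicators with value
  1.\<close>

lemma nn_integral_periodic_translate:
  fixes g :: "'n::finite point \<Rightarrow> ennreal"
  assumes e: "lattice_basis e" and [measurable]: "g \<in> borel_measurable borel" and g: "periodic e g"
  shows "(\<integral>\<^sup>+x\<in>fundamental_domain e. g (x + z) \<partial>lborel) = (\<integral>\<^sup>+x\<in>fundamental_domain e. g x \<partial>lborel)"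
proof -
  note [measurable] = fundamental_domain_borel[OF e]
  let ?F = "fundamental_domain e"
  have "(\<integral>\<^sup>+x\<in>?F. g (x + z) \<partial>lborel) = (\<integral>\<^sup>+x. g x * indicator ?F (x - z) \<partial>lborel)"
    using nn_integral_translate[of "\<lambda>x. g x * indicator ?F (x - z)" z] by simp
  also have "\<dots> = (\<integral>\<^sup>+x. indicator ?F x * (\<integral>\<^sup>+l. g (x + l) * indicator ?F (x + l - z) \<partial>count_space (lattice e)) \<partial>lborel)"
    by (rule nn_integral_unfold_lattice[OF e]) measurable
  also have "\<dots> = (\<integral>\<^sup>+x. indicator ?F x * (\<integral>\<^sup>+l. g x * indicator ?F (x - z + l) \<partial>count_space (lattice e)) \<partial>lborel)"
    using g by (intro nn_integral_cong arg_cong2[of _ _ _ _ times] refl)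
       (simp_all add: periodic_def diff_add_eq)
  also have "\<dots> = (\<integral>\<^sup>+x\<in>?F. g x \<partial>lborel)"
    by (simp add: nn_integral_cmult nn_integral_lattice_indicator[OF e] mult.commute)
  finally show ?thesis .
qed

text \<open>If the fundamental domain were null, unfolding the constant 1 would make the whole space
  null.\<close>

lemma emeasure_fundamental_domain_pos:
  fixes e :: "'n::finite \<Rightarrow> 'n point"
  assumes e: "lattice_basis e"
  shows "emeasure lborel (fundamental_domain e) > 0"
proof (rule ccontr)
  note [measurable] = fundamental_domain_borel[OF e]
  assume "\<not> ?thesis"
  then have 0: "emeasure lborel (fundamental_domain e) = 0" by simp
  have "nn_integral lborel (\<lambda>x::'n point. 1) = (\<integral>\<^sup>+x. indicator (fundamental_domain e) x * (\<integral>\<^sup>+l. 1 \<partial>count_space (lattice e)) \<partial>lborel)"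
    by (rule nn_integral_unfold_lattice[OF e]) measurable
  also have "\<dots> = 0"
    by (subst nn_integral_multc) (auto simp: 0)
  finally show False by simp
qed

lemma nn_integral_periodic_bounded:
  fixes e :: "'n::finite \<Rightarrow> 'n point"
  assumes e: "lattice_basis e"
  obtains N :: real where "N \<ge> 0" and "\<And>g. g \<in> borel_measurable borel \<Longrightarrow> periodic e g \<Longrightarrow>
    (\<integral>\<^sup>+x\<in>cball 0 R. g x \<partial>lborel) \<le> ennreal N * (\<integral>\<^sup>+x\<in>fundamental_domain e. g x \<partial>lborel)"
proof -
  note [measurable] = fundamental_domain_borel[OF e]
  let ?F = "fundamental_domain e"
  obtain D where D: "\<And>x. x \<in> ?F \<Longrightarrow> norm x \<le> D"
    using fundamental_domain_bounded[of e] by (auto simp: bounded_iff)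
  \<comment> \<open>\<open>D\<close> bounds the norm on the fundamental domain. If \<open>y\<close>
    and \<open>x - l\<close> lie in it and \<open>y + l\<close> in the ball of radius
    \<open>R\<close>, then \<open>x = (y + l) + (x - l) - y\<close> has norm at most
    \<open>R + 2 * D\<close>.\<close>
  define V where "V = emeasure lborel (cball (0::'n point) (R + 2 * D))"
  define N where "N = V / emeasure lborel ?F"
  have V: "V < \<infinity>"
    unfolding V_def by (rule emeasure_lborel_cball_finite)
  have Ffin: "emeasure lborel ?F < \<infinity>"
    by (rule emeasure_bounded_finite) (rule fundamental_domain_bounded)
  have Fpos: "emeasure lborel ?F > 0"
    by (rule emeasure_fundamental_domain_pos[OF e])
  have Nfin: "N < \<infinity>"
    unfolding N_def using V Fpos by (auto simp: less_top[symmetric] ennreal_divide_eq_top_iff)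
  \<comment> \<open>The translates of the fundamental domain by those \<open>l\<close> with
    \<open>y + l\<close> in the ball are disjoint and lie in the larger ball, so the quotient of
    volumes bounds their number.\<close>
  have count: "(\<integral>\<^sup>+l. indicator (cball 0 R) (y + l) \<partial>count_space (lattice e)) \<le> N" if y: "y \<in> ?F" for y
  proof -
    have "(\<integral>\<^sup>+l. indicator (cball 0 R) (y + l) \<partial>count_space (lattice e)) * emeasure lborel ?F
       = (\<integral>\<^sup>+l. (\<integral>\<^sup>+x. indicator (cball 0 R) (y + l) * indicator ?F x \<partial>lborel) \<partial>count_space (lattice e))"
      by (simp add: nn_integral_cmult nn_integral_multc)
    also have "\<dots> = (\<integral>\<^sup>+l. (\<integral>\<^sup>+x. indicator (cball 0 R) (y + l) * indicator ?F (x + - l) \<partial>lborel) \<partial>count_space (lattice e))"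
    proof (rule nn_integral_cong)
      fix l
      show "(\<integral>\<^sup>+x. indicator (cball 0 R) (y + l) * indicator ?F x \<partial>lborel) =
        (\<integral>\<^sup>+x. indicator (cball 0 R) (y + l) * indicator ?F (x + - l) \<partial>(lborel::'n point measure))"
        using nn_integral_translate[of "\<lambda>x. indicator (cball 0 R) (y + l) * indicator ?F x" "- l"] by simp
    qed
    also have "\<dots> = (\<integral>\<^sup>+x. (\<integral>\<^sup>+l. indicator (cball 0 R) (y + l) * indicator ?F (x + - l) \<partial>count_space (lattice e)) \<partial>lborel)"
      by (rule nn_integral_count_space_nn_integral[OF countable_lattice, symmetric]) measurable
    also have "\<dots> \<le> (\<integral>\<^sup>+x. (\<integral>\<^sup>+l. indicator (cball 0 (R + 2 * D)) x * indicator ?F (x + - l) \<partial>count_space (lattice e)) \<partial>lborel)"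
    proof (intro nn_integral_mono)
      fix x l
      have "norm x \<le> R + 2 * D" if "norm (y + l) \<le> R" "x - l \<in> ?F"
      proof -
        have "norm ((y + l) + (x - l) - y) \<le> norm (y + l) + norm (x - l) + norm y"
          by (rule order_trans[OF norm_triangle_ineq4]) (intro add_right_mono norm_triangle_ineq)
        then have "norm x \<le> norm (y + l) + norm (x - l) + norm y" by simp
        then show ?thesis using D[OF y] D[OF that(2)] that(1) by linarith
      qed
      then show "indicator (cball 0 R) (y + l) * indicator ?F (x + - l) \<le>
        indicator (cball 0 (R + 2 * D)) x * (indicator ?F (x + - l)::ennreal)"
        by (auto simp: indicator_def)
    qed
    also have "\<dots> = (\<integral>\<^sup>+x. indicator (cball 0 (R + 2 * D)) x * (\<integral>\<^sup>+l. indicator ?F (x + l) \<partial>count_space (lattice e)) \<partial>lborel)"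
      using nn_integral_lattice_uminus[where f = "\<lambda>l. indicator ?F (x + l)" and e = e for x]
      by (simp add: nn_integral_cmult)
    also have "\<dots> = V"
      by (simp add: nn_integral_lattice_indicator[OF e] V_def)
    finally have "(\<integral>\<^sup>+l. indicator (cball 0 R) (y + l) \<partial>count_space (lattice e)) * emeasure lborel ?F / emeasure lborel ?F \<le> N"
      unfolding N_def by (rule divide_right_mono_ennreal)
    then show ?thesis
      using Ffin Fpos by (simp add: ennreal_mult_divide_eq)
  qed
  show thesis
  proof
    show "0 \<le> enn2real N" by simp
    fix g :: "'n point \<Rightarrow> ennreal"
    assume [measurable]: "g \<in> borel_measurable borel" and g: "periodic e g"
    have "(\<integral>\<^sup>+x\<in>cball 0 R. g x \<partial>lborel) = (\<integral>\<^sup>+x. indicator ?F x *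
        (\<integral>\<^sup>+l. g (x + l) * indicator (cball 0 R) (x + l) \<partial>count_space (lattice e)) \<partial>lborel)"
      by (rule nn_integral_unfold_lattice[OF e]) measurable
    also have "\<dots> = (\<integral>\<^sup>+x. indicator ?F x *
        (\<integral>\<^sup>+l. g x * indicator (cball 0 R) (x + l) \<partial>count_space (lattice e)) \<partial>lborel)"
      using g by (intro nn_integral_cong arg_cong2[of _ _ _ _ times] refl) (simp add: periodic_def)
    also have "\<dots> \<le> (\<integral>\<^sup>+x. N * (g x * indicator ?F x) \<partial>lborel)"
    proof (rule nn_integral_mono)
      fix x
      have "(\<integral>\<^sup>+l. g x * indicator (cball 0 R) (x + l) \<partial>count_space (lattice e)) \<le> g x * N" if "x \<in> ?F"
        using count[OF that] by (subst nn_integral_cmult) (auto intro: mult_left_mono)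
      then show "indicator ?F x * (\<integral>\<^sup>+l. g x * indicator (cball 0 R) (x + l) \<partial>count_space (lattice e))
         \<le> N * (g x * indicator ?F x)"
        by (cases "x \<in> ?F") (simp_all add: mult.commute)
    qed
    also have "\<dots> = N * (\<integral>\<^sup>+x\<in>?F. g x \<partial>lborel)"
      by (rule nn_integral_cmult) measurable
    finally show "(\<integral>\<^sup>+x\<in>cball 0 R. g x \<partial>lborel) \<le> ennreal (enn2real N) * (\<integral>\<^sup>+x\<in>?F. g x \<partial>lborel)"
      using Nfin by simp
  qed
qed


section \<open>The singular kernel\<close>

lemma nn_integral_lborel_affine:
  fixes f :: "'a::euclidean_space \<Rightarrow> ennreal"
  assumes [measurable]: "f \<in> borel_measurable borel" and c: "c > 0"
  shows "(\<integral>\<^sup>+x. f x \<partial>lborel) = ennreal (c ^ DIM('a)) * (\<integral>\<^sup>+x. f (a + c *\<^sub>R x) \<partial>lborel)"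
proof -
  have "(\<integral>\<^sup>+x. f x \<partial>lborel) =
     (\<integral>\<^sup>+x. f x \<partial>density (distr lborel borel (\<lambda>x. a + c *\<^sub>R x)) (\<lambda>_. ennreal (\<bar>c\<bar> ^ DIM('a))))"
    using c by (subst lborel_affine[of c a]) auto
  also have "\<dots> = (\<integral>\<^sup>+x. ennreal (c ^ DIM('a)) * f (a + c *\<^sub>R x) \<partial>lborel)"
    using c by (simp add: nn_integral_density nn_integral_distr)
  also have "\<dots> = ennreal (c ^ DIM('a)) * (\<integral>\<^sup>+x. f (a + c *\<^sub>R x) \<partial>lborel)"
    by (rule nn_integral_cmult) measurable
  finally show ?thesis .
qed

text \<open>The part of \<open>S\<close> shrunk by the factor \<open>1 - \<bar>z\<bar> / \<rho>\<close> towards \<open>c\<close> stays in \<open>S\<close> when it is translated by \<open>z\<close>.\<close>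

lemma emeasure_convex_minus_translate:
  fixes S :: "'a::euclidean_space set"
  assumes S: "convex S" "compact S" and c: "cball c \<rho> \<subseteq> S" and \<rho>: "\<rho> > 0"
  shows "emeasure lborel {x \<in> S. x + z \<notin> S} \<le> ennreal (DIM('a) * norm z / \<rho>) * emeasure lborel S"
proof -
  define t where "t = norm z / \<rho>"
  have [measurable]: "S \<in> sets borel"
    using S(2) by (simp add: borel_compact)
  have Sfin: "emeasure lborel S < \<infinity>"
    by (rule emeasure_bounded_finite) (rule compact_imp_bounded[OF S(2)])
  have t0: "t \<ge> 0" using \<rho> by (simp add: t_def)
  consider "z = 0" | "t \<ge> 1" | "z \<noteq> 0" "t < 1" by linarith
  then show ?thesis
  proof cases
    case 1 then show ?thesis by simp
  next
    case 2
    have "1 * 1 \<le> real DIM('a) * t"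
      using 2 DIM_positive[where 'a='a] by (intro mult_mono) (auto simp: Suc_le_eq)
    then have 1: "1 \<le> ennreal (DIM('a) * norm z / \<rho>)"
      by (simp add: t_def)
    have "emeasure lborel {x \<in> S. x + z \<notin> S} \<le> emeasure lborel S"
      by (rule emeasure_mono) auto
    also have "\<dots> \<le> ennreal (DIM('a) * norm z / \<rho>) * emeasure lborel S"
      using mult_right_mono[OF 1, of "emeasure lborel S"] by simp
    finally show ?thesis .
  next
    case 3
    have t: "0 < t" using 3 \<rho> by (simp add: t_def)
    define S' where "S' = (\<lambda>x. t *\<^sub>R c + (1 - t) *\<^sub>R x) ` S"
    have cS: "c \<in> S" using c \<rho> by auto
    have S'S: "S' \<subseteq> S"
      using cS t 3(2) by (auto simp: S'_def intro!: convexD[OF S(1)])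
    \<comment> \<open>\<open>x + z\<close> is the convex combination of \<open>y\<close> and
      \<open>c + z / t\<close> with weights \<open>1 - t\<close> and \<open>t\<close>, and
      \<open>c + z / t\<close> has distance \<rho> from \<open>c\<close>.\<close>
    have shift: "x + z \<in> S" if "x \<in> S'" for x
    proof -
      obtain y where y: "y \<in> S" "x = t *\<^sub>R c + (1 - t) *\<^sub>R y"
        using \<open>x \<in> S'\<close> by (auto simp: S'_def)
      have "norm (z /\<^sub>R t) = \<rho>"
        using 3 \<rho> by (simp add: t_def)
      then have "c + z /\<^sub>R t \<in> S"
        using c by (auto simp: dist_norm subset_iff)
      then have "(1 - t) *\<^sub>R y + t *\<^sub>R (c + z /\<^sub>R t) \<in> S"
        using y(1) t 3(2) by (intro convexD[OF S(1)]) auto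
      then show ?thesis
        using t by (simp add: y(2) scaleR_add_right algebra_simps)
    qed
    have "compact S'"
      unfolding S'_def by (rule compact_continuous_image[OF _ S(2)]) (intro continuous_intros)
    then have [measurable]: "S' \<in> sets borel" by (simp add: borel_compact)
    have "inj (\<lambda>x. t *\<^sub>R c + (1 - t) *\<^sub>R x)"
      using 3 by (auto intro: injI)
    then have ind: "indicator S' (t *\<^sub>R c + (1 - t) *\<^sub>R x) = (indicator S x :: ennreal)" for x
      unfolding S'_def indicator_def by (auto dest: injD)
    have meas: "emeasure lborel S' = ennreal ((1 - t) ^ DIM('a)) * emeasure lborel S"
      using nn_integral_lborel_affine[of "indicator S'" "1 - t" "t *\<^sub>R c"] 3 by (simp add: ind)
    have "emeasure lborel {x \<in> S. x + z \<notin> S} \<le> emeasure lborel (S - S')"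
      using shift by (intro emeasure_mono) auto
    also have "\<dots> = emeasure lborel S - emeasure lborel S'"
      using S'S Sfin by (intro emeasure_Diff) (auto simp: meas ennreal_mult_eq_top_iff)
    also have "\<dots> \<le> ennreal (DIM('a) * t) * emeasure lborel S"
    proof -
      obtain m where m: "emeasure lborel S = ennreal m" "m \<ge> 0"
        using Sfin by (cases "emeasure lborel S") auto
      \<comment> \<open>Bernoulli: the removed fraction \<open>1 - (1 - t) ^ n\<close> of the volume
        is at most \<open>n * t\<close>.\<close>
      have "1 + real DIM('a) * (- t) \<le> (1 + (- t)) ^ DIM('a)"
        using 3 t by (intro Bernoulli_inequality) auto
      then have "m - (1 - t) ^ DIM('a) * m \<le> DIM('a) * t * m"
        using mult_right_mono[OF _ m(2), of "1 - DIM('a) * t" "(1 - t) ^ DIM('a)"]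
        by (simp add: algebra_simps)
      then show ?thesis
        using m t 3 unfolding meas
        by (simp add: ennreal_mult[symmetric] ennreal_minus ennreal_leI)
    qed
    finally show ?thesis by (simp add: t_def)
  qed
qed

section \<open>Dyadic integration of the kernel\<close>

lemma power_two_bracket:
  assumes "r \<ge> (1::real)"
  obtains m :: nat where "2 ^ m \<le> r" "r \<le> 2 ^ Suc m"
proof -
  define m where "m = nat \<lfloor>log 2 r\<rfloor>"
  have *: "0 \<le> log 2 r" using assms by simp
  have "real m \<le> log 2 r" "log 2 r \<le> real (Suc m)"
    using * unfolding m_def by linarith+
  then have "2 powr real m \<le> r" "r \<le> 2 powr real (Suc m)"
    using assms by (auto simp: le_log_iff log_le_iff)
  then show thesis
    using that by (auto simp: powr_realpow simp del: of_nat_Suc power_Suc)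
qed

text \<open>Space is cut into dyadic shells, going outward from the sphere of radius
  \<open>h\<close> in the first summand and inward in the second, where
  \<open>min 1 (norm z / h)\<close> contributes \<open>1 / 2 ^ m\<close>. Replacing a shell by the
  ball that contains it costs a constant factor after integration and leaves only volumes of balls
  to compute.\<close>

lemma dyadic_kernel_bound:
  fixes z :: "'a::real_normed_vector"
  assumes a: "a > 0" and h: "h > 0"
  shows "ennreal (norm z powr (- a) * min 1 (norm z / h)) \<le>
    (\<Sum>m. ennreal ((2 ^ m * h) powr (- a)) * indicator (cball 0 (2 ^ Suc m * h)) z
       + ennreal ((h / 2 ^ Suc m) powr (- a) / 2 ^ m) * indicator (cball 0 (h / 2 ^ m)) z)"
    (is "?L \<le> (\<Sum>m. ?f m)")
proof -
  have le: "?f m \<le> (\<Sum>m. ?f m)" for m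
    using sum_le_suminf[of ?f "{m}"] by simp
  have mono: "r powr (- a) \<le> q powr (- a)" if "0 < q" "q \<le> r" for q r :: real
    using a that by (intro powr_mono2') auto
  consider "z = 0" | "z \<noteq> 0" "norm z \<ge> h" | "z \<noteq> 0" "norm z < h" by linarith
  then show ?thesis
  proof cases
    case 1 then show ?thesis by simp
  next
    case 2
    then obtain m where m: "2 ^ m \<le> norm z / h" "norm z / h \<le> 2 ^ Suc m"
      using power_two_bracket[of "norm z / h"] h by auto
    have m': "2 ^ m * h \<le> norm z" "norm z \<le> 2 ^ Suc m * h"
      using m h by (simp_all add: field_simps)
    have "norm z powr (- a) * min 1 (norm z / h) \<le> (2 ^ m * h) powr (- a) * 1"
      using m' h by (intro mult_mono mono) auto
    then have "?L \<le> ennreal ((2 ^ m * h) powr (- a)) * indicator (cball 0 (2 ^ Suc m * h)) z"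
      using m' by (simp add: ennreal_leI)
    also have "\<dots> \<le> ?f m" by simp
    finally show ?thesis using le[of m] by (rule order_trans)
  next
    case 3
    then obtain m where m: "2 ^ m \<le> h / norm z" "h / norm z \<le> 2 ^ Suc m"
      using power_two_bracket[of "h / norm z"] h by auto
    have m': "h / 2 ^ Suc m \<le> norm z" "norm z \<le> h / 2 ^ m"
      using m h 3 by (simp_all add: field_simps)
    have "norm z powr (- a) * min 1 (norm z / h) \<le> (h / 2 ^ Suc m) powr (- a) * (1 / 2 ^ m)"
    proof (intro mult_mono mono)
      show "min 1 (norm z / h) \<le> 1 / 2 ^ m"
        using m'(2) h by (intro min.coboundedI2) (simp add: field_simps)
    qed (use m' h in auto)
    then have "?L \<le> ennreal ((h / 2 ^ Suc m) powr (- a) / 2 ^ m) * indicator (cball 0 (h / 2 ^ m)) z"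
      using m' by (simp add: ennreal_leI)
    also have "\<dots> \<le> ?f m" by simp
    finally show ?thesis using le[of m] by (rule order_trans)
  qed
qed

lemma nn_integral_kernel_le:
  assumes s: "0 < s" "s < (1::real) / 2"
  obtains C :: real where "C \<ge> 0" and "\<And>h. h > 0 \<Longrightarrow>
    (\<integral>\<^sup>+z. ennreal (norm z powr (- (real DIM('a) + 2 * s)) * min 1 (norm z / h)) \<partial>(lborel :: 'a::euclidean_space measure))
      \<le> ennreal (C * h powr (- 2 * s))"
proof -
  let ?n = "DIM('a)" and ?a = "real DIM('a) + 2 * s"
  define V where "V = unit_ball_vol (real ?n)"
  \<comment> \<open>\<open>p\<close> and \<open>q\<close> are the ratios of the geometric series
    over the outer and the inner shells: a shell of radius \<open>r\<close> has volume of order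
    \<open>r ^ n\<close> and carries the weight \<open>r powr (- (n + 2 * s))\<close>, with an
    additional \<open>1 / 2 ^ m\<close> inside. Here \<open>p < 1\<close> because
    \<open>s > 0\<close>, and \<open>q < 1\<close> because \<open>s < 1 / 2\<close>.\<close>
  define p where "p = 2 powr (- 2 * s)"
  define q where "q = 2 powr (2 * s - 1)"
  have V: "V \<ge> 0" by (simp add: V_def)
  have p: "0 \<le> p" "p < 1" using s by (auto simp: p_def powr_less_one)
  have q: "0 \<le> q" "q < 1" using s by (auto simp: q_def powr_less_one)
  define D where "D m = V * 2 ^ ?n * p ^ m + V * 2 powr ?a * q ^ m" for m
  have D: "D m \<ge> 0" for m unfolding D_def using V p q by simp
  have sD: "summable D"
    unfolding D_def using p q by (intro summable_add summable_mult summable_geometric) auto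
  show thesis
  proof
    show "suminf D \<ge> 0" using D sD by (intro suminf_nonneg)
    fix h :: real assume h: "h > 0"
    define P where "P m = ennreal ((2 ^ m * h) powr (- ?a))" for m :: nat
    define Q where "Q m = ennreal ((h / 2 ^ Suc m) powr (- ?a) / 2 ^ m)" for m :: nat
    have cb: "emeasure lborel (cball (0::'a) r) = ennreal (V * r ^ ?n)" if "r \<ge> 0" for r
      using emeasure_cball[OF that] by (simp add: V_def)
    have PQ: "P m * emeasure lborel (cball (0::'a) (2 ^ Suc m * h)) +
      Q m * emeasure lborel (cball (0::'a) (h / 2 ^ m)) = ennreal (h powr (- 2 * s) * D m)" for m
    proof -
      have hn: "x ^ ?n = x powr real ?n" if "x > 0" for x :: real
        using that by (simp add: powr_realpow)
      have m2: "(2::real) ^ m = 2 powr real m" by (simp add: powr_realpow)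
      have pm: "p ^ m = 2 powr (- 2 * s * real m)"
        unfolding p_def by (simp add: powr_powr flip: powr_realpow)
      have qm: "q ^ m = 2 powr ((2 * s - 1) * real m)"
        unfolding q_def by (simp add: powr_powr flip: powr_realpow)
      have e1: "(2 ^ m * h) powr (- ?a) * (2 ^ Suc m * h) ^ ?n = h powr (- 2 * s) * 2 ^ ?n * p ^ m"
      proof -
        have "(2 ^ m * h) powr (- ?a) * (2 ^ Suc m * h) ^ ?n = 2 powr (real m * - ?a) * h powr (- ?a) *
           (2 powr real ?n * 2 powr (real m * real ?n) * h powr real ?n)"
          using h by (simp add: power_mult_distrib powr_mult hn m2 powr_powr)
        also have "\<dots> = (h powr (- ?a) * h powr real ?n) * 2 powr real ?n * (2 powr (real m * - ?a) * 2 powr (real m * real ?n))"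
          by (simp only: mult_ac)
        also have "\<dots> = h powr (- 2 * s) * 2 ^ ?n * p ^ m"
          unfolding pm by (simp add: hn algebra_simps flip: powr_add)
        finally show ?thesis .
      qed
      have e2: "(h / 2 ^ Suc m) powr (- ?a) / 2 ^ m * (h / 2 ^ m) ^ ?n = h powr (- 2 * s) * 2 powr ?a * q ^ m"
      proof -
        have "(h / 2 ^ Suc m) powr (- ?a) = h powr (- ?a) * (2 powr ?a * 2 powr (real m * ?a))"
        proof -
          have g: "(h / X) powr (- b) = h powr (- b) * X powr b" if "X > 0" for X b :: real
            using h that by (simp add: powr_divide powr_minus field_simps)
          have p: "(2 ^ Suc m :: real) powr ?a = 2 powr ?a * 2 powr (real m * ?a)"
            by (simp add: powr_mult m2 powr_powr)
          show ?thesis by (subst g, simp, simp only: p)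
        qed
        moreover have "1 / 2 ^ m = 2 powr (- real m)"
          by (simp add: m2 powr_minus field_simps)
        moreover have "(h / 2 ^ m) ^ ?n = h powr real ?n * 2 powr (- (real m * real ?n))"
          using h by (simp add: power_divide hn m2 powr_powr powr_minus field_simps)
        ultimately have "(h / 2 ^ Suc m) powr (- ?a) * (1 / 2 ^ m) * (h / 2 ^ m) ^ ?n =
          (h powr (- ?a) * h powr real ?n) * 2 powr ?a * (2 powr (real m * ?a) * 2 powr (- real m) * 2 powr (- (real m * real ?n)))"
          by (simp only: mult_ac)
        also have "\<dots> = h powr (- 2 * s) * 2 powr ?a * q ^ m"
          unfolding qm by (simp add: algebra_simps flip: powr_add)
        finally show ?thesis by simp
      qed
      have "P m * emeasure lborel (cball (0::'a) (2 ^ Suc m * h)) + Q m * emeasure lborel (cball (0::'a) (h / 2 ^ m))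
        = ennreal ((2 ^ m * h) powr (- ?a) * (2 ^ Suc m * h) ^ ?n * V + (h / 2 ^ Suc m) powr (- ?a) / 2 ^ m * (h / 2 ^ m) ^ ?n * V)"
        unfolding P_def Q_def using h V
        by (subst cb, simp, subst cb, simp, simp add: ennreal_mult[symmetric] ennreal_plus[symmetric] mult_ac del: ennreal_plus)
      also have "\<dots> = ennreal (h powr (- 2 * s) * D m)"
        unfolding e1 e2 D_def by (simp add: algebra_simps)
      finally show ?thesis .
    qed
    have "(\<integral>\<^sup>+z. ennreal (norm z powr (- ?a) * min 1 (norm z / h)) \<partial>(lborel :: 'a measure)) \<le>
      (\<integral>\<^sup>+z. (\<Sum>m. P m * indicator (cball 0 (2 ^ Suc m * h)) z + Q m * indicator (cball 0 (h / 2 ^ m)) z) \<partial>(lborel :: 'a measure))"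
      unfolding P_def Q_def using s h
      by (intro nn_integral_mono dyadic_kernel_bound) (auto intro: add_nonneg_pos)
    also have "\<dots> = (\<Sum>m. \<integral>\<^sup>+z. (P m * indicator (cball 0 (2 ^ Suc m * h)) z + Q m * indicator (cball 0 (h / 2 ^ m)) z) \<partial>(lborel :: 'a measure))"
      by (rule nn_integral_suminf) measurable
    also have "\<dots> = (\<Sum>m. P m * emeasure lborel (cball (0::'a) (2 ^ Suc m * h)) + Q m * emeasure lborel (cball (0::'a) (h / 2 ^ m)))"
      by (simp add: nn_integral_add nn_integral_cmult)
    also have "\<dots> = (\<Sum>m. ennreal (h powr (- 2 * s) * D m))"
      unfolding PQ ..
    also have "\<dots> = ennreal (suminf D * h powr (- 2 * s))"
      using D sD by (subst suminf_ennreal2) (auto simp: suminf_mult2[symmetric] suminf_mult summable_mult mult.commute[of _ "h powr _"])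
    finally show "(\<integral>\<^sup>+z. ennreal (norm z powr (- ?a) * min 1 (norm z / h)) \<partial>(lborel :: 'a measure)) \<le> ennreal (suminf D * h powr (- 2 * s))" .
  qed
qed

text \<open>A lattice vector realising the distance up to a factor 2 already gives the bound, which
  is where \<open>2 powr a\<close> comes from; so it need not be shown that the infimum is attained.
  The full lattice sum is stated because unfolding turns it into an integral over the whole
  space.\<close>

lemma torus_kernel_le:
  fixes e :: "'n::finite \<Rightarrow> 'n point"
  assumes a: "a > 0" and b: "b \<ge> 0"
  shows "ennreal (b / torus_dist e x y powr a) \<le> ennreal (2 powr a) *
    (\<integral>\<^sup>+l. ennreal (b * norm (y + l - x) powr (- a)) \<partial>count_space (lattice e))"
proof (cases "torus_dist e x y = 0")
  \<comment> \<open>At torus distance 0 the denominator is \<open>0 powr a = 0\<close>, and division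
    by 0 gives 0.\<close>
  case True then show ?thesis by simp
next
  case False
  define d where "d = torus_dist e x y"
  have d: "d > 0" using False infdist_nonneg[of "x - y" "lattice e"] by (simp add: d_def torus_dist_def)
  have "\<exists>l\<in>lattice e. dist (x - y) l < 2 * d"
  proof (rule ccontr)
    assume "\<not> ?thesis"
    then have "2 * d \<le> infdist (x - y) (lattice e)"
      unfolding infdist_notempty[OF lattice_nonempty]
      by (intro cINF_greatest lattice_nonempty) force
    then show False using d by (simp add: d_def torus_dist_def)
  qed
  then obtain l where l: "l \<in> lattice e" "norm (x - y - l) < 2 * d" by (auto simp: dist_norm)
  have "d \<le> norm (x - y - l)"
    unfolding d_def torus_dist_def using infdist_le[OF l(1), of "x - y"] by (simp add: dist_norm)
  then have pos: "norm (x - y - l) > 0" using d by linarith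
  have n: "norm (y + l - x) = norm (x - y - l)"
    by (metis diff_diff_eq norm_minus_commute)
  have "(2 * d) powr (- a) \<le> norm (x - y - l) powr (- a)"
    using a pos l(2) by (intro powr_mono2') auto
  then have "1 / d powr a \<le> 2 powr a * norm (x - y - l) powr (- a)"
    using d by (simp add: powr_mult powr_minus field_simps)
  from mult_left_mono[OF this b]
  have "ennreal (b / d powr a) \<le> ennreal (2 powr a) * ennreal (b * norm (y + l - x) powr (- a))"
    using b by (simp add: n ennreal_mult[symmetric] ennreal_leI mult_ac)
  also have "\<dots> \<le> ennreal (2 powr a) * (\<integral>\<^sup>+l. ennreal (b * norm (y + l - x) powr (- a)) \<partial>count_space (lattice e))"
    by (intro mult_left_mono nn_integral_ge_point l) simp
  finally show ?thesis by (simp add: d_def)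
qed

text \<open>Once the kernel is bounded by its lattice sum, periodicity of \<open>u\<close> lets the
  inner integral unfold to the whole space. There \<open>z = y - x\<close> can be taken as variable,
  and Tonelli moves it outside.\<close>

lemma slobodetskij_le_translates:
  fixes e :: "'n::finite \<Rightarrow> 'n point" and u :: "'n form"
  assumes e: "lattice_basis e" and u[measurable]: "u \<in> borel_measurable borel" and per: "periodic e u" and a: "a > 0"
  shows "(\<integral>\<^sup>+x\<in>fundamental_domain e. (\<integral>\<^sup>+y\<in>fundamental_domain e.
        ennreal ((norm (u x - u y))\<^sup>2 / torus_dist e x y powr a) \<partial>lborel) \<partial>lborel)
    \<le> ennreal (2 powr a) * (\<integral>\<^sup>+z. ennreal (norm z powr (- a)) *
        (\<integral>\<^sup>+x\<in>fundamental_domain e. ennreal ((norm (u (x + z) - u x))\<^sup>2) \<partial>lborel) \<partial>lborel)"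
proof -
  note [measurable] = fundamental_domain_borel[OF e]
  let ?F = "fundamental_domain e"
  let ?g = "\<lambda>x y. ennreal ((norm (u x - u y))\<^sup>2 * norm (y - x) powr (- a))"
  have inner: "(\<integral>\<^sup>+y\<in>?F. ennreal ((norm (u x - u y))\<^sup>2 / torus_dist e x y powr a) \<partial>lborel) \<le>
     ennreal (2 powr a) * (\<integral>\<^sup>+z. ?g x (x + z) \<partial>lborel)" for x
  proof -
    have "(\<integral>\<^sup>+y\<in>?F. ennreal ((norm (u x - u y))\<^sup>2 / torus_dist e x y powr a) \<partial>lborel) \<le>
      (\<integral>\<^sup>+y. indicator ?F y * (\<integral>\<^sup>+l. ennreal (2 powr a) * ?g x (y + l) \<partial>count_space (lattice e)) \<partial>lborel)"
    proof (rule nn_integral_mono)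
      fix y
      have "(\<integral>\<^sup>+l. ?g x (y + l) \<partial>count_space (lattice e)) =
        (\<integral>\<^sup>+l. ennreal ((norm (u x - u y))\<^sup>2 * norm (y + l - x) powr (- a)) \<partial>count_space (lattice e))"
        using per by (intro nn_integral_cong) (simp add: periodic_def)
      then show "ennreal ((norm (u x - u y))\<^sup>2 / torus_dist e x y powr a) * indicator ?F y \<le>
         indicator ?F y * (\<integral>\<^sup>+l. ennreal (2 powr a) * ?g x (y + l) \<partial>count_space (lattice e))"
        using torus_kernel_le[OF a, of "(norm (u x - u y))\<^sup>2" e x y]
        by (cases "y \<in> ?F") (auto simp: nn_integral_cmult)
    qed
    also have "\<dots> = (\<integral>\<^sup>+y. ennreal (2 powr a) * ?g x y \<partial>lborel)"
      by (rule nn_integral_unfold_lattice[OF e, symmetric]) measurable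
    also have "\<dots> = ennreal (2 powr a) * (\<integral>\<^sup>+y. ?g x y \<partial>lborel)"
      by (rule nn_integral_cmult) measurable
    also have "(\<integral>\<^sup>+y. ?g x y \<partial>lborel) = (\<integral>\<^sup>+z. ?g x (x + z) \<partial>lborel)"
      using nn_integral_translate[of "?g x" x] by (simp add: add.commute)
    finally show ?thesis .
  qed
  have "(\<integral>\<^sup>+x\<in>?F. (\<integral>\<^sup>+y\<in>?F. ennreal ((norm (u x - u y))\<^sup>2 / torus_dist e x y powr a) \<partial>lborel) \<partial>lborel)
    \<le> (\<integral>\<^sup>+x. ennreal (2 powr a) * (\<integral>\<^sup>+z. ?g x (x + z) * indicator ?F x \<partial>lborel) \<partial>lborel)"
  proof (rule nn_integral_mono)
    fix x
    show "(\<integral>\<^sup>+y\<in>?F. ennreal ((norm (u x - u y))\<^sup>2 / torus_dist e x y powr a) \<partial>lborel) * indicator ?F x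
      \<le> ennreal (2 powr a) * (\<integral>\<^sup>+z. ?g x (x + z) * indicator ?F x \<partial>lborel)"
      using inner[of x] by (cases "x \<in> ?F") simp_all
  qed
  also have "\<dots> = ennreal (2 powr a) * (\<integral>\<^sup>+x. (\<integral>\<^sup>+z. ?g x (x + z) * indicator ?F x \<partial>lborel) \<partial>lborel)"
    by (rule nn_integral_cmult) measurable
  also have "(\<integral>\<^sup>+x. (\<integral>\<^sup>+z. ?g x (x + z) * indicator ?F x \<partial>lborel) \<partial>lborel) =
    (\<integral>\<^sup>+z. (\<integral>\<^sup>+x. ?g x (x + z) * indicator ?F x \<partial>lborel) \<partial>lborel)"
    by (rule lborel_pair.Fubini') measurable
  also have "\<dots> = (\<integral>\<^sup>+z. ennreal (norm z powr (- a)) *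
        (\<integral>\<^sup>+x\<in>?F. ennreal ((norm (u (x + z) - u x))\<^sup>2) \<partial>lborel) \<partial>lborel)"
  proof (rule nn_integral_cong)
    fix z :: "'n point"
    have "(\<integral>\<^sup>+x. ?g x (x + z) * indicator ?F x \<partial>lborel) =
      (\<integral>\<^sup>+x. ennreal (norm z powr (- a)) * (ennreal ((norm (u (x + z) - u x))\<^sup>2) * indicator ?F x) \<partial>lborel)"
      by (intro nn_integral_cong) (simp add: ennreal_mult norm_minus_commute mult_ac)
    also have "\<dots> = ennreal (norm z powr (- a)) * (\<integral>\<^sup>+x\<in>?F. ennreal ((norm (u (x + z) - u x))\<^sup>2) \<partial>lborel)"
      by (rule nn_integral_cmult) measurable
    finally show "(\<integral>\<^sup>+x. ?g x (x + z) * indicator ?F x \<partial>lborel) = \<dots>" .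
  qed
  finally show ?thesis .
qed


section \<open>The translation estimate\<close>

text \<open>Volume comparison: if \<open>y\<close> is within \<open>R\<close> of \<open>c i\<close>,
  the ball of radius \<rho> about \<open>c i\<close> lies in the ball of radius
  \<open>R + \<rho>\<close> about \<open>y\<close>. This will bound the overlap of the enlarged
  balls around simplices. The number is written as an integral for the counting measure, so that
  finiteness need not be known beforehand.\<close>

lemma packing_count:
  fixes c :: "'i \<Rightarrow> 'a::euclidean_space"
  assumes I: "countable I" and \<rho>: "\<rho> > 0" and R: "R \<ge> 0"
    and disj: "\<And>i j. i \<in> I \<Longrightarrow> j \<in> I \<Longrightarrow> i \<noteq> j \<Longrightarrow> ball (c i) \<rho> \<inter> ball (c j) \<rho> = {}"
  shows "(\<integral>\<^sup>+i. indicator (cball (c i) R) y \<partial>count_space I) \<le> ennreal (((R + \<rho>) / \<rho>) ^ DIM('a))"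
proof -
  define V where "V = unit_ball_vol (real DIM('a))"
  have V: "V > 0" by (simp add: V_def)
  have b: "emeasure lborel (ball x \<rho>) = ennreal (V * \<rho> ^ DIM('a))" for x :: 'a
    using emeasure_ball[of \<rho> x] \<rho> by (simp add: V_def)
  have one: "(\<integral>\<^sup>+i. indicator (ball (c i) \<rho>) x \<partial>count_space I) \<le> (1::ennreal)" for x
  proof (cases "\<exists>i\<in>I. x \<in> ball (c i) \<rho>")
    case True
    then obtain i where i: "i \<in> I" "x \<in> ball (c i) \<rho>" by blast
    have "(\<integral>\<^sup>+j. indicator (ball (c j) \<rho>) x \<partial>count_space I) \<le> (\<integral>\<^sup>+j. indicator {i} j \<partial>count_space I)"
    proof (rule nn_integral_mono)
      fix j assume "j \<in> space (count_space I)"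
      then show "indicator (ball (c j) \<rho>) x \<le> (indicator {i} j :: ennreal)"
        using disj[of i j] i by (cases "i = j") (auto simp: indicator_def)
    qed
    also have "\<dots> = 1" using i(1) by (simp add: nn_integral_indicator)
    finally show ?thesis .
  next
    case False
    then have "(\<integral>\<^sup>+i. indicator (ball (c i) \<rho>) x \<partial>count_space I) = (\<integral>\<^sup>+i. 0 \<partial>count_space I)"
      by (intro nn_integral_cong) (auto simp: indicator_def)
    then show ?thesis by simp
  qed
  have "(\<integral>\<^sup>+i. indicator (cball (c i) R) y \<partial>count_space I) * ennreal (V * \<rho> ^ DIM('a)) =
    (\<integral>\<^sup>+i. (\<integral>\<^sup>+x. indicator (cball (c i) R) y * indicator (ball (c i) \<rho>) x \<partial>lborel) \<partial>count_space I)"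
    by (simp add: nn_integral_cmult nn_integral_multc b)
  also have "\<dots> = (\<integral>\<^sup>+x. (\<integral>\<^sup>+i. indicator (cball (c i) R) y * indicator (ball (c i) \<rho>) x \<partial>count_space I) \<partial>lborel)"
    by (rule nn_integral_count_space_nn_integral[OF I, symmetric]) measurable
  also have "\<dots> \<le> (\<integral>\<^sup>+x. indicator (cball y (R + \<rho>)) x \<partial>lborel)"
  proof (rule nn_integral_mono)
    fix x
    have "(\<integral>\<^sup>+i. indicator (cball (c i) R) y * indicator (ball (c i) \<rho>) x \<partial>count_space I) \<le>
      (\<integral>\<^sup>+i. indicator (cball y (R + \<rho>)) x * indicator (ball (c i) \<rho>) x \<partial>count_space I)"
    proof (rule nn_integral_mono)
      fix i
      have "dist y x \<le> R + \<rho>" if "dist (c i) y \<le> R" "dist (c i) x < \<rho>"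
        using that dist_triangle2[of y x "c i"] by (simp add: dist_commute)
      then show "indicator (cball (c i) R) y * indicator (ball (c i) \<rho>) x \<le>
        indicator (cball y (R + \<rho>)) x * (indicator (ball (c i) \<rho>) x :: ennreal)"
        by (auto simp: indicator_def)
    qed
    also have "\<dots> = indicator (cball y (R + \<rho>)) x * (\<integral>\<^sup>+i. indicator (ball (c i) \<rho>) x \<partial>count_space I)"
      by (simp add: nn_integral_cmult)
    also have "\<dots> \<le> indicator (cball y (R + \<rho>)) x * 1"
      by (intro mult_left_mono one) simp
    finally show "(\<integral>\<^sup>+i. indicator (cball (c i) R) y * indicator (ball (c i) \<rho>) x \<partial>count_space I) \<le>
      indicator (cball y (R + \<rho>)) x" by simp
  qed
  also have "\<dots> = ennreal (V * (R + \<rho>) ^ DIM('a))"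
    using R \<rho> emeasure_cball[of "R + \<rho>" y] by (simp add: V_def)
  finally have *: "(\<integral>\<^sup>+i. indicator (cball (c i) R) y \<partial>count_space I) * ennreal (V * \<rho> ^ DIM('a)) /
     ennreal (V * \<rho> ^ DIM('a)) \<le> ennreal (V * (R + \<rho>) ^ DIM('a)) / ennreal (V * \<rho> ^ DIM('a))"
    by (rule divide_right_mono_ennreal)
  have "ennreal (V * (R + \<rho>) ^ DIM('a)) / ennreal (V * \<rho> ^ DIM('a)) = ennreal (((R + \<rho>) / \<rho>) ^ DIM('a))"
    using V \<rho> R by (simp add: divide_ennreal power_divide)
  with * show ?thesis
    using V \<rho> by (simp add: ennreal_mult_divide_eq)
qed

lemma norm_diff_squared_le: "(norm (a - b))\<^sup>2 \<le> 2 * (norm a)\<^sup>2 + 2 * (norm (b::'a::real_normed_vector))\<^sup>2"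
proof -
  have "(norm (a - b))\<^sup>2 \<le> (norm a + norm b)\<^sup>2"
    by (intro power_mono norm_triangle_ineq4) simp
  also have "\<dots> \<le> 2 * (norm a)\<^sup>2 + 2 * (norm b)\<^sup>2"
    using zero_le_power2[of "norm a - norm b"] by (simp add: power2_eq_square algebra_simps)
  finally show ?thesis .
qed

lemma AE_lborel_translate:
  fixes P :: "'a::euclidean_space \<Rightarrow> bool"
  assumes "AE x in lborel. P x"
  shows "AE x in lborel. P (x + z)"
proof -
  obtain N where N: "{x. \<not> P x} \<subseteq> N" "emeasure lborel N = 0" "N \<in> sets borel"
    using AE_E[OF assms] by (metis (no_types, lifting) Collect_cong sets_lborel space_lborel UNIV_I space_borel)
  note [measurable] = N(3)
  have "(\<integral>\<^sup>+x. indicator N (x + z) \<partial>lborel) = 0"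
    using N(2) by (subst nn_integral_translate) auto
  then have "AE x in lborel. indicator N (x + z) = (0::ennreal)"
    by (subst (asm) nn_integral_0_iff_AE) auto
  then show ?thesis
    by eventually_elim (use N(1) in \<open>auto simp: indicator_def split: if_splits\<close>)
qed

text \<open>If a simplex contains both points, its Lipschitz bound applies, and
  \<open>norm z \<le> h\<close> reduces the square of \<open>norm z / h\<close> to its first power.
  Otherwise \<open>x\<close> leaves its simplex, \<open>x + z\<close> has entered another, and each
  value is charged to the simplex of its own point. The sum over all of \<open>J\<close> dominates
  the one or two terms that are used and can be integrated term by term.\<close>

lemma translation_pointwise:
  assumes J: "\<sigma> \<in> \<Sigma>" "\<sigma>' \<in> \<Sigma>" "x \<in> \<sigma>" "x + z \<in> \<sigma>'"
    and Jin: "\<And>\<tau>. \<tau> \<in> \<Sigma> \<Longrightarrow> x \<in> \<tau> \<or> x + z \<in> \<tau> \<Longrightarrow> \<tau> \<in> J"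
    and u: "\<And>\<tau>. \<tau> \<in> \<Sigma> \<Longrightarrow> x \<in> \<tau> \<Longrightarrow> u x = v \<tau> x"  "\<And>\<tau>. \<tau> \<in> \<Sigma> \<Longrightarrow> x + z \<in> \<tau> \<Longrightarrow> u (x + z) = v \<tau> (x + z)"
    and bound: "\<And>\<tau> x. \<tau> \<in> \<Sigma> \<Longrightarrow> x \<in> \<tau> \<Longrightarrow> norm (v \<tau> x) \<le> A \<tau>"
    and lip: "\<And>\<tau> x y. \<tau> \<in> \<Sigma> \<Longrightarrow> x \<in> \<tau> \<Longrightarrow> y \<in> \<tau> \<Longrightarrow> norm (v \<tau> x - v \<tau> y) \<le> A \<tau> * (norm (x - y) / h)"
    and h: "h > 0" "norm z \<le> h"
  shows "ennreal ((norm (u (x + z) - u x :: 'b::real_normed_vector))\<^sup>2) \<le>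
    (\<integral>\<^sup>+\<tau>. ennreal ((A \<tau>)\<^sup>2) * (ennreal (norm z / h) * indicator \<tau> x + 2 * indicator {x\<in>\<tau>. x + z \<notin> \<tau>} x) \<partial>count_space J) +
    (\<integral>\<^sup>+\<tau>. ennreal ((A \<tau>)\<^sup>2) * (2 * indicator {y\<in>\<tau>. y - z \<notin> \<tau>} (x + z)) \<partial>count_space (J :: 'a::real_normed_vector set set))"
    (is "_ \<le> (\<integral>\<^sup>+\<tau>. ?P \<tau> \<partial>_) + (\<integral>\<^sup>+\<tau>. ?Q \<tau> \<partial>_)")
proof (cases "\<exists>\<tau>\<in>\<Sigma>. x \<in> \<tau> \<and> x + z \<in> \<tau>")
  case True
  then obtain \<tau> where \<tau>: "\<tau> \<in> \<Sigma>" "x \<in> \<tau>" "x + z \<in> \<tau>" by blast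
  have A: "A \<tau> \<ge> 0" using bound[OF \<tau>(1,2)] norm_ge_zero order_trans by blast
  have "(norm (u (x + z) - u x))\<^sup>2 \<le> (A \<tau> * (norm z / h))\<^sup>2"
    using lip[OF \<tau>(1,3,2)] u \<tau> by (intro power_mono) auto
  also have "\<dots> = (A \<tau>)\<^sup>2 * ((norm z / h) * (norm z / h))"
    by (simp add: power2_eq_square)
  also have "\<dots> \<le> (A \<tau>)\<^sup>2 * ((norm z / h) * 1)"
    using h by (intro mult_left_mono) auto
  finally have "ennreal ((norm (u (x + z) - u x))\<^sup>2) \<le> ?P \<tau>"
    using \<tau> h by (simp add: ennreal_mult[symmetric] ennreal_leI)
  also have "\<dots> \<le> (\<integral>\<^sup>+\<tau>. ?P \<tau> \<partial>count_space J)"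
    using Jin \<tau> by (intro nn_integral_ge_point) auto
  finally show ?thesis by (simp add: add_increasing2)
next
  case False
  then have ne: "x + z \<notin> \<sigma>" "x \<notin> \<sigma>'" using J by auto
  have "(norm (u (x + z) - u x))\<^sup>2 \<le> 2 * (norm (u (x + z)))\<^sup>2 + 2 * (norm (u x))\<^sup>2"
    by (rule norm_diff_squared_le)
  also have "\<dots> \<le> 2 * (A \<sigma>')\<^sup>2 + 2 * (A \<sigma>)\<^sup>2"
    using J u bound by (intro add_mono mult_left_mono power_mono) auto
  finally have "ennreal ((norm (u (x + z) - u x))\<^sup>2) \<le> ennreal (2 * (A \<sigma>')\<^sup>2 + 2 * (A \<sigma>)\<^sup>2)"
    by (rule ennreal_leI)
  also have "\<dots> = 2 * ennreal ((A \<sigma>')\<^sup>2) + 2 * ennreal ((A \<sigma>)\<^sup>2)"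
    by (simp add: ennreal_mult)
  also have "\<dots> \<le> ?Q \<sigma>' + ?P \<sigma>"
    using J ne by (intro add_mono) (auto simp: mult.commute distrib_left)
  also have "\<dots> \<le> (\<integral>\<^sup>+\<tau>. ?Q \<tau> \<partial>count_space J) + (\<integral>\<^sup>+\<tau>. ?P \<tau> \<partial>count_space J)"
    using Jin J by (intro add_mono nn_integral_ge_point) auto
  finally show ?thesis by (simp add: add.commute)
qed

text \<open>In \<open>K\<close>, the summand 4 covers translations longer than \<open>h\<close>. In
  the other summand, \<open>1 + 4 * CARD('n) / r\<close> stems from the Lipschitz bound and from the
  points leaving or entering a simplex, the unit ball volume times the power of \<open>R\<close>
  bounds the volume of a simplex in units of \<open>h ^ CARD('n)\<close>, \<open>C\<close> is the
  constant of the inverse estimate, the power of \<open>(R + r) / r\<close> is the overlap of the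
  balls, and \<open>N\<close> compares a large ball with the fundamental domain. None of these
  depends on \<open>h\<close> itself, only on the bound \<open>H\<close>.\<close>

lemma translation_estimate:
  fixes e :: "'n::finite \<Rightarrow> 'n point" and u :: "'n form" and c :: "'n point set \<Rightarrow> 'n point" and A :: "'n point set \<Rightarrow> real"
  assumes e: "lattice_basis e" and u[measurable]: "u \<in> borel_measurable borel" and per: "periodic e u"
    and h: "0 < h" "h \<le> H" and r: "0 < r" and R: "0 < R" and C: "0 \<le> C" and N: "0 \<le> N"
    and D: "fundamental_domain e \<subseteq> cball 0 D"
    and over: "\<And>g. g \<in> borel_measurable borel \<Longrightarrow> periodic e g \<Longrightarrow>
      (\<integral>\<^sup>+x\<in>cball 0 (D + H + 2 * R * H). g x \<partial>lborel) \<le> ennreal N * (\<integral>\<^sup>+x\<in>fundamental_domain e. g x \<partial>lborel)"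
    and \<Sigma>: "countable \<Sigma>" "\<And>\<sigma>. \<sigma> \<in> \<Sigma> \<Longrightarrow> convex \<sigma>" "\<And>\<sigma>. \<sigma> \<in> \<Sigma> \<Longrightarrow> compact \<sigma>"
      "\<And>\<sigma>. \<sigma> \<in> \<Sigma> \<Longrightarrow> cball (c \<sigma>) (r * h) \<subseteq> \<sigma>" "\<And>\<sigma>. \<sigma> \<in> \<Sigma> \<Longrightarrow> \<sigma> \<subseteq> cball (c \<sigma>) (R * h)"
    and disj: "\<And>\<sigma> \<tau>. \<sigma> \<in> \<Sigma> \<Longrightarrow> \<tau> \<in> \<Sigma> \<Longrightarrow> \<sigma> \<noteq> \<tau> \<Longrightarrow> ball (c \<sigma>) (r * h) \<inter> ball (c \<tau>) (r * h) = {}"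
    and cover: "AE x in lborel. \<exists>\<sigma>\<in>\<Sigma>. x \<in> \<sigma>"
    and loc: "\<And>\<sigma>. \<sigma> \<in> \<Sigma> \<Longrightarrow> AE x in lborel. x \<in> \<sigma> \<longrightarrow> u x = v \<sigma> x"
    and bound: "\<And>\<sigma> x. \<sigma> \<in> \<Sigma> \<Longrightarrow> x \<in> \<sigma> \<Longrightarrow> norm (v \<sigma> x) \<le> A \<sigma>"
    and lip: "\<And>\<sigma> x y. \<sigma> \<in> \<Sigma> \<Longrightarrow> x \<in> \<sigma> \<Longrightarrow> y \<in> \<sigma> \<Longrightarrow> norm (v \<sigma> x - v \<sigma> y) \<le> A \<sigma> * (norm (x - y) / h)"
    and inv: "\<And>\<sigma>. \<sigma> \<in> \<Sigma> \<Longrightarrow> ennreal ((A \<sigma>)\<^sup>2 * h ^ CARD('n)) \<le>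
       ennreal C * (\<integral>\<^sup>+x\<in>cball (c \<sigma>) (R * h). ennreal ((norm (u x))\<^sup>2) \<partial>lborel)"
    and K: "K = 4 + (1 + 4 * CARD('n) / r) * unit_ball_vol CARD('n) * R ^ CARD('n) * C * ((R + r) / r) ^ CARD('n) * N"
  shows "(\<integral>\<^sup>+x\<in>fundamental_domain e. ennreal ((norm (u (x + z) - u x))\<^sup>2) \<partial>lborel) \<le>
     ennreal (K * min 1 (norm z / h)) * (\<integral>\<^sup>+x\<in>fundamental_domain e. ennreal ((norm (u x))\<^sup>2) \<partial>lborel)"
proof -
  let ?F = "fundamental_domain e" and ?n = "CARD('n)"
  note [measurable] = fundamental_domain_borel[OF e]
  let ?U = "\<integral>\<^sup>+x\<in>?F. ennreal ((norm (u x))\<^sup>2) \<partial>lborel"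
  define V where "V = unit_ball_vol ?n"
  have V: "V \<ge> 0" by (simp add: V_def)
  define K1 where "K1 = (1 + 4 * real ?n / r) * V * R ^ ?n"
  define P where "P = ((R + r) / r) ^ ?n"
  have K1: "K1 \<ge> 0" using V r R by (simp add: K1_def)
  have P: "P \<ge> 0" using r R by (simp add: P_def)
  have Keq: "K = 4 + K1 * C * P * N" by (simp add: K K1_def P_def V_def)
  have perU: "periodic e (\<lambda>x. ennreal ((norm (u x))\<^sup>2))"
    using per by (simp add: periodic_def)
  show ?thesis
  proof (cases "norm z \<le> h")
    \<comment> \<open>For a long translation the two values are estimated separately, and
      periodicity removes the shift.\<close>
    case False
    have "(\<integral>\<^sup>+x\<in>?F. ennreal ((norm (u (x + z) - u x))\<^sup>2) \<partial>lborel) \<le>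
      (\<integral>\<^sup>+x. 2 * (ennreal ((norm (u (x + z)))\<^sup>2) * indicator ?F x) + 2 * (ennreal ((norm (u x))\<^sup>2) * indicator ?F x) \<partial>lborel)"
    proof (rule nn_integral_mono)
      fix x
      have "ennreal ((norm (u (x + z) - u x))\<^sup>2) \<le> ennreal (2 * (norm (u (x + z)))\<^sup>2 + 2 * (norm (u x))\<^sup>2)"
        by (intro ennreal_leI norm_diff_squared_le)
      then show "ennreal ((norm (u (x + z) - u x))\<^sup>2) * indicator ?F x \<le>
        2 * (ennreal ((norm (u (x + z)))\<^sup>2) * indicator ?F x) + 2 * (ennreal ((norm (u x))\<^sup>2) * indicator ?F x)"
        by (cases "x \<in> ?F") (simp_all add: ennreal_mult)
    qed
    also have "\<dots> = 2 * ?U + 2 * ?U"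
      using nn_integral_periodic_translate[OF e _ perU, of z] by (simp add: nn_integral_add nn_integral_cmult)
    also have "\<dots> = ennreal 4 * ?U"
      by (simp flip: distrib_right)
    also have "\<dots> \<le> ennreal (K * min 1 (norm z / h)) * ?U"
    proof -
      have "min 1 (norm z / h) = 1" using False h by (simp add: min_def field_simps)
      moreover have "4 \<le> K" unfolding Keq using K1 C P N by simp
      ultimately show ?thesis by (intro mult_right_mono ennreal_leI) auto
    qed
    finally show ?thesis .
  next
    case True
    \<comment> \<open>If \<open>x\<close> is in the fundamental domain, then \<open>x\<close> and
      \<open>x + z\<close> have norm at most \<open>D + H\<close>, so only these simplices occur.
      The balls attached to them stay in one fixed ball, to which \<open>over\<close>
      applies.\<close>
    define J where "J = {\<sigma>\<in>\<Sigma>. \<exists>x\<in>\<sigma>. norm x \<le> D + H}"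
    have J: "countable J" "J \<subseteq> \<Sigma>" using \<Sigma>(1) by (auto simp: J_def)
    have J2: "cball (c \<sigma>) (R * h) \<subseteq> cball 0 (D + H + 2 * R * H)" if \<sigma>: "\<sigma> \<in> J" for \<sigma>
    proof
      fix y assume y: "y \<in> cball (c \<sigma>) (R * h)"
      obtain x where x: "x \<in> \<sigma>" "norm x \<le> D + H" using \<sigma> by (auto simp: J_def)
      have "x \<in> cball (c \<sigma>) (R * h)" using \<Sigma>(5)[of \<sigma>] x(1) \<sigma> J(2) by blast
      then have "dist (c \<sigma>) x \<le> R * h" by simp
      moreover have "dist y x \<le> dist (c \<sigma>) y + dist (c \<sigma>) x" by (rule dist_triangle3)
      moreover have "norm y \<le> norm x + dist y x" unfolding dist_norm by (metis add.commute norm_triangle_sub)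
      moreover have "R * h \<le> R * H" using R h by simp
      ultimately show "y \<in> cball 0 (D + H + 2 * R * H)" using x(2) y by (simp add: algebra_simps)
    qed
    have [measurable]: "\<sigma> \<in> sets borel" if "\<sigma> \<in> J" for \<sigma>
      using that J(2) \<Sigma>(3) by (auto simp: borel_compact)
    let ?P = "\<lambda>\<tau> x. ennreal ((A \<tau>)\<^sup>2) * (ennreal (norm z / h) * indicator \<tau> x + 2 * indicator {x\<in>\<tau>. x + z \<notin> \<tau>} x)"
    let ?Q = "\<lambda>\<tau> x. ennreal ((A \<tau>)\<^sup>2) * (2 * indicator {y\<in>\<tau>. y - z \<notin> \<tau>} x)"
    have [measurable]: "{x\<in>\<sigma>. x + z \<notin> \<sigma>} \<in> sets borel" "{x\<in>\<sigma>. x - z \<notin> \<sigma>} \<in> sets borel" if \<sigma>: "\<sigma> \<in> J" for \<sigma>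
    proof -
      have [measurable]: "\<sigma> \<in> sets borel" using \<sigma> by measurable
      have "{x\<in>\<sigma>. x + w \<notin> \<sigma>} = \<sigma> - ((\<lambda>x. x + w) -` \<sigma> \<inter> space borel)" for w by auto
      also have "\<dots> w \<in> sets borel" for w by measurable
      finally have *: "{x\<in>\<sigma>. x + w \<notin> \<sigma>} \<in> sets borel" for w .
      show "{x\<in>\<sigma>. x + z \<notin> \<sigma>} \<in> sets borel" "{x\<in>\<sigma>. x - z \<notin> \<sigma>} \<in> sets borel"
        using *[of z] *[of "- z"] by simp_all
    qed
    \<comment> \<open>There are countably many simplices, so the exceptional null sets can be
      united; almost every \<open>x\<close> avoids the union together with
      \<open>x + z\<close>.\<close>
    have loc': "AE x in lborel. \<forall>\<sigma>\<in>\<Sigma>. x \<in> \<sigma> \<longrightarrow> u x = v \<sigma> x"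
      using \<Sigma>(1) loc by (subst AE_ball_countable) auto
    have "AE x in lborel. x \<in> ?F \<longrightarrow> ennreal ((norm (u (x + z) - u x))\<^sup>2) \<le>
      (\<integral>\<^sup>+\<tau>. ?P \<tau> x \<partial>count_space J) + (\<integral>\<^sup>+\<tau>. ?Q \<tau> (x + z) \<partial>count_space J)"
      using cover AE_lborel_translate[OF cover, of z] loc' AE_lborel_translate[OF loc', of z]
    proof eventually_elim
      fix x
      assume x: "\<exists>\<sigma>\<in>\<Sigma>. x \<in> \<sigma>" "\<exists>\<sigma>\<in>\<Sigma>. x + z \<in> \<sigma>" "\<forall>\<sigma>\<in>\<Sigma>. x \<in> \<sigma> \<longrightarrow> u x = v \<sigma> x"
        "\<forall>\<sigma>\<in>\<Sigma>. x + z \<in> \<sigma> \<longrightarrow> u (x + z) = v \<sigma> (x + z)"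
      obtain \<sigma> \<sigma>' where \<sigma>: "\<sigma> \<in> \<Sigma>" "\<sigma>' \<in> \<Sigma>" "x \<in> \<sigma>" "x + z \<in> \<sigma>'" using x by blast
      show "x \<in> ?F \<longrightarrow> ennreal ((norm (u (x + z) - u x))\<^sup>2) \<le>
        (\<integral>\<^sup>+\<tau>. ?P \<tau> x \<partial>count_space J) + (\<integral>\<^sup>+\<tau>. ?Q \<tau> (x + z) \<partial>count_space J)"
      proof
        assume "x \<in> ?F"
        then have nx: "norm x \<le> D" using D by auto
        then have "norm x \<le> D + H" "norm (x + z) \<le> D + H"
          using h True norm_triangle_ineq[of x z] by linarith+
        then have Jin: "\<tau> \<in> J" if "\<tau> \<in> \<Sigma>" "x \<in> \<tau> \<or> x + z \<in> \<tau>" for \<tau>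
          using that unfolding J_def by blast
        show "ennreal ((norm (u (x + z) - u x))\<^sup>2) \<le>
          (\<integral>\<^sup>+\<tau>. ?P \<tau> x \<partial>count_space J) + (\<integral>\<^sup>+\<tau>. ?Q \<tau> (x + z) \<partial>count_space J)"
          by (rule translation_pointwise[OF \<sigma> Jin _ _ bound lip h(1) True]) (use x in auto)
      qed
    qed
    then have "(\<integral>\<^sup>+x\<in>?F. ennreal ((norm (u (x + z) - u x))\<^sup>2) \<partial>lborel) \<le>
      (\<integral>\<^sup>+x. (\<integral>\<^sup>+\<tau>. ?P \<tau> x \<partial>count_space J) + (\<integral>\<^sup>+\<tau>. ?Q \<tau> (x + z) \<partial>count_space J) \<partial>lborel)"
      by (intro nn_integral_mono_AE) (auto elim!: eventually_mono simp: indicator_def)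
    also have "\<dots> = (\<integral>\<^sup>+x. (\<integral>\<^sup>+\<tau>. ?P \<tau> x + ?Q \<tau> (x + z) \<partial>count_space J) \<partial>lborel)"
      by (simp add: nn_integral_add)
    also have "\<dots> = (\<integral>\<^sup>+\<tau>. (\<integral>\<^sup>+x. ?P \<tau> x + ?Q \<tau> (x + z) \<partial>lborel) \<partial>count_space J)"
      by (rule nn_integral_count_space_nn_integral[OF J(1)]) measurable
    also have "\<dots> \<le> (\<integral>\<^sup>+\<tau>. ennreal (K1 * C * (norm z / h)) *
       (\<integral>\<^sup>+x\<in>cball (c \<tau>) (R * h). ennreal ((norm (u x))\<^sup>2) \<partial>lborel) \<partial>count_space J)"
    proof (rule nn_integral_mono)
      fix \<tau> assume "\<tau> \<in> space (count_space J)"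
      then have \<tau>J: "\<tau> \<in> J" by simp
      then have \<tau>: "\<tau> \<in> \<Sigma>" using J(2) by auto
      note [measurable] = \<open>\<And>\<sigma>. \<sigma> \<in> J \<Longrightarrow> \<sigma> \<in> sets borel\<close>[OF \<tau>J]
        \<open>\<And>\<sigma>. \<sigma> \<in> J \<Longrightarrow> {x\<in>\<sigma>. x + z \<notin> \<sigma>} \<in> sets borel\<close>[OF \<tau>J]
        \<open>\<And>\<sigma>. \<sigma> \<in> J \<Longrightarrow> {x\<in>\<sigma>. x - z \<notin> \<sigma>} \<in> sets borel\<close>[OF \<tau>J]
      \<comment> \<open>Used for \<open>w = z\<close> and for \<open>w = - z\<close>: the points at
        which a simplex is entered under the translation by \<open>z\<close> are those that leave it
        under \<open>- z\<close>.\<close>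
      have sh: "emeasure lborel {x\<in>\<tau>. x + w \<notin> \<tau>} \<le> ennreal (real ?n * norm w / (r * h)) * emeasure lborel \<tau>" for w
        using emeasure_convex_minus_translate[OF \<Sigma>(2,3,4)[OF \<tau>], of w] r h by simp
      have "emeasure lborel \<tau> \<le> emeasure lborel (cball (c \<tau>) (R * h))"
        by (intro emeasure_mono \<Sigma>(5)[OF \<tau>]) simp
      also have "\<dots> = ennreal (V * R ^ ?n * h ^ ?n)"
        using emeasure_cball[of "R * h" "c \<tau>"] R h by (simp add: V_def power_mult_distrib mult.assoc)
      finally have vol: "emeasure lborel \<tau> \<le> ennreal (V * R ^ ?n * h ^ ?n)" .
      have "(\<integral>\<^sup>+x. ?P \<tau> x + ?Q \<tau> (x + z) \<partial>lborel) =
        (\<integral>\<^sup>+x. ?P \<tau> x \<partial>lborel) + (\<integral>\<^sup>+x. ?Q \<tau> (x + z) \<partial>lborel)"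
        by (rule nn_integral_add) measurable
      also have "(\<integral>\<^sup>+x. ?Q \<tau> (x + z) \<partial>lborel) = (\<integral>\<^sup>+x. ?Q \<tau> x \<partial>lborel)"
        by (rule nn_integral_translate) measurable
      also have "(\<integral>\<^sup>+x. ?P \<tau> x \<partial>lborel) + (\<integral>\<^sup>+x. ?Q \<tau> x \<partial>lborel) =
        ennreal ((A \<tau>)\<^sup>2) * (ennreal (norm z / h) * emeasure lborel \<tau> + 2 * emeasure lborel {x\<in>\<tau>. x + z \<notin> \<tau>} +
          2 * emeasure lborel {x\<in>\<tau>. x - z \<notin> \<tau>})"
        by (simp add: nn_integral_cmult nn_integral_add distrib_left add.assoc)
      also have "\<dots> \<le> ennreal ((A \<tau>)\<^sup>2) * (ennreal (norm z / h) * emeasure lborel \<tau> + 2 * (ennreal (real ?n * norm z / (r * h)) * emeasure lborel \<tau>) +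
          2 * (ennreal (real ?n * norm z / (r * h)) * emeasure lborel \<tau>))"
        using sh[of z] sh[of "- z"] by (intro mult_left_mono add_mono order_refl) auto
      also have "\<dots> = ennreal ((A \<tau>)\<^sup>2) * (ennreal (norm z / h + 4 * (real ?n * norm z / (r * h))) * emeasure lborel \<tau>)"
      proof -
        have q: "ennreal (a + 4 * b) = ennreal a + (2 * ennreal b + 2 * ennreal b)" if "a \<ge> 0" "b \<ge> 0" for a b
          using that by (simp add: ennreal_mult flip: distrib_right)
        show ?thesis
          by (subst q) (use h r in \<open>simp_all add: distrib_right mult.assoc add.assoc\<close>)
      qed
      also have "\<dots> \<le> ennreal ((A \<tau>)\<^sup>2) * (ennreal (norm z / h + 4 * (real ?n * norm z / (r * h))) * ennreal (V * R ^ ?n * h ^ ?n))"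
        by (intro mult_left_mono vol) auto
      also have "\<dots> = ennreal (K1 * (norm z / h) * ((A \<tau>)\<^sup>2 * h ^ ?n))"
      proof -
        have "norm z / h + 4 * (real ?n * norm z / (r * h)) = (1 + 4 * real ?n / r) * (norm z / h)"
          using r h by (simp add: field_simps)
        then show ?thesis
          using h r R V by (simp add: K1_def ennreal_mult[symmetric] mult_ac)
      qed
      also have "\<dots> \<le> ennreal (K1 * (norm z / h)) * (ennreal C * (\<integral>\<^sup>+x\<in>cball (c \<tau>) (R * h). ennreal ((norm (u x))\<^sup>2) \<partial>lborel))"
        using K1 h inv[OF \<tau>] by (subst ennreal_mult) (auto intro!: mult_left_mono)
      also have "\<dots> = ennreal (K1 * C * (norm z / h)) * (\<integral>\<^sup>+x\<in>cball (c \<tau>) (R * h). ennreal ((norm (u x))\<^sup>2) \<partial>lborel)"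
      proof -
        have eq: "ennreal (K1 * C * q) = ennreal (K1 * q) * ennreal C" if "q \<ge> 0" for q
          using K1 C that by (simp add: ennreal_mult mult_ac)
        show ?thesis
          by (subst eq) (use h in \<open>simp_all add: mult.assoc\<close>)
      qed
      finally show "(\<integral>\<^sup>+x. ?P \<tau> x + ?Q \<tau> (x + z) \<partial>lborel) \<le> \<dots>" .
    qed
    also have "\<dots> = ennreal (K1 * C * (norm z / h)) * (\<integral>\<^sup>+\<tau>.
       (\<integral>\<^sup>+x\<in>cball (c \<tau>) (R * h). ennreal ((norm (u x))\<^sup>2) \<partial>lborel) \<partial>count_space J)"
      by (simp add: nn_integral_cmult)
    also have "(\<integral>\<^sup>+\<tau>. (\<integral>\<^sup>+x\<in>cball (c \<tau>) (R * h). ennreal ((norm (u x))\<^sup>2) \<partial>lborel) \<partial>count_space J) =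
      (\<integral>\<^sup>+x. (\<integral>\<^sup>+\<tau>. ennreal ((norm (u x))\<^sup>2) * indicator (cball (c \<tau>) (R * h)) x \<partial>count_space J) \<partial>lborel)"
      by (rule nn_integral_count_space_nn_integral[OF J(1), symmetric]) measurable
    also have "\<dots> \<le> (\<integral>\<^sup>+x. ennreal P * (ennreal ((norm (u x))\<^sup>2) * indicator (cball 0 (D + H + 2 * R * H)) x) \<partial>lborel)"
    proof (rule nn_integral_mono)
      fix x
      have "(\<integral>\<^sup>+\<tau>. ennreal ((norm (u x))\<^sup>2) * indicator (cball (c \<tau>) (R * h)) x \<partial>count_space J) \<le>
        (\<integral>\<^sup>+\<tau>. (ennreal ((norm (u x))\<^sup>2) * indicator (cball 0 (D + H + 2 * R * H)) x) * indicator (cball (c \<tau>) (R * h)) x \<partial>count_space J)"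
      proof (rule nn_integral_mono)
        fix \<tau> assume "\<tau> \<in> space (count_space J)"
        then show "ennreal ((norm (u x))\<^sup>2) * indicator (cball (c \<tau>) (R * h)) x \<le>
          ennreal ((norm (u x))\<^sup>2) * indicator (cball 0 (D + H + 2 * R * H)) x * indicator (cball (c \<tau>) (R * h)) x"
          using J2[of \<tau>] by (cases "x \<in> cball (c \<tau>) (R * h)") auto
      qed
      also have "\<dots> = (ennreal ((norm (u x))\<^sup>2) * indicator (cball 0 (D + H + 2 * R * H)) x) *
          (\<integral>\<^sup>+\<tau>. indicator (cball (c \<tau>) (R * h)) x \<partial>count_space J)"
        by (rule nn_integral_cmult) simp
      also have "\<dots> \<le> (ennreal ((norm (u x))\<^sup>2) * indicator (cball 0 (D + H + 2 * R * H)) x) * ennreal P"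
      proof (rule mult_left_mono)
        have "(R * h + r * h) / (r * h) = (R + r) / r" using h r by (simp add: field_simps)
        then show "(\<integral>\<^sup>+\<tau>. indicator (cball (c \<tau>) (R * h)) x \<partial>count_space J) \<le> ennreal P"
          using packing_count[OF J(1), of "r * h" "R * h" c x] disj J(2) r R h
          by (simp add: P_def subset_iff)
      qed simp
      finally show "(\<integral>\<^sup>+\<tau>. ennreal ((norm (u x))\<^sup>2) * indicator (cball (c \<tau>) (R * h)) x \<partial>count_space J) \<le>
         ennreal P * (ennreal ((norm (u x))\<^sup>2) * indicator (cball 0 (D + H + 2 * R * H)) x)"
        by (simp add: mult.commute)
    qed
    also have "\<dots> = ennreal P * (\<integral>\<^sup>+x\<in>cball 0 (D + H + 2 * R * H). ennreal ((norm (u x))\<^sup>2) \<partial>lborel)"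
      by (rule nn_integral_cmult) measurable
    also have "\<dots> \<le> ennreal P * (ennreal N * ?U)"
      using perU by (intro mult_left_mono over) auto
    finally have "(\<integral>\<^sup>+x\<in>?F. ennreal ((norm (u (x + z) - u x))\<^sup>2) \<partial>lborel) \<le>
      ennreal (K1 * C * (norm z / h)) * (ennreal P * (ennreal N * ?U))"
      by (simp add: mult_left_mono)
    also have "\<dots> = ennreal (K1 * C * P * N * (norm z / h)) * ?U"
    proof -
      have eq: "ennreal (K1 * C * P * N * q) = ennreal (K1 * C * q) * (ennreal P * ennreal N)" if "q \<ge> 0" for q
        using K1 C P N that by (simp add: ennreal_mult mult_ac)
      show ?thesis
        by (subst eq) (use h in \<open>simp_all add: mult.assoc\<close>)
    qed
    also have "\<dots> \<le> ennreal (K * min 1 (norm z / h)) * ?U"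
    proof -
      have "min 1 (norm z / h) = norm z / h" using True h by (simp add: min_def field_simps)
      moreover have "K1 * C * P * N \<le> K" by (simp add: Keq)
      ultimately show ?thesis using h mult_right_mono[of "K1 * C * P * N" K "norm z / h"]
        by (intro mult_right_mono ennreal_leI) auto
    qed
    finally show ?thesis .
  qed
qed

lemma ennreal_sqrt_le:
  assumes "a \<le> ennreal m * b" "m \<ge> 0"
  shows "ennreal_sqrt a \<le> ennreal (sqrt m) * ennreal_sqrt b"
proof (cases b)
  case (real r)
  then have a: "a \<le> ennreal (m * r)" using assms by (simp add: ennreal_mult)
  then obtain q where q: "a = ennreal q" "q \<ge> 0"
    by (cases a) (auto simp: top_unique)
  have "q \<le> m * r" using a q assms(2) real by simp
  then have "sqrt q \<le> sqrt m * sqrt r" by (simp flip: real_sqrt_mult)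
  then show ?thesis
    using q real assms(2) by (simp add: ennreal_sqrt_def ennreal_mult[symmetric] ennreal_leI)
next
  case top
  show ?thesis
  proof (cases "m = 0")
    \<comment> \<open>In \<open>ennreal\<close> the product of 0 and infinity is 0, so here the
      hypothesis forces \<open>a = 0\<close>.\<close>
    case True
    then have "a = 0" using assms(1) by simp
    then show ?thesis by (simp add: ennreal_sqrt_def)
  next
    case False
    then show ?thesis using assms(2) top by (simp add: ennreal_sqrt_def ennreal_mult_top)
  qed
qed

text \<open>The factor \<open>min 1 (norm z / h)\<close> of the translation estimate makes the
  singular weight integrable, with an integral of order \<open>h powr (- 2 * s)\<close>; square
  roots then give \<open>h powr (- s)\<close>.\<close>

lemma slobodetskij_le_of_translation_estimate:
  fixes e :: "'n::finite \<Rightarrow> 'n point" and u :: "'n form"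
  assumes e: "lattice_basis e" and u[measurable]: "u \<in> borel_measurable borel" and per: "periodic e u"
    and h: "h > 0" and s: "s > 0" and K: "K \<ge> 0" and C: "C \<ge> 0"
    and trans: "\<And>z. (\<integral>\<^sup>+x\<in>fundamental_domain e. ennreal ((norm (u (x + z) - u x))\<^sup>2) \<partial>lborel) \<le>
     ennreal (K * min 1 (norm z / h)) * (\<integral>\<^sup>+x\<in>fundamental_domain e. ennreal ((norm (u x))\<^sup>2) \<partial>lborel)"
    and kernel: "(\<integral>\<^sup>+z. ennreal (norm z powr (- (real CARD('n) + 2 * s)) * min 1 (norm z / h)) \<partial>(lborel :: 'n point measure))
      \<le> ennreal (C * h powr (- 2 * s))"
  shows "slobodetskij e s u \<le> ennreal (sqrt (2 powr (real CARD('n) + 2 * s) * K * C) * h powr (- s)) * L2_norm e u"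
proof -
  let ?a = "real CARD('n) + 2 * s"
  let ?U = "\<integral>\<^sup>+x\<in>fundamental_domain e. ennreal ((norm (u x))\<^sup>2) \<partial>lborel"
  have a: "?a > 0" using s by (simp add: add_nonneg_pos)
  have "(\<integral>\<^sup>+x\<in>fundamental_domain e. (\<integral>\<^sup>+y\<in>fundamental_domain e.
        ennreal ((norm (u x - u y))\<^sup>2 / torus_dist e x y powr ?a) \<partial>lborel) \<partial>lborel)
    \<le> ennreal (2 powr ?a) * (\<integral>\<^sup>+z. ennreal (norm z powr (- ?a)) *
        (\<integral>\<^sup>+x\<in>fundamental_domain e. ennreal ((norm (u (x + z) - u x))\<^sup>2) \<partial>lborel) \<partial>lborel)"
    by (rule slobodetskij_le_translates[OF e u per a])
  also have "\<dots> \<le> ennreal (2 powr ?a) * (\<integral>\<^sup>+z. ennreal (norm z powr (- ?a) * min 1 (norm z / h)) * (ennreal K * ?U) \<partial>(lborel :: 'n point measure))"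
  proof (intro mult_left_mono nn_integral_mono)
    fix z :: "'n point"
    have "ennreal (norm z powr (- ?a)) * (\<integral>\<^sup>+x\<in>fundamental_domain e. ennreal ((norm (u (x + z) - u x))\<^sup>2) \<partial>lborel)
      \<le> ennreal (norm z powr (- ?a)) * (ennreal (K * min 1 (norm z / h)) * ?U)"
      by (intro mult_left_mono trans) simp
    also have "\<dots> = ennreal (norm z powr (- ?a) * min 1 (norm z / h)) * (ennreal K * ?U)"
    proof -
      have "min 1 (norm z / h) \<ge> 0" using h by simp
      then show ?thesis using K by (simp only: ennreal_mult powr_ge_zero mult_ac)
    qed
    finally show "ennreal (norm z powr (- ?a)) * (\<integral>\<^sup>+x\<in>fundamental_domain e. ennreal ((norm (u (x + z) - u x))\<^sup>2) \<partial>lborel) \<le> \<dots>" .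
  qed simp
  also have "\<dots> = ennreal (2 powr ?a) * ((\<integral>\<^sup>+z. ennreal (norm z powr (- ?a) * min 1 (norm z / h)) \<partial>(lborel :: 'n point measure)) * (ennreal K * ?U))"
    by (subst nn_integral_multc) auto
  also have "\<dots> \<le> ennreal (2 powr ?a) * (ennreal (C * h powr (- 2 * s)) * (ennreal K * ?U))"
    by (intro mult_left_mono mult_right_mono kernel) auto
  also have "\<dots> = ennreal (2 powr ?a * K * C * h powr (- 2 * s)) * ?U"
    using K C by (simp only: ennreal_mult powr_ge_zero mult_nonneg_nonneg mult_ac)
  finally have "slobodetskij e s u \<le> ennreal (sqrt (2 powr ?a * K * C * h powr (- 2 * s))) * L2_norm e u"
    unfolding slobodetskij_def L2_norm_def using K C by (intro ennreal_sqrt_le) auto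
  moreover have "sqrt (h powr (- 2 * s)) = h powr (- s)"
    using h by (simp add: powr_half_sqrt[symmetric] powr_powr)
  ultimately show ?thesis by (simp add: real_sqrt_mult)
qed


section \<open>Compact families of macro-elements\<close>

text \<open>The \<delta>-neighbourhood of the hull of the \<open>\<nu>' v\<close> is convex and
  contains every \<open>\<nu> v\<close>, hence their hull. It serves to pass between approximating
  and limiting simplices in both directions.\<close>

lemma convex_hull_perturb:
  fixes \<nu> \<nu>' :: "'i \<Rightarrow> 'a::real_normed_vector"
  assumes close: "\<And>v. v \<in> A \<Longrightarrow> norm (\<nu> v - \<nu>' v) \<le> \<delta>" and x: "x \<in> convex hull (\<nu> ` A)"
  shows "\<exists>y\<in>convex hull (\<nu>' ` A). norm (x - y) \<le> \<delta>"
proof -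
  let ?S = "\<Union>y\<in>convex hull (\<nu>' ` A). \<Union>w\<in>cball 0 \<delta>. {y + w}"
  have "convex ?S" by (intro convex_sums convex_convex_hull convex_cball)
  moreover have "\<nu> ` A \<subseteq> ?S"
  proof clarify
    fix v assume v: "v \<in> A"
    have "\<nu>' v \<in> convex hull (\<nu>' ` A)" using v by (simp add: hull_inc)
    moreover have "\<nu> v - \<nu>' v \<in> cball 0 \<delta>" using close[OF v] by simp
    moreover have "\<nu> v = \<nu>' v + (\<nu> v - \<nu>' v)" by simp
    ultimately show "\<nu> v \<in> ?S" by blast
  qed
  ultimately have "convex hull (\<nu> ` A) \<subseteq> ?S" by (rule hull_minimal[rotated])
  then obtain y w where "y \<in> convex hull (\<nu>' ` A)" "w \<in> cball 0 \<delta>" "x = y + w" using x by auto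
  then show ?thesis by (intro bexI[of _ y]) auto
qed

text \<open>A missing point \<open>z\<close> is separated from \<open>S\<close> by a hyperplane, and
  moving from \<open>z\<close> by \<epsilon> in the direction away from \<open>S\<close> reaches a
  point of the larger ball farther than \<epsilon> from \<open>S\<close>. This keeps a fixed ball
  inside the approximating simplices if it lies well inside the limit simplex.\<close>

lemma cball_subset_of_convex_close:
  fixes S :: "'a::euclidean_space set"
  assumes S: "convex S" "closed S" and \<epsilon>: "\<epsilon> > 0"
    and close: "\<And>p. p \<in> cball y (2 * \<epsilon>) \<Longrightarrow> \<exists>k\<in>S. norm (p - k) \<le> \<epsilon>"
  shows "cball y \<epsilon> \<subseteq> S"
proof (rule ccontr)
  assume "\<not> ?thesis"
  then obtain z where z: "z \<in> cball y \<epsilon>" "z \<notin> S" by blast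
  have "S \<noteq> {}" using close[of y] \<epsilon> by auto
  then obtain a b where ab: "a \<bullet> z < b" "\<And>x. x \<in> S \<Longrightarrow> b < a \<bullet> x"
    using separating_hyperplane_closed_point[OF S z(2)] by blast
  have a: "a \<noteq> 0" using ab \<open>S \<noteq> {}\<close> by fastforce
  define p where "p = z - (\<epsilon> / norm a) *\<^sub>R a"
  have np: "norm (z - p) = \<epsilon>" using a \<epsilon> by (simp add: p_def)
  have "dist y p \<le> dist y z + dist z p" by (rule dist_triangle)
  then have "p \<in> cball y (2 * \<epsilon>)" using z(1) np by (simp add: dist_norm)
  then obtain k where k: "k \<in> S" "norm (p - k) \<le> \<epsilon>" using close by blast
  have "a \<bullet> (k - p) \<le> norm a * norm (k - p)" by (rule norm_cauchy_schwarz)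
  also have "\<dots> \<le> norm a * \<epsilon>" using k(2) by (simp add: norm_minus_commute mult_left_mono)
  finally have "a \<bullet> k \<le> a \<bullet> p + norm a * \<epsilon>" by (simp add: inner_diff_right)
  moreover have "a \<bullet> p = a \<bullet> z - norm a * \<epsilon>"
    using a by (simp add: p_def inner_diff_right dot_square_norm power2_eq_square)
  ultimately show False using ab(1) ab(2)[OF k(1)] by simp
qed

lemma bounded_sequences_common_subsequence:
  fixes b :: "nat \<Rightarrow> nat \<Rightarrow> real"
  assumes "\<And>i. i < N \<Longrightarrow> bounded (range (\<lambda>m. b m i))"
  shows "\<exists>r \<beta>. strict_mono (r :: nat \<Rightarrow> nat) \<and> (\<forall>i<N. (\<lambda>m. b (r m) i) \<longlonglongrightarrow> \<beta> i)"
  using assms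
proof (induction N)
  case 0
  show ?case by (auto intro: exI[of _ id] strict_mono_id)
next
  case (Suc N)
  then obtain r \<beta> where r: "strict_mono (r :: nat \<Rightarrow> nat)" "\<forall>i<N. (\<lambda>m. b (r m) i) \<longlonglongrightarrow> \<beta> i"
    by fastforce
  have "bounded (range (\<lambda>m. b (r m) N))"
    using Suc.prems[of N] by (rule bounded_subset) auto
  then obtain l q where q: "strict_mono (q :: nat \<Rightarrow> nat)" "((\<lambda>m. b (r m) N) \<circ> q) \<longlonglongrightarrow> l"
    using bounded_imp_convergent_subsequence by blast
  have "(\<lambda>m. b ((r \<circ> q) m) i) \<longlonglongrightarrow> (\<beta>(N := l)) i" if "i < Suc N" for i
  proof (cases "i = N")
    case True then show ?thesis using q(2) by (simp add: o_def)
  next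
    case False
    then have "(\<lambda>m. b (r m) i) \<longlonglongrightarrow> \<beta> i" using r(2) that by simp
    from LIMSEQ_subseq_LIMSEQ[OF this q(1)] show ?thesis using False by (simp add: o_def)
  qed
  then show ?case using strict_mono_o[OF r(1) q(1)] by blast
qed

lemma interior_simplex_nonempty:
  fixes \<nu> :: "'i \<Rightarrow> 'a::euclidean_space"
  assumes "\<not> affine_dependent (\<nu> ` A)" "inj_on \<nu> A" "card A = Suc DIM('a)"
  shows "interior (convex hull (\<nu> ` A)) \<noteq> {}"
proof -
  have c: "card (\<nu> ` A) = Suc DIM('a)" using assms by (simp add: card_image)
  then have "affine hull (\<nu> ` A) = UNIV"
    using affine_independent_span_eq[OF assms(1)] by simp
  then have "rel_interior (convex hull (\<nu> ` A)) = interior (convex hull (\<nu> ` A))"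
    by (intro rel_interior_interior) simp
  moreover have "rel_interior (convex hull (\<nu> ` A)) \<noteq> {}"
    using c by (subst rel_interior_eq_empty) auto
  ultimately show ?thesis by simp
qed

text \<open>The source of all constants: if no bound served the whole family, data violating the
  bounds \<open>m\<close> would have a convergent subsequence, along which some fixed bound
  eventually holds.\<close>

lemma compact_macro_uniform:
  assumes K: "compact_macro_family \<tau> K"
    and mono: "\<And>D B B'. P D B \<Longrightarrow> B \<le> B' \<Longrightarrow> P D B'"
    and ev: "\<And>D D'. D' \<in> K \<Longrightarrow> macro_convergence \<tau> D D' \<Longrightarrow> \<exists>B::real. eventually (\<lambda>m. P (D m) B) sequentially"
  shows "\<exists>B. \<forall>D\<in>K. P D B"
proof (rule ccontr)
  assume "\<not> ?thesis"
  then have "\<forall>m::nat. \<exists>D\<in>K. \<not> P D (real m)" by metis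
  then obtain D where D: "\<And>m::nat. D m \<in> K" "\<And>m. \<not> P (D m) (real m)" by metis
  obtain D' r where r: "D' \<in> K" "strict_mono r" "macro_convergence \<tau> (D \<circ> r) D'"
    using K D(1) unfolding compact_macro_family_def by blast
  obtain B where B: "eventually (\<lambda>m. P ((D \<circ> r) m) B) sequentially" using ev[OF r(1,3)] by blast
  have "eventually (\<lambda>m. B \<le> real m) sequentially"
    by (rule eventually_sequentiallyI[of "nat \<lceil>B\<rceil>"]) linarith
  with B have "eventually (\<lambda>m. False) sequentially"
  proof eventually_elim
    case (elim m)
    have "real m \<le> real (r m)" using seq_suble[OF r(2), of m] by simp
    then show ?case using mono[OF elim(1), of "real (r m)"] D(2)[of "r m"] elim(2) by simp
  qed
  then show False by simp
qed

lemma uniform_bound_finite: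
  assumes "finite I" and "\<And>i. i \<in> I \<Longrightarrow> \<exists>B. P i B" and "\<And>i B B'. P i B \<Longrightarrow> B \<le> B' \<Longrightarrow> P i (B'::real)"
  shows "\<exists>B\<ge>0. \<forall>i\<in>I. P i B"
proof -
  obtain f where f: "\<And>i. i \<in> I \<Longrightarrow> P i (f i)" using assms(2) by metis
  have "f i \<le> (\<Sum>i\<in>I. \<bar>f i\<bar>)" if "i \<in> I" for i
    using member_le_sum[of i I "\<lambda>i. \<bar>f i\<bar>"] assms(1) that by auto
  then have "P i (\<Sum>i\<in>I. \<bar>f i\<bar>)" if "i \<in> I" for i using f assms(3) that by blast
  then show ?thesis by (intro exI[of _ "\<Sum>i\<in>I. \<bar>f i\<bar>"]) (auto intro: sum_nonneg)
qed

lemma smooth_partial_continuous: "smooth f \<Longrightarrow> continuous_on S (partial is f)"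
  by (simp add: smooth_def continuous_at_imp_continuous_on differentiable_imp_continuous_within)

text \<open>A type has finitely many vertices, and the positions of each are bounded over the family
  since convergent sequences are bounded.\<close>

lemma macro_realization_bounded:
  fixes K :: "'n::{finite,linorder} macro_datum set"
  assumes K: "compact_macro_family (Cs, N) K" and t: "is_macro_type (Cs, N)"
  shows "\<exists>R\<ge>0. \<forall>\<nu> f. (\<nu>, f) \<in> K \<longrightarrow> (\<forall>c\<in>Cs. realization \<nu> c \<subseteq> cball 0 R)"
proof -
  have fin: "finite (\<Union>(\<Union>Cs))" using t by (auto simp: is_macro_type_def)
  have "\<exists>R. \<forall>D\<in>K. norm (fst D v) \<le> R" if v: "v \<in> \<Union>(\<Union>Cs)" for v
  proof (rule compact_macro_uniform[OF K])
    fix D and D' :: "'n macro_datum" assume "macro_convergence (Cs, N) D D'"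
    then have "(\<lambda>m. fst (D m) v) \<longlonglongrightarrow> fst D' v"
      using v unfolding macro_convergence_def case_prod_beta fst_conv by blast
    then have "Bseq (\<lambda>m. fst (D m) v)" by (rule convergent_imp_Bseq[OF convergentI])
    then show "\<exists>R. eventually (\<lambda>m. norm (fst (D m) v) \<le> R) sequentially"
      unfolding Bseq_def by (auto intro: always_eventually)
  qed auto
  then have "\<exists>R\<ge>0. \<forall>v\<in>\<Union>(\<Union>Cs). \<forall>D\<in>K. norm (fst D v) \<le> R"
    by (rule uniform_bound_finite[OF fin]) force+
  then obtain R where R: "R \<ge> 0" "\<forall>v\<in>\<Union>(\<Union>Cs). \<forall>D\<in>K. norm (fst D v) \<le> R"
    by (elim exE conjE)
  have "realization \<nu> c \<subseteq> cball 0 R" if D: "(\<nu>, f) \<in> K" and c: "c \<in> Cs" for \<nu> f c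
    unfolding realization_def
  proof (rule UN_least)
    fix A assume A: "A \<in> c"
    have "\<nu> ` A \<subseteq> cball 0 R"
    proof clarify
      fix v assume "v \<in> A"
      then have "v \<in> \<Union>(\<Union>Cs)" using A c by blast
      from R(2)[rule_format, OF this D] show "\<nu> v \<in> cball 0 R" by simp
    qed
    then show "convex hull (\<nu> ` A) \<subseteq> cball 0 R"
      by (rule hull_minimal) (rule convex_cball)
  qed
  then show ?thesis using R(1) by blast
qed

text \<open>The empty list yields bounds for the basis forms themselves and one-element lists yield
  bounds for their first derivatives, hence Lipschitz constants on the ball.\<close>

lemma macro_partial_bounded:
  fixes K :: "'n::{finite,linorder} macro_datum set"
  assumes K: "compact_macro_family (Cs, N) K" and ci: "c \<in> Cs" "i < N c k"
  shows "\<exists>B. \<forall>D\<in>K. \<forall>x\<in>cball 0 R. norm (partial is (snd D c k i) x) \<le> B"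
proof (rule compact_macro_uniform[OF K])
  fix D and D' :: "'n macro_datum" assume D': "D' \<in> K" and conv: "macro_convergence (Cs, N) D D'"
  have lim: "uniform_limit (cball 0 R) (\<lambda>m. partial is (snd (D m) c k i)) (partial is (snd D' c k i)) sequentially"
    using conv ci unfolding macro_convergence_def smooth_convergence_def case_prod_beta by simp
  have "smooth (snd D' c k i)"
    using K D' ci unfolding compact_macro_family_def is_macro_datum_def by (auto simp: case_prod_beta)
  then have "bounded (partial is (snd D' c k i) ` cball 0 R)"
    by (intro compact_imp_bounded compact_continuous_image smooth_partial_continuous) auto
  then obtain B where B: "\<And>x. x \<in> cball 0 R \<Longrightarrow> norm (partial is (snd D' c k i) x) \<le> B"
    unfolding bounded_iff by blast
  have "eventually (\<lambda>m. \<forall>x\<in>cball 0 R. dist (partial is (snd (D m) c k i) x) (partial is (snd D' c k i) x) < 1) sequentially"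
    using lim by (rule uniform_limitD) simp
  then have "eventually (\<lambda>m. \<forall>x\<in>cball 0 R. norm (partial is (snd (D m) c k i) x) \<le> B + 1) sequentially"
  proof eventually_elim
    case (elim m)
    show ?case
    proof
      fix x :: "'n point" assume x: "x \<in> cball 0 R"
      have "norm (partial is (snd (D m) c k i) x) \<le> norm (partial is (snd D' c k i) x)
         + dist (partial is (snd (D m) c k i) x) (partial is (snd D' c k i) x)"
        unfolding dist_norm by (metis add.commute norm_triangle_sub)
      then show "norm (partial is (snd (D m) c k i) x) \<le> B + 1"
        using B[OF x] elim x by fastforce
    qed
  qed
  then show "\<exists>B. eventually (\<lambda>m. \<forall>x\<in>cball 0 R. norm (partial is (snd (D m) c k i) x) \<le> B) sequentially" by blast
qed force

text \<open>Mean value inequality; the factor \<open>CARD('n)\<close> comes from expanding a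
  direction in coordinates, each of absolute value at most the norm.\<close>

lemma smooth_lipschitz_of_partial_bound:
  fixes f :: "'n::finite point \<Rightarrow> 'b::real_normed_vector" and B :: real
  assumes f: "smooth f" and S: "convex S" and B: "\<And>j x. x \<in> S \<Longrightarrow> norm (partial [j] f x) \<le> B"
    and xy: "x \<in> S" "y \<in> S"
  shows "norm (f x - f y) \<le> (CARD('n) * B) * norm (x - y)"
proof (rule differentiable_bound[where f' = "\<lambda>x. frechet_derivative f (at x)", OF S _ _ xy])
  fix x assume x: "x \<in> S"
  have "partial [] f differentiable (at x)" using f unfolding smooth_def by blast
  then have d: "(f has_derivative frechet_derivative f (at x)) (at x)"
    by (simp add: frechet_derivative_works)
  then show "(f has_derivative frechet_derivative f (at x)) (at x within S)"
    by (rule has_derivative_at_withinI)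
  have lin: "linear (frechet_derivative f (at x))"
    using d has_derivative_linear by blast
  show "onorm (frechet_derivative f (at x)) \<le> CARD('n) * B"
  proof (rule onorm_le)
    fix w :: "'n point"
    have "frechet_derivative f (at x) w = frechet_derivative f (at x) (\<Sum>j\<in>UNIV. (w $ j) *\<^sub>R axis j 1)"
      by (simp add: basis_expansion flip: scalar_mult_eq_scaleR)
    also have "\<dots> = (\<Sum>j\<in>UNIV. (w $ j) *\<^sub>R partial [j] f x)"
      using lin by (simp add: linear_sum linear_scale)
    also have "norm \<dots> \<le> (\<Sum>j\<in>UNIV. norm ((w $ j) *\<^sub>R partial [j] f x))"
      by (rule norm_sum)
    also have "\<dots> \<le> (\<Sum>j\<in>(UNIV::'n set). norm w * B)"
      using B[OF x] component_le_norm_cart[of w] by (intro sum_mono) (simp add: mult_mono del: partial.simps)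
    finally show "norm (frechet_derivative f (at x) w) \<le> real CARD('n) * B * norm w"
      by (simp add: mult_ac)
  qed
qed

section \<open>Ambient forms and their pullbacks\<close>

lemma pullback_alt_sum:
  "(\<Sum>i\<in>I. c i *\<^sub>R pullback_alt A (w i)) = pullback_alt A (\<Sum>i\<in>I. c i *\<^sub>R w i)"
  by (simp add: pullback_alt_def vec_eq_iff sum_distrib_left sum_distrib_right sum.swap[of _ I] mult.assoc)

lemma tangent_at_imp_mem: "tangent_at T x V \<Longrightarrow> x \<in> T"
proof -
  assume "tangent_at T x V"
  then obtain \<epsilon> where "subspace V" "\<epsilon> > 0" "T \<inter> ball x \<epsilon> = (+) x ` V \<inter> ball x \<epsilon>"
    by (auto simp: tangent_at_def)
  moreover have "x \<in> (+) x ` V" using subspace_0[OF \<open>subspace V\<close>] by force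
  ultimately show "x \<in> T" by (metis IntD1 IntI centre_in_ball)
qed

text \<open>Independence of a basis is given for the pullbacks, while limits are taken of ambient
  forms. A combination of the latter that vanishes on the set also vanishes for the former, whose
  values are 0 by convention where there is no tangent space.\<close>

lemma pullback_to_sum_eq_0:
  assumes "\<And>x. x \<in> T \<Longrightarrow> (\<Sum>i\<in>I. c i *\<^sub>R f i x) = 0"
  shows "(\<Sum>i\<in>I. c i *\<^sub>R pullback_to T (f i) x) = 0"
proof (cases "\<exists>V. tangent_at T x V")
  case True
  then have "(\<Sum>i\<in>I. c i *\<^sub>R f i x) = 0" using assms tangent_at_imp_mem by blast
  then show ?thesis
    using True by (simp add: pullback_to_def pullback_alt_sum) (simp add: pullback_alt_def vec_eq_iff)
next
  case False
  have "pullback_to T (f i) x = 0" for i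
    unfolding pullback_to_def by (rule if_not_P) (rule False)
  then show ?thesis by simp
qed

text \<open>Purity of a cell in terms of vertex sets. Neither interiors nor charts occur, and the
  number of vertices of a simplex does not change when the vertices move, so the property can be
  carried to a limit datum, which is not known to be made of cells.\<close>

definition covered_by_full_simplices :: "('i \<Rightarrow> 'n::finite point) \<Rightarrow> 'i set set \<Rightarrow> bool" where
  "covered_by_full_simplices \<nu> c \<longleftrightarrow>
     (\<Union>A\<in>c. convex hull (\<nu> ` A)) \<subseteq> (\<Union>A\<in>{A\<in>c. card A = Suc CARD('n)}. convex hull (\<nu> ` A))"

text \<open>A point of the limit is moved to a nearby point of an approximating cell, which lies in
  a simplex with \<open>CARD('n) + 1\<close> vertices, and from there into the limit of that
  simplex. The simplex may change with the accuracy, but the union of the finitely many candidates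
  is closed.\<close>

lemma covered_by_full_simplices_limit:
  fixes \<nu>' :: "'i \<Rightarrow> 'n::finite point"
  assumes fin: "finite c" "\<And>A. A \<in> c \<Longrightarrow> finite A"
    and cov: "\<And>m. covered_by_full_simplices (\<nu> m) c"
    and lim: "\<And>A v. A \<in> c \<Longrightarrow> v \<in> A \<Longrightarrow> (\<lambda>m. \<nu> m v) \<longlonglongrightarrow> \<nu>' v"
  shows "covered_by_full_simplices \<nu>' c"
proof -
  let ?W = "\<Union>A\<in>{A\<in>c. card A = Suc CARD('n)}. convex hull (\<nu>' ` A)"
  have "closed ?W"
    using fin by (intro closed_UN ballI compact_imp_closed compact_convex_hull finite_imp_compact) auto
  moreover have "x \<in> closure ?W" if B: "B \<in> c" "x \<in> convex hull (\<nu>' ` B)" for x B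
    unfolding closure_approachable
  proof (intro allI impI)
    fix \<epsilon> :: real assume \<epsilon>: "\<epsilon> > 0"
    have "eventually (\<lambda>m. \<forall>A\<in>c. \<forall>v\<in>A. dist (\<nu> m v) (\<nu>' v) < \<epsilon> / 3) sequentially"
      using fin lim \<epsilon> by (intro eventually_ball_finite ballI tendstoD) auto
    then obtain m where "\<forall>A\<in>c. \<forall>v\<in>A. dist (\<nu> m v) (\<nu>' v) < \<epsilon> / 3"
      using eventually_happens'[OF sequentially_bot] by blast
    then have m: "norm (\<nu> m v - \<nu>' v) \<le> \<epsilon> / 3" if "A \<in> c" "v \<in> A" for A v
      using that by (force simp: dist_norm)
    obtain y where y: "y \<in> convex hull (\<nu> m ` B)" "norm (x - y) \<le> \<epsilon> / 3"
      using convex_hull_perturb[OF _ B(2), of "\<nu> m" "\<epsilon> / 3"] m[OF B(1)] by (auto simp: norm_minus_commute)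
    obtain A where A: "A \<in> c" "card A = Suc CARD('n)" "y \<in> convex hull (\<nu> m ` A)"
      using cov[of m] y(1) B(1) unfolding covered_by_full_simplices_def by blast
    obtain z where z: "z \<in> convex hull (\<nu>' ` A)" "norm (y - z) \<le> \<epsilon> / 3"
      using convex_hull_perturb[OF _ A(3), of "\<nu>'" "\<epsilon> / 3"] m[OF A(1)] by auto
    have "dist z x \<le> norm (x - y) + norm (y - z)"
      using norm_triangle_ineq[of "x - y" "y - z"] by (simp add: dist_norm norm_minus_commute)
    then have "dist z x < \<epsilon>" using y(2) z(2) \<epsilon> by linarith
    then show "\<exists>z\<in>?W. dist z x < \<epsilon>" using A z(1) by blast
  qed
  ultimately show ?thesis unfolding covered_by_full_simplices_def by auto
qed

lemma uniform_limit_sum: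
  fixes f :: "'i \<Rightarrow> 'a \<Rightarrow> 'b \<Rightarrow> 'c::real_normed_vector"
  assumes "\<And>i. i \<in> I \<Longrightarrow> uniform_limit X (f i) (l i) F"
  shows "uniform_limit X (\<lambda>n x. \<Sum>i\<in>I. f i n x) (\<lambda>x. \<Sum>i\<in>I. l i x) F"
  using assms by (induction I rule: infinite_finite_induct) (auto intro!: uniform_limit_add uniform_limit_const)

text \<open>Equivalence of norms on a finite dimensional space, made uniform although both the
  domain and the basis vary. Convergence of the integrals is not established: it is enough to bound
  them below on one small ball that eventually lies in all the domains.\<close>

lemma macro_lower_bound:
  fixes K :: "'n::{finite,linorder} macro_datum set"
  assumes K: "compact_macro_family (Cs, N) K" and t: "is_macro_type (Cs, N)" and c: "c \<in> Cs"
  shows "\<exists>C\<ge>0. \<forall>\<nu> f b. (\<nu>, f) \<in> K \<longrightarrow> covered_by_full_simplices \<nu> c \<longrightarrow>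
    ennreal ((\<Sum>i<N c k. \<bar>b i\<bar>)\<^sup>2) \<le> ennreal C *
      (\<integral>\<^sup>+x\<in>interior (realization \<nu> c). ennreal ((norm (\<Sum>i<N c k. b i *\<^sub>R f c k i x))\<^sup>2) \<partial>lborel)"
    (is "\<exists>C\<ge>0. \<forall>\<nu> f b. _ \<longrightarrow> _ \<longrightarrow> ?S b \<le> ennreal C * ?I \<nu> f b")
proof (rule ccontr)
  let ?N = "N c k"
  assume neg: "\<not> ?thesis"
  define Q where "Q m \<nu> f b \<longleftrightarrow> (\<nu>, f) \<in> K \<and> covered_by_full_simplices \<nu> c \<and>
    \<not> ?S b \<le> ennreal (real m) * ?I \<nu> f b" for m \<nu> f b
  have "\<exists>\<nu> f b. Q m \<nu> f b" for m
    using neg of_nat_0_le_iff[of m] unfolding Q_def by blast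
  then obtain \<nu> f b where Q: "\<And>m. Q m (\<nu> m) (f m) (b m)" by metis
  have D: "\<And>m. (\<nu> m, f m) \<in> K" "\<And>m. covered_by_full_simplices (\<nu> m) c"
    "\<And>m::nat. \<not> ?S (b m) \<le> ennreal (real m) * ?I (\<nu> m) (f m) (b m)"
    using Q unfolding Q_def by simp_all
  define s where "s m = (\<Sum>i<?N. \<bar>b m i\<bar>)" for m
  \<comment> \<open>For vanishing coefficients the estimate is trivial, so coefficients violating it
    can be normalised.\<close>
  have s: "s m > 0" for m
  proof (rule ccontr)
    assume "\<not> s m > 0"
    moreover have "s m \<ge> 0" by (simp add: s_def sum_nonneg)
    ultimately have "s m = 0" by simp
    then show False using D(3)[of m] by (simp add: s_def)
  qed
  define b' where "b' m i = b m i / s m" for m i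
  have sum1: "(\<Sum>i<?N. \<bar>b' m i\<bar>) = 1" for m
  proof -
    have "(\<Sum>i<?N. \<bar>b' m i\<bar>) = s m / s m"
      using s[of m] by (simp add: b'_def abs_divide s_def sum_divide_distrib[symmetric])
    then show ?thesis using s[of m] by simp
  qed
  let ?g = "\<lambda>m x. \<Sum>i<?N. b' m i *\<^sub>R f m c k i x"
  have small: "ennreal (real m) * (\<integral>\<^sup>+x\<in>interior (realization (\<nu> m) c). ennreal ((norm (?g m x))\<^sup>2) \<partial>lborel) < 1" for m
  proof -
    have fs: "smooth (f m c k i)" if "i < ?N" for i
      using K D(1)[of m] c that unfolding compact_macro_family_def is_macro_datum_def by fastforce
    have fm: "f m c k i \<in> borel_measurable borel" if "i < ?N" for i
      using smooth_partial_continuous[OF fs[OF that], of UNIV "[]"] by (intro borel_measurable_continuous_onI) simp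
    have [measurable]: "?g m \<in> borel_measurable borel"
      using fm by (intro borel_measurable_sum borel_measurable_scaleR) auto
    have "?I (\<nu> m) (f m) (b m) = (\<integral>\<^sup>+x. ennreal ((s m)\<^sup>2) * (ennreal ((norm (?g m x))\<^sup>2) * indicator (interior (realization (\<nu> m) c)) x) \<partial>lborel)"
    proof (rule nn_integral_cong)
      fix x
      have "(\<Sum>i<?N. b m i *\<^sub>R f m c k i x) = s m *\<^sub>R ?g m x"
        using s[of m] by (simp add: b'_def scaleR_sum_right)
      then have "(norm (\<Sum>i<?N. b m i *\<^sub>R f m c k i x))\<^sup>2 = (s m)\<^sup>2 * (norm (?g m x))\<^sup>2"
        by (simp add: power_mult_distrib)
      then show "ennreal ((norm (\<Sum>i<?N. b m i *\<^sub>R f m c k i x))\<^sup>2) * indicator (interior (realization (\<nu> m) c)) x =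
        ennreal ((s m)\<^sup>2) * (ennreal ((norm (?g m x))\<^sup>2) * indicator (interior (realization (\<nu> m) c)) x)"
        by (simp add: ennreal_mult mult.assoc)
    qed
    also have "\<dots> = ennreal ((s m)\<^sup>2) * (\<integral>\<^sup>+x\<in>interior (realization (\<nu> m) c). ennreal ((norm (?g m x))\<^sup>2) \<partial>lborel)"
      by (rule nn_integral_cmult) measurable
    finally have I: "?I (\<nu> m) (f m) (b m) = \<dots>" .
    show ?thesis
    proof (rule ccontr)
      assume "\<not> ?thesis"
      then have "ennreal ((s m)\<^sup>2) * 1 \<le> ennreal ((s m)\<^sup>2) * (ennreal (real m) * (\<integral>\<^sup>+x\<in>interior (realization (\<nu> m) c). ennreal ((norm (?g m x))\<^sup>2) \<partial>lborel))"
        by (intro mult_left_mono) auto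
      then show False using D(3)[of m] unfolding I by (simp add: s_def mult.left_commute)
    qed
  qed
  \<comment> \<open>Compactness of the family yields a limit of vertex positions and bases along
    \<open>r\<close>; the subsequence \<open>q\<close> below makes the normalised coefficients
    converge as well.\<close>
  obtain D' r where r: "D' \<in> K" "strict_mono r" "macro_convergence (Cs, N) ((\<lambda>m. (\<nu> m, f m)) \<circ> r) D'"
    using conjunct2[OF K[unfolded compact_macro_family_def], rule_format, of "\<lambda>m. (\<nu> m, f m)"] D(1) by blast
  obtain \<nu>' f' where D': "D' = (\<nu>', f')" by (cases D')
  have conv\<nu>: "(\<lambda>m. \<nu> (r m) v) \<longlonglongrightarrow> \<nu>' v" if "v \<in> A" "A \<in> c" for v A
    using r(3) that c unfolding D' macro_convergence_def by (auto simp: o_def)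
  have convf: "uniform_limit (cball 0 R) (\<lambda>m. f (r m) c k i) (f' c k i) sequentially" if "i < ?N" for R i
  proof -
    have "smooth_convergence (\<lambda>m. f (r m) c k i) (f' c k i)"
      using r(3) that c unfolding D' macro_convergence_def by (auto simp: o_def)
    then have "uniform_limit (cball 0 R) (\<lambda>m. partial [] (f (r m) c k i)) (partial [] (f' c k i)) sequentially"
      unfolding smooth_convergence_def by blast
    then show ?thesis by simp
  qed
  have f's: "smooth (f' c k i)" if "i < ?N" for i
    using K r(1) c that unfolding D' compact_macro_family_def is_macro_datum_def by fastforce
  have f'c: "continuous_on S (f' c k i)" if "i < ?N" for i S
    using smooth_partial_continuous[OF f's[OF that], of S "[]"] by simp
  have inj: "inj_on \<nu>' A" "\<not> affine_dependent (\<nu>' ` A)" if "A \<in> c" for A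
    using K r(1) c that unfolding D' compact_macro_family_def is_macro_datum_def by fastforce+
  have indep: "form_independent ?N (\<lambda>i. pullback_to (realization \<nu>' c) (f' c k i))"
    using K r(1) c unfolding D' compact_macro_family_def is_macro_datum_def by fastforce
  have fin: "finite c" "\<And>A. A \<in> c \<Longrightarrow> finite A"
    using t c by (auto simp: is_macro_type_def)
  have "bounded (range (\<lambda>m. b' (r m) i))" if "i < ?N" for i
  proof -
    have "\<bar>b' m i\<bar> \<le> 1" for m
      using member_le_sum[of i "{..<?N}" "\<lambda>i. \<bar>b' m i\<bar>"] that sum1[of m] by auto
    then show ?thesis by (auto simp: bounded_iff)
  qed
  then obtain q \<beta> where q: "strict_mono (q :: nat \<Rightarrow> nat)" "\<forall>i<?N. (\<lambda>m. b' (r (q m)) i) \<longlonglongrightarrow> \<beta> i"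
    using bounded_sequences_common_subsequence[of ?N "\<lambda>m. b' (r m)"] by blast
  define p where "p = r \<circ> q"
  have p: "strict_mono p" unfolding p_def using r(2) q(1) by (rule strict_mono_o)
  have conv\<nu>p: "(\<lambda>m. \<nu> (p m) v) \<longlonglongrightarrow> \<nu>' v" if "v \<in> A" "A \<in> c" for v A
    using LIMSEQ_subseq_LIMSEQ[OF conv\<nu>[OF that] q(1)] by (simp add: p_def o_def)
  let ?g' = "\<lambda>x. \<Sum>i<?N. \<beta> i *\<^sub>R f' c k i x"
  have g'c: "continuous_on S ?g'" for S
    using f'c by (intro continuous_intros) auto
  have convg: "uniform_limit (cball 0 R) (\<lambda>m. ?g (p m)) ?g' sequentially" for R
  proof (rule uniform_limit_sum)
    fix i assume "i \<in> {..<?N}"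
    then have i: "i < ?N" by simp
    have 1: "uniform_limit (cball 0 R) (\<lambda>m. f (p m) c k i) (f' c k i) sequentially"
      unfolding uniform_limit_iff p_def o_def
    proof (intro allI impI)
      fix \<epsilon> :: real assume "\<epsilon> > 0"
      from eventually_subseq[OF q(1) uniform_limitD[OF convf[OF i, of R] this]]
      show "\<forall>\<^sub>F m in sequentially. \<forall>x\<in>cball 0 R. dist (f (r (q m)) c k i x) (f' c k i x) < \<epsilon>" .
    qed
    have 2: "uniform_limit (cball 0 R) (\<lambda>m x. b' (p m) i) (\<lambda>x. \<beta> i) sequentially"
      unfolding uniform_limit_iff p_def o_def using q(2) i by (auto dest: tendstoD elim: eventually_mono)
    have "bounded (f' c k i ` cball 0 R)"
      using f'c[OF i] by (intro compact_imp_bounded compact_continuous_image) auto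
    moreover have "bounded ((\<lambda>x. \<beta> i) ` cball (0::'n point) R)"
      by (rule finite_imp_bounded) (auto intro: finite_subset[of _ "{\<beta> i}"])
    ultimately show "uniform_limit (cball 0 R) (\<lambda>m x. b' (p m) i *\<^sub>R f (p m) c k i x) (\<lambda>x. \<beta> i *\<^sub>R f' c k i x) sequentially"
      using bounded_bilinear.bounded_uniform_limit[OF bounded_bilinear_scaleR 2 1] by blast
  qed
  \<comment> \<open>If the limit combination were non-zero at \<open>y\<close>, the approximating
    combinations would be bounded below on a ball about \<open>y\<close> that is contained in their
    cells for large \<open>m\<close>. Their integrals would then stay above \<delta>, contrary to
    \<open>small\<close>.\<close>
  have zero_int: "?g' y = 0" if A: "A \<in> c" "y \<in> interior (convex hull (\<nu>' ` A))" for A y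
  proof (rule ccontr)
    assume ne: "?g' y \<noteq> 0"
    define \<eta> where "\<eta> = norm (?g' y) / 2"
    have \<eta>: "\<eta> > 0" using ne by (simp add: \<eta>_def)
    obtain \<epsilon>1 where \<epsilon>1: "\<epsilon>1 > 0" "cball y \<epsilon>1 \<subseteq> convex hull (\<nu>' ` A)"
      using A(2) by (auto simp: mem_interior_cball)
    have "isCont ?g' y" using g'c[of UNIV] by (simp add: continuous_on_eq_continuous_at)
    then obtain \<epsilon>2 where \<epsilon>2: "\<epsilon>2 > 0" "\<And>x. dist x y < \<epsilon>2 \<Longrightarrow> dist (?g' x) (?g' y) < \<eta>"
      using \<eta> unfolding continuous_at_eps_delta by blast
    \<comment> \<open>The ball of radius \<open>2 * \<epsilon>\<close> must fit into the limit
      simplex for the ball of radius \<epsilon> to survive in a perturbed one.\<close>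
    define \<epsilon> where "\<epsilon> = min (\<epsilon>1 / 2) (\<epsilon>2 / 2)"
    have \<epsilon>: "\<epsilon> > 0" "2 * \<epsilon> \<le> \<epsilon>1" "\<epsilon> < \<epsilon>2" using \<epsilon>1(1) \<epsilon>2(1) by (auto simp: \<epsilon>_def)
    have big: "\<eta> < norm (?g' x)" if "x \<in> cball y \<epsilon>" for x
    proof -
      have "dist (?g' x) (?g' y) < \<eta>" using that \<epsilon> by (intro \<epsilon>2(2)) (auto simp: dist_commute)
      then show ?thesis
        using norm_triangle_ineq2[of "?g' y" "?g' x"] by (simp add: dist_norm norm_minus_commute \<eta>_def)
    qed
    have ev1: "eventually (\<lambda>m. \<forall>v\<in>A. dist (\<nu> (p m) v) (\<nu>' v) < \<epsilon>) sequentially"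
      using fin(2)[OF A(1)] conv\<nu>p A(1) \<epsilon>(1) by (intro eventually_ball_finite ballI tendstoD) auto
    have ev2: "eventually (\<lambda>m. \<forall>x\<in>cball 0 (norm y + \<epsilon>). dist (?g (p m) x) (?g' x) < \<eta> / 2) sequentially"
      using \<eta> by (intro uniform_limitD[OF convg]) simp
    \<comment> \<open>The limit exceeds \<eta> on the ball and the uniform error is below
      \<open>\<eta> / 2\<close>, so \<open>\<eta> / 2\<close> remains as a lower bound.\<close>
    define \<delta> where "\<delta> = (\<eta> / 2)\<^sup>2 * measure lborel (ball y \<epsilon>)"
    have \<delta>: "\<delta> > 0" using \<eta> \<epsilon>(1) by (simp add: \<delta>_def content_ball_pos)
    have ev3: "eventually (\<lambda>m. real m * \<delta> \<ge> 1) sequentially"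
    proof (rule eventually_sequentiallyI[of "nat \<lceil>1 / \<delta>\<rceil>"])
      fix m assume "nat \<lceil>1 / \<delta>\<rceil> \<le> m"
      then have "1 / \<delta> \<le> real m" by linarith
      then show "real m * \<delta> \<ge> 1" using \<delta> by (simp add: field_simps)
    qed
    obtain m where m: "\<forall>v\<in>A. dist (\<nu> (p m) v) (\<nu>' v) < \<epsilon>"
      "\<forall>x\<in>cball 0 (norm y + \<epsilon>). dist (?g (p m) x) (?g' x) < \<eta> / 2" "real m * \<delta> \<ge> 1"
      using eventually_happens'[OF sequentially_bot eventually_conj[OF ev1 eventually_conj[OF ev2 ev3]]] by blast
    have "cball y \<epsilon> \<subseteq> convex hull (\<nu> (p m) ` A)"
    proof (rule cball_subset_of_convex_close)
      show "closed (convex hull (\<nu> (p m) ` A))"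
        using fin(2)[OF A(1)] by (intro compact_imp_closed compact_convex_hull finite_imp_compact) auto
      fix x assume "x \<in> cball y (2 * \<epsilon>)"
      then have "x \<in> convex hull (\<nu>' ` A)" using \<epsilon>1(2) \<epsilon>(2) by auto
      then show "\<exists>z\<in>convex hull (\<nu> (p m) ` A). norm (x - z) \<le> \<epsilon>"
        using m(1) by (intro convex_hull_perturb[of A \<nu>']) (auto simp: dist_norm norm_minus_commute less_imp_le)
    qed (use \<epsilon> in auto)
    also have "\<dots> \<subseteq> realization (\<nu> (p m)) c" using A(1) by (auto simp: realization_def)
    finally have "ball y \<epsilon> \<subseteq> realization (\<nu> (p m)) c" using ball_subset_cball by blast
    then have sub: "ball y \<epsilon> \<subseteq> interior (realization (\<nu> (p m)) c)" by (rule interior_maximal) simp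
    have "ennreal \<delta> = ennreal ((\<eta> / 2)\<^sup>2) * emeasure lborel (ball y \<epsilon>)"
      using emeasure_lborel_ball_finite[of y \<epsilon>] by (simp add: \<delta>_def ennreal_mult emeasure_eq_ennreal_measure)
    also have "\<dots> = (\<integral>\<^sup>+x. ennreal ((\<eta> / 2)\<^sup>2) * indicator (ball y \<epsilon>) x \<partial>lborel)"
      by (simp add: nn_integral_cmult_indicator)
    also have "\<dots> \<le> (\<integral>\<^sup>+x\<in>interior (realization (\<nu> (p m)) c). ennreal ((norm (?g (p m) x))\<^sup>2) \<partial>lborel)"
    proof (rule nn_integral_mono)
      fix x
      show "ennreal ((\<eta> / 2)\<^sup>2) * indicator (ball y \<epsilon>) x \<le>
        ennreal ((norm (?g (p m) x))\<^sup>2) * indicator (interior (realization (\<nu> (p m)) c)) x"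
      proof (cases "x \<in> ball y \<epsilon>")
        case True
        then have x: "x \<in> cball y \<epsilon>" by auto
        have "norm x \<le> norm y + \<epsilon>"
          using x norm_triangle_ineq2[of x y] by (simp add: dist_norm norm_minus_commute)
        then have "dist (?g (p m) x) (?g' x) < \<eta> / 2" using m(2) by auto
        then have "\<eta> / 2 \<le> norm (?g (p m) x)"
          using big[OF x] norm_triangle_ineq2[of "?g' x" "?g (p m) x"] by (simp add: dist_norm norm_minus_commute)
        then have "(\<eta> / 2)\<^sup>2 \<le> (norm (?g (p m) x))\<^sup>2" using \<eta> by (intro power_mono) auto
        then show ?thesis using True sub by (auto simp: ennreal_leI subset_iff)
      qed simp
    qed
    finally have "ennreal \<delta> \<le> (\<integral>\<^sup>+x\<in>interior (realization (\<nu> (p m)) c). ennreal ((norm (?g (p m) x))\<^sup>2) \<partial>lborel)" .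
    then have "ennreal (real (p m)) * ennreal \<delta> \<le> ennreal (real (p m)) * (\<integral>\<^sup>+x\<in>interior (realization (\<nu> (p m)) c). ennreal ((norm (?g (p m) x))\<^sup>2) \<partial>lborel)"
      by (intro mult_left_mono) auto
    also have "\<dots> < 1" by (rule small)
    finally have "real (p m) * \<delta> < 1"
      using \<delta> by (simp add: ennreal_mult[symmetric])
    moreover have "real m * \<delta> \<le> real (p m) * \<delta>"
      using seq_suble[OF p, of m] \<delta> by (intro mult_right_mono) auto
    ultimately show False using m(3) by linarith
  qed
  \<comment> \<open>The limit datum belongs to \<open>K\<close>, so its simplices are
    non-degenerate, and those with \<open>CARD('n) + 1\<close> vertices are the closures of their
    interiors.\<close>
  have zero_full: "?g' y = 0" if A: "A \<in> c" "card A = Suc CARD('n)" "y \<in> convex hull (\<nu>' ` A)" for A y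
  proof -
    have "interior (convex hull (\<nu>' ` A)) \<noteq> {}"
      using interior_simplex_nonempty[OF inj(2,1)[OF A(1)]] A(2) by simp
    then have "closure (interior (convex hull (\<nu>' ` A))) = closure (convex hull (\<nu>' ` A))"
      by (intro convex_closure_interior) auto
    then have y: "y \<in> closure (interior (convex hull (\<nu>' ` A)))"
      using A(3) closure_subset by blast
    show ?thesis
      by (rule continuous_constant_on_closure[OF g'c _ y]) (use zero_int[OF A(1)] in auto)
  qed
  have "covered_by_full_simplices \<nu>' c"
    by (rule covered_by_full_simplices_limit[of c "\<lambda>m. \<nu> (p m)"]) (use fin D(2) conv\<nu>p in auto)
  then have "?g' y = 0" if "y \<in> realization \<nu>' c" for y
    using zero_full that unfolding covered_by_full_simplices_def realization_def by blast
  then have "(\<Sum>i<?N. \<beta> i *\<^sub>R pullback_to (realization \<nu>' c) (f' c k i) x) = 0" for x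
    by (rule pullback_to_sum_eq_0)
  then have "\<forall>i<?N. \<beta> i = 0" using indep unfolding form_independent_def by blast
  \<comment> \<open>There are finitely many coefficients, so the normalisation passes to their
    limits.\<close>
  moreover have "(\<lambda>m. \<Sum>i<?N. \<bar>b' (r (q m)) i\<bar>) \<longlonglongrightarrow> (\<Sum>i<?N. \<bar>\<beta> i\<bar>)"
    using q(2) by (intro tendsto_intros) auto
  then have "(\<Sum>i<?N. \<bar>\<beta> i\<bar>) = 1"
    unfolding sum1 using LIMSEQ_const_iff[of "1::real"] by simp
  ultimately show False by simp
qed


section \<open>Cells and simplices\<close>

lemma minor_det_id:
  fixes I J :: "'n::{finite,linorder} set"
  assumes card: "card I = card J"
  shows "minor_det (\<lambda>x. x) I J = (if I = J then 1 else 0)"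
proof -
  let ?i = "\<lambda>r. sorted_list_of_set I ! r" and ?j = "\<lambda>r. sorted_list_of_set J ! r"
  have prod: "(\<Prod>r<card J. (axis (?j r) 1 :: 'n point) $ ?i (\<pi> r)) = (if \<forall>r<card J. ?j r = ?i (\<pi> r) then 1 else 0)" for \<pi>
  proof (cases "\<forall>r<card J. ?j r = ?i (\<pi> r)")
    case True then show ?thesis by (simp add: axis_def)
  next
    case False
    then obtain r where "r < card J" "?j r \<noteq> ?i (\<pi> r)" by blast
    then show ?thesis using False by (auto simp: axis_def intro!: prod_zero bexI[of _ r])
  qed
  \<comment> \<open>A non-zero term of the Leibniz sum puts every element of \<open>J\<close> into
    \<open>I\<close>, so the sets agree by cardinality; since the sorted list has no repetitions,
    the permutation is then the identity.\<close>
  have "I = J \<and> \<pi> = id" if \<pi>: "\<pi> permutes {..<card J}" and eq: "\<forall>r<card J. ?j r = ?i (\<pi> r)" for \<pi>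
  proof -
    have "J \<subseteq> I"
    proof
      fix x assume "x \<in> J"
      then obtain r where r: "r < card J" "x = ?j r"
        by (metis finite in_set_conv_nth length_sorted_list_of_set set_sorted_list_of_set)
      have "\<pi> r < card I" using permutes_in_image[OF \<pi>, of r] r(1) card by simp
      then have "?i (\<pi> r) \<in> I"
        by (metis finite length_sorted_list_of_set nth_mem set_sorted_list_of_set)
      then show "x \<in> I" using eq r by simp
    qed
    then have IJ: "I = J" using card by (metis card_subset_eq finite)
    have "\<pi> r = r" for r
    proof (cases "r < card J")
      case True
      then have "\<pi> r < card J" using permutes_in_image[OF \<pi>, of r] by simp
      moreover have "?j r = ?j (\<pi> r)" using eq True IJ by simp
      ultimately show ?thesis using True
        by (subst (asm) nth_eq_iff_index_eq) auto
    next
      case False then show ?thesis using \<pi> by (simp add: permutes_not_in)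
    qed
    then show ?thesis using IJ by auto
  qed
  then have "minor_det (\<lambda>x. x) I J = (\<Sum>\<pi> | \<pi> permutes {..<card J}. of_int (sign \<pi>) * (if I = J \<and> \<pi> = id then 1 else 0))"
    unfolding minor_det_def prod by (intro sum.cong refl) auto
  also have "\<dots> = (\<Sum>\<pi> | \<pi> permutes {..<card J}. if \<pi> = id then (if I = J then 1 else 0) else 0)"
    by (intro sum.cong refl) (auto simp: sign_id)
  also have "\<dots> = (if I = J then 1 else 0)"
    by (subst sum.delta) (auto simp: finite_permutations permutes_id)
  finally show ?thesis .
qed

lemma pullback_alt_id: "pullback_alt (\<lambda>x. x) w = w"
proof -
  have "(\<Sum>I | card I = card J. w $ I * minor_det (\<lambda>x. x) I J) = (\<Sum>I | card I = card J. if I = J then w $ I else 0)" for J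
    by (intro sum.cong) (auto simp: minor_det_id)
  then show ?thesis by (simp add: pullback_alt_def vec_eq_iff sum.delta)
qed

text \<open>A subspace containing a ball about 0 is the whole space. Thus the \<open>THE\<close> in
  \<open>pullback_to\<close> denotes \<open>UNIV\<close> at interior points.\<close>

lemma tangent_at_interior:
  assumes x: "x \<in> interior T"
  shows "tangent_at T x V \<longleftrightarrow> V = UNIV"
proof
  assume "V = UNIV"
  moreover obtain \<epsilon> where "\<epsilon> > 0" "ball x \<epsilon> \<subseteq> T" using x by (auto simp: mem_interior)
  ultimately show "tangent_at T x V"
    unfolding tangent_at_def by (auto intro!: exI[of _ \<epsilon>])
next
  assume "tangent_at T x V"
  then obtain \<epsilon> where V: "subspace V" and \<epsilon>: "\<epsilon> > 0" "T \<inter> ball x \<epsilon> = (+) x ` V \<inter> ball x \<epsilon>"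
    by (auto simp: tangent_at_def)
  obtain \<delta> where \<delta>: "\<delta> > 0" "ball x \<delta> \<subseteq> T" using x by (auto simp: mem_interior)
  have "ball 0 (min \<epsilon> \<delta>) \<subseteq> V"
  proof
    fix w :: "'a point" assume w: "w \<in> ball 0 (min \<epsilon> \<delta>)"
    then have "x + w \<in> T \<inter> ball x \<epsilon>" using \<delta>(2) by (auto simp: dist_norm subset_iff)
    then show "w \<in> V" using \<epsilon>(2) by auto
  qed
  moreover have "(0 :: 'a point) \<in> ball 0 (min \<epsilon> \<delta>)" using \<epsilon>(1) \<delta>(1) by simp
  ultimately have "interior V \<noteq> {}" by (metis empty_iff interior_maximal open_ball subsetD)
  then have "dim V = DIM('a point)"
    using low_dim_interior[of V] aff_dim_subspace[OF V] by force
  then show "V = UNIV" using V by (simp add: subspace_dim_equal dim_eq_full span_eq_iff)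
qed

lemma pullback_to_interior:
  assumes x: "x \<in> interior T"
  shows "pullback_to T \<omega> x = \<omega> x"
proof -
  have "closest_point UNIV = (\<lambda>y. y :: 'a point)" by (auto simp: closest_point_self)
  moreover have "tangent_at T x = (\<lambda>V. V = UNIV)"
    using tangent_at_interior[OF x] by blast
  ultimately show ?thesis
    by (simp add: pullback_to_def pullback_alt_id)
qed

text \<open>The inverse chart embeds the non-empty open interior into \<open>V\<close>, so
  \<open>V\<close> is the whole space by invariance of dimension. Then the chart maps the open ball
  to an open set, which lies in the interior, and by continuity it maps the closed ball into the
  closure.\<close>

lemma is_cell_subset_closure_interior:
  fixes T :: "'n::finite point set"
  assumes cell: "is_cell T" and ne: "interior T \<noteq> {}"
  shows "T \<subseteq> closure (interior T)"
proof -
  obtain V and f g :: "'n point \<Rightarrow> 'n point" where V: "subspace V" and hom: "homeomorphism (cball 0 1 \<inter> V) T f g"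
    using cell by (auto simp: is_cell_def cell_chart_def)
  have "continuous_on T g" "g ` T = cball 0 1 \<inter> V" "inj_on g T"
    using hom by (auto simp: homeomorphism_def intro: inj_on_inverseI)
  then have "dim (UNIV :: 'n point set) \<le> dim V"
    using interior_subset[of T]
    by (intro invariance_of_dimension_subspaces[of UNIV "interior T" V g])
       (auto simp: V ne intro: continuous_on_subset inj_on_subset)
  then have "dim V = DIM('n point)" using dim_subset_UNIV[of V] by (simp add: dim_UNIV)
  then have "span V = UNIV" by (simp only: dim_eq_full)
  then have V: "V = UNIV" using V by (metis span_eq_iff)
  have f: "continuous_on (cball 0 1) f" "f ` cball 0 1 = T" "inj_on f (cball 0 1)"
    using hom V by (auto simp: homeomorphism_def intro: inj_on_inverseI)
  have "open (f ` ball 0 1)"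
    by (rule invariance_of_domain) (use f in \<open>auto intro: continuous_on_subset inj_on_subset\<close>)
  then have "f ` ball 0 1 \<subseteq> interior T"
    using f(2) by (intro interior_maximal) auto
  then have "f ` closure (ball 0 1) \<subseteq> closure (interior T)"
    using f(1) closure_subset by (intro image_closure_subset) auto
  then show ?thesis using f(2) by simp
qed

section \<open>Triangulations up to null sets\<close>

lemma AE_not_in_negligible:
  fixes S :: "'a::euclidean_space set"
  assumes "negligible S" "S \<in> sets borel"
  shows "AE x in lborel. x \<notin> S"
proof -
  have "S \<in> null_sets lborel"
    using assms by (simp add: negligible_iff_null_sets null_sets_completion_iff)
  then show ?thesis by (rule AE_not_in)
qed

lemma negligible_low_aff_dim:
  fixes S :: "'a::euclidean_space set"
  assumes "convex S" "aff_dim S \<noteq> DIM('a)"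
  shows "negligible S"
  using assms by (simp add: negligible_convex_interior low_dim_interior)

lemma periodic_triangulation_simplex:
  assumes "periodic_triangulation e \<S>" "\<sigma> \<in> \<S>"
  shows "convex \<sigma>" "compact \<sigma>"
  using assms unfolding periodic_triangulation_def
  by (meson convex_simplex, meson compact_simplex)

lemma countable_periodic_family:
  assumes "periodic_family e \<C>"
  shows "countable \<C>"
proof -
  obtain F where F: "finite F" "\<C> = {(+) l ` T | l T. l \<in> lattice e \<and> T \<in> F}"
    using assms by (auto simp: periodic_family_def)
  then have "\<C> = (\<lambda>(l, T). (+) l ` T) ` (lattice e \<times> F)" by auto
  then show ?thesis using F(1) by (simp add: countable_lattice countable_finite)
qed

lemma AE_in_full_simplex:
  fixes \<S> :: "'n::finite point set set"
  assumes t: "periodic_triangulation e \<S>"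
  shows "AE x in lborel. \<exists>\<sigma>\<in>{\<sigma>\<in>\<S>. aff_dim \<sigma> = int CARD('n)}. x \<in> \<sigma>"
proof -
  have c: "countable \<S>" using t countable_periodic_family[of e \<S>] by (simp add: periodic_triangulation_def)
  have "AE x in lborel. \<forall>\<sigma>\<in>{\<sigma>\<in>\<S>. aff_dim \<sigma> \<noteq> int CARD('n)}. x \<notin> \<sigma>"
  proof (subst AE_ball_countable)
    show "countable {\<sigma>\<in>\<S>. aff_dim \<sigma> \<noteq> int CARD('n)}" using c by simp
    show "\<forall>\<sigma>\<in>{\<sigma>\<in>\<S>. aff_dim \<sigma> \<noteq> int CARD('n)}. AE x in lborel. x \<notin> \<sigma>"
      using periodic_triangulation_simplex[OF t]
      by (auto intro!: AE_not_in_negligible negligible_low_aff_dim simp: borel_compact)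
  qed
  then show ?thesis
  proof eventually_elim
    case (elim x)
    have "x \<in> \<Union>\<S>" using t by (simp add: periodic_triangulation_def)
    then show ?case using elim by blast
  qed
qed

text \<open>The intersection is a face of both simplices; as it contains a common interior point, it
  is all of each. This makes balls inscribed in different simplices disjoint, as the packing bound
  requires.\<close>

lemma full_simplices_disjoint:
  fixes \<S> :: "'n::finite point set set"
  assumes t: "periodic_triangulation e \<S>" and st: "\<sigma> \<in> \<S>" "\<tau> \<in> \<S>" "\<sigma> \<noteq> \<tau>"
  shows "interior \<sigma> \<inter> interior \<tau> = {}"
proof (rule ccontr)
  assume "\<not> ?thesis"
  then obtain y where y: "y \<in> interior \<sigma>" "y \<in> interior \<tau>" by blast
  have f: "(\<sigma> \<inter> \<tau>) face_of \<sigma>" "(\<tau> \<inter> \<sigma>) face_of \<tau>"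
    using t st by (auto simp: periodic_triangulation_def)
  have r: "rel_interior \<sigma> = interior \<sigma>" "rel_interior \<tau> = interior \<tau>"
    using y rel_interior_nonempty_interior by blast+
  have "y \<in> \<sigma> \<inter> \<tau>" using y interior_subset by blast
  then have "\<sigma> \<subseteq> \<sigma> \<inter> \<tau>" "\<tau> \<subseteq> \<tau> \<inter> \<sigma>"
    using subset_of_face_of[OF f(1) order_refl] subset_of_face_of[OF f(2) order_refl] y r by blast+
  then show False using st(3) by blast
qed

text \<open>The remaining simplices form a null set, so the open set of interior points outside
  \<open>W\<close> is empty. As \<open>W\<close> is closed, it contains the closure of the interior
  as well.\<close>

lemma covered_by_full_simplices_of_pure:
  fixes \<nu> :: "nat \<Rightarrow> 'n::finite point"
  assumes fin: "finite c" "\<And>A. A \<in> c \<Longrightarrow> finite A"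
    and ind: "\<And>A. A \<in> c \<Longrightarrow> inj_on \<nu> A \<and> \<not> affine_dependent (\<nu> ` A)"
    and pure: "realization \<nu> c \<subseteq> closure (interior (realization \<nu> c))"
  shows "covered_by_full_simplices \<nu> c"
proof -
  define W where "W = (\<Union>A\<in>{A\<in>c. card A = Suc CARD('n)}. convex hull (\<nu> ` A))"
  define L where "L = (\<Union>A\<in>{A\<in>c. card A \<noteq> Suc CARD('n)}. convex hull (\<nu> ` A))"
  have "closed W"
    unfolding W_def using fin by (intro closed_UN ballI compact_imp_closed compact_convex_hull finite_imp_compact) auto
  have "negligible (convex hull (\<nu> ` A))" if "A \<in> c" "card A \<noteq> Suc CARD('n)" for A
  proof (rule negligible_low_aff_dim)
    have "aff_dim (convex hull (\<nu> ` A)) = int (card (\<nu> ` A)) - 1"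
      using ind[OF that(1)] by (simp add: aff_dim_convex_hull aff_dim_affine_independent)
    also have "\<dots> \<noteq> int CARD('n)"
      using that ind[OF that(1)] by (simp add: card_image)
    finally show "aff_dim (convex hull (\<nu> ` A)) \<noteq> int DIM('n point)" by simp
  qed simp
  then have L: "negligible L" unfolding L_def using fin by (intro negligible_Union) auto
  have WL: "realization \<nu> c = W \<union> L" by (auto simp: W_def L_def realization_def)
  have "interior (realization \<nu> c) \<subseteq> W"
  proof (rule ccontr)
    assume "\<not> ?thesis"
    then have "interior (realization \<nu> c) - W \<noteq> {}" by blast
    moreover have "open (interior (realization \<nu> c) - W)" using \<open>closed W\<close> by (simp add: open_Diff)
    moreover have "interior (realization \<nu> c) - W \<subseteq> L" using WL interior_subset by blast
    ultimately show False using L open_not_negligible negligible_subset by blast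
  qed
  then have "closure (interior (realization \<nu> c)) \<subseteq> W" using \<open>closed W\<close> by (rule closure_minimal)
  then show ?thesis using pure unfolding covered_by_full_simplices_def W_def realization_def by blast
qed

section \<open>Cells under scaling\<close>

lemma scaling_interior:
  fixes Y :: "'a::real_normed_vector set"
  assumes h: "h > 0"
  shows "a + h *\<^sub>R y \<in> interior ((\<lambda>y. a + h *\<^sub>R y) ` Y) \<longleftrightarrow> y \<in> interior Y"
proof -
  let ?\<phi> = "\<lambda>y. a + h *\<^sub>R y" and ?\<psi> = "\<lambda>x. (x - a) /\<^sub>R h"
  have inv: "?\<psi> (?\<phi> y) = y" "?\<phi> (?\<psi> y) = y" for y using h by simp_all
  have im: "?\<phi> ` S = ?\<psi> -` S" for S
    using inv by (auto simp: image_iff) (metis inv(2))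
  have "open (?\<psi> -` interior Y)"
    by (intro open_vimage continuous_intros) auto
  then have "?\<phi> ` interior Y \<subseteq> interior (?\<phi> ` Y)"
    unfolding im[of "interior Y"] using interior_subset[of Y] by (intro interior_maximal) (auto simp: im)
  moreover have "open (?\<phi> -` interior (?\<phi> ` Y))"
    by (intro open_vimage continuous_intros) auto
  then have "?\<phi> -` interior (?\<phi> ` Y) \<subseteq> interior Y"
    using interior_subset[of "?\<phi> ` Y"] h by (intro interior_maximal) (auto simp: subset_iff)
  ultimately show ?thesis by blast
qed

lemma is_cell_scaling:
  fixes Y :: "'n::finite point set"
  assumes h: "h > 0" and cell: "is_cell ((\<lambda>y. a + h *\<^sub>R y) ` Y)"
  shows "is_cell Y"
proof -
  let ?\<phi> = "\<lambda>y. a + h *\<^sub>R y" and ?\<psi> = "\<lambda>x. (x - a) /\<^sub>R h"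
  obtain V and f g :: "'n point \<Rightarrow> 'n point" where V: "subspace V" "homeomorphism (cball 0 1 \<inter> V) (?\<phi> ` Y) f g"
    using cell by (auto simp: is_cell_def cell_chart_def)
  have "homeomorphism (?\<phi> ` Y) Y ?\<psi> ?\<phi>"
    using h by (intro homeomorphismI continuous_intros) auto
  from homeomorphism_compose[OF V(2) this] show ?thesis
    using V(1) unfolding is_cell_def cell_chart_def by blast
qed


section \<open>Local inverse estimates\<close>

text \<open>The bounds are made for the ambient combination, scaled back to size \<open>h\<close>,
  because the cell form \<open>g\<close> vanishes by convention where there is no tangent space and
  need not be continuous up to the boundary. The factor \<open>h ^ k\<close> from the scaling of
  \<open>k\<close>-forms occurs squared on both sides of the inverse estimate and cancels.\<close>

lemma scaled_local_form:
  fixes f :: "nat \<Rightarrow> 'n::{finite,linorder} form" and a :: "'n point" and h :: real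
  defines "\<phi> \<equiv> \<lambda>y. a + h *\<^sub>R y"
  assumes h: "h > 0"
    and rep: "\<And>y. h ^ k *\<^sub>R g (\<phi> y) = (\<Sum>i<N. b i *\<^sub>R pullback_to Y (f i) y)"
    and w[measurable]: "w \<in> borel_measurable borel"
    and ae: "AE x in lborel. x \<in> interior (\<phi> ` Y) \<longrightarrow> w x = g x"
    and sm: "\<And>i. i < N \<Longrightarrow> smooth (f i)"
    and B: "B \<ge> 0" "\<And>i x. i < N \<Longrightarrow> x \<in> Y \<Longrightarrow> norm (f i x) \<le> B"
      "\<And>i x y. i < N \<Longrightarrow> x \<in> Y \<Longrightarrow> y \<in> Y \<Longrightarrow> norm (f i x - f i y) \<le> B * norm (x - y)"
    and C: "C \<ge> 0"
    and low: "ennreal ((\<Sum>i<N. \<bar>b i\<bar>)\<^sup>2) \<le> ennreal C *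
      (\<integral>\<^sup>+x\<in>interior Y. ennreal ((norm (\<Sum>i<N. b i *\<^sub>R f i x))\<^sup>2) \<partial>lborel)"
  shows "\<exists>v A. 0 \<le> A \<and> (AE x in lborel. x \<in> interior (\<phi> ` Y) \<longrightarrow> w x = v x) \<and>
    (\<forall>x\<in>\<phi> ` Y. norm (v x) \<le> A) \<and>
    (\<forall>x\<in>\<phi> ` Y. \<forall>y\<in>\<phi> ` Y. norm (v x - v y) \<le> A * (norm (x - y) / h)) \<and>
    ennreal (A\<^sup>2 * h ^ CARD('n)) \<le> ennreal (B\<^sup>2 * C) * (\<integral>\<^sup>+x\<in>interior (\<phi> ` Y). ennreal ((norm (w x))\<^sup>2) \<partial>lborel)"
proof -
  define G where "G y = (\<Sum>i<N. b i *\<^sub>R f i y)" for y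
  define v where "v x = (1 / h ^ k) *\<^sub>R G ((x - a) /\<^sub>R h)" for x
  define s where "s = (\<Sum>i<N. \<bar>b i\<bar>)"
  \<comment> \<open>\<open>B\<close> bounds each basis form and its Lipschitz constant, and
    \<open>s\<close> is the absolute sum of the coefficients. Division by \<open>h ^ k\<close>
    undoes the scaling of values; the factor \<open>1 / h\<close> of derivatives is kept outside
    \<open>A\<close>.\<close>
  define A where "A = B * s / h ^ k"
  have s: "s \<ge> 0" by (simp add: s_def sum_nonneg)
  have v\<phi>: "v (\<phi> y) = (1 / h ^ k) *\<^sub>R G y" for y
    using h by (simp add: v_def \<phi>_def)
  have "continuous_on UNIV (f i)" if "i < N" for i
    using smooth_partial_continuous[OF sm[OF that], of UNIV "[]"] by simp
  then have "continuous_on UNIV G" unfolding G_def by (intro continuous_intros) auto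
  then have [measurable]: "G \<in> borel_measurable borel" by (rule borel_measurable_continuous_onI)
  then have [measurable]: "v \<in> borel_measurable borel" unfolding v_def by measurable
  have wv: "AE x in lborel. x \<in> interior (\<phi> ` Y) \<longrightarrow> w x = v x"
    using ae
  proof eventually_elim
    case (elim x)
    show ?case
    proof
      assume x: "x \<in> interior (\<phi> ` Y)"
      define y where "y = (x - a) /\<^sub>R h"
      have xy: "x = \<phi> y" using h by (simp add: \<phi>_def y_def)
      have y: "y \<in> interior Y"
        using x scaling_interior[OF h, of a y Y] unfolding xy \<phi>_def by simp
      have "h ^ k *\<^sub>R g x = G y"
        unfolding xy rep G_def using y by (simp add: pullback_to_interior)
      moreover have "g x = (1 / h ^ k) *\<^sub>R (h ^ k *\<^sub>R g x)" using h by simp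
      ultimately have "g x = v x" unfolding xy v\<phi> by simp
      then show "w x = v x" using elim x by simp
    qed
  qed
  have "norm (G y) \<le> s * B" if "y \<in> Y" for y
  proof -
    have "norm (G y) \<le> (\<Sum>i<N. norm (b i *\<^sub>R f i y))" unfolding G_def by (rule norm_sum)
    also have "\<dots> \<le> (\<Sum>i<N. \<bar>b i\<bar> * B)"
      using B(2) that by (intro sum_mono) (auto intro: mult_left_mono)
    finally show ?thesis by (simp add: s_def sum_distrib_right)
  qed
  then have bound: "\<forall>x\<in>\<phi> ` Y. norm (v x) \<le> A"
    using h by (auto simp: v\<phi> A_def mult.commute[of B] intro: divide_right_mono)
  have lipG: "norm (G x - G y) \<le> s * B * norm (x - y)" if "x \<in> Y" "y \<in> Y" for x y
  proof -
    have "G x - G y = (\<Sum>i<N. b i *\<^sub>R (f i x - f i y))"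
      by (simp add: G_def sum_subtractf scaleR_diff_right)
    then have "norm (G x - G y) \<le> (\<Sum>i<N. norm (b i *\<^sub>R (f i x - f i y)))"
      by (simp only: norm_sum)
    also have "\<dots> \<le> (\<Sum>i<N. \<bar>b i\<bar> * (B * norm (x - y)))"
      using B(3) that by (intro sum_mono) (auto intro: mult_left_mono)
    finally show ?thesis by (simp add: s_def sum_distrib_right mult.assoc)
  qed
  have lip: "\<forall>x\<in>\<phi> ` Y. \<forall>y\<in>\<phi> ` Y. norm (v x - v y) \<le> A * (norm (x - y) / h)"
  proof clarify
    fix x y assume "x \<in> Y" "y \<in> Y"
    then have "norm (v (\<phi> x) - v (\<phi> y)) \<le> (1 / h ^ k) * (s * B * norm (x - y))"
      using lipG[of x y] h by (simp add: v\<phi> divide_right_mono flip: scaleR_diff_right)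
    also have "\<dots> = A * (norm (\<phi> x - \<phi> y) / h)"
      using h by (simp add: \<phi>_def A_def mult_ac flip: scaleR_diff_right)
    finally show "norm (v (\<phi> x) - v (\<phi> y)) \<le> A * (norm (\<phi> x - \<phi> y) / h)" .
  qed
  have "(\<integral>\<^sup>+x\<in>interior (\<phi> ` Y). ennreal ((norm (w x))\<^sup>2) \<partial>lborel) =
     (\<integral>\<^sup>+x\<in>interior (\<phi> ` Y). ennreal ((norm (v x))\<^sup>2) \<partial>lborel)"
    using wv by (intro nn_integral_cong_AE) (auto elim!: eventually_mono simp: indicator_def)
  also have "\<dots> = ennreal (h ^ CARD('n)) * (\<integral>\<^sup>+y. ennreal ((norm (v (\<phi> y)))\<^sup>2) * indicator (interior (\<phi> ` Y)) (\<phi> y) \<partial>lborel)"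
    using nn_integral_lborel_affine[OF _ h, of "\<lambda>x. ennreal ((norm (v x))\<^sup>2) * indicator (interior (\<phi> ` Y)) x" a]
    by (simp add: \<phi>_def)
  also have "(\<integral>\<^sup>+y. ennreal ((norm (v (\<phi> y)))\<^sup>2) * indicator (interior (\<phi> ` Y)) (\<phi> y) \<partial>lborel) =
     (\<integral>\<^sup>+y. ennreal (1 / (h ^ k)\<^sup>2) * (ennreal ((norm (G y))\<^sup>2) * indicator (interior Y) y) \<partial>lborel)"
  proof (rule nn_integral_cong)
    fix y
    have "indicator (interior (\<phi> ` Y)) (\<phi> y) = (indicator (interior Y) y :: ennreal)"
      using scaling_interior[OF h, of a y Y] by (simp add: \<phi>_def indicator_def)
    moreover have "(norm (v (\<phi> y)))\<^sup>2 = 1 / (h ^ k)\<^sup>2 * (norm (G y))\<^sup>2"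
      using h by (simp add: v\<phi> power_divide)
    ultimately show "ennreal ((norm (v (\<phi> y)))\<^sup>2) * indicator (interior (\<phi> ` Y)) (\<phi> y) =
      ennreal (1 / (h ^ k)\<^sup>2) * (ennreal ((norm (G y))\<^sup>2) * indicator (interior Y) y)"
      by (simp only: ennreal_mult zero_le_power2 zero_le_divide_1_iff mult.assoc)
  qed
  also have "\<dots> = ennreal (1 / (h ^ k)\<^sup>2) * (\<integral>\<^sup>+y\<in>interior Y. ennreal ((norm (G y))\<^sup>2) \<partial>lborel)"
    by (rule nn_integral_cmult) measurable
  finally have I: "(\<integral>\<^sup>+x\<in>interior (\<phi> ` Y). ennreal ((norm (w x))\<^sup>2) \<partial>lborel) =
    ennreal (h ^ CARD('n)) * (ennreal (1 / (h ^ k)\<^sup>2) * (\<integral>\<^sup>+y\<in>interior Y. ennreal ((norm (G y))\<^sup>2) \<partial>lborel))" .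
  have "A\<^sup>2 * h ^ CARD('n) = B\<^sup>2 * h ^ CARD('n) * (1 / (h ^ k)\<^sup>2) * s\<^sup>2"
    by (simp add: A_def power_mult_distrib power_divide)
  then have "ennreal (A\<^sup>2 * h ^ CARD('n)) = ennreal (B\<^sup>2 * h ^ CARD('n) * (1 / (h ^ k)\<^sup>2)) * ennreal (s\<^sup>2)"
    using h by (simp only: ennreal_mult'' zero_le_power2)
  also have "\<dots> \<le> ennreal (B\<^sup>2 * h ^ CARD('n) * (1 / (h ^ k)\<^sup>2)) *
     (ennreal C * (\<integral>\<^sup>+y\<in>interior Y. ennreal ((norm (G y))\<^sup>2) \<partial>lborel))"
    using low by (intro mult_left_mono) (auto simp: s_def G_def)
  also have "\<dots> = ennreal (B\<^sup>2 * C) * (\<integral>\<^sup>+x\<in>interior (\<phi> ` Y). ennreal ((norm (w x))\<^sup>2) \<partial>lborel)"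
  proof -
    have nn: "0 \<le> B\<^sup>2" "0 \<le> h ^ CARD('n)" "0 \<le> 1 / (h ^ k)\<^sup>2" "0 \<le> B\<^sup>2 * h ^ CARD('n)" using h by simp_all
    show ?thesis
      unfolding I ennreal_mult[OF nn(4,3)] ennreal_mult[OF nn(1,2)] ennreal_mult[OF nn(1) C] by (simp only: mult_ac)
  qed
  finally have inv: "ennreal (A\<^sup>2 * h ^ CARD('n)) \<le> ennreal (B\<^sup>2 * C) * (\<integral>\<^sup>+x\<in>interior (\<phi> ` Y). ennreal ((norm (w x))\<^sup>2) \<partial>lborel)" .
  have "A \<ge> 0" using B(1) s h by (simp add: A_def)
  then show ?thesis using wv bound lip inv by blast
qed

text \<open>Forms of different degrees have coefficients at different index sets, so adding them
  cannot decrease the norm. Hence the inverse estimate may be proved one degree at a time.\<close>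

lemma norm_homogeneous_component_le:
  fixes w :: "nat \<Rightarrow> 'n::finite form"
  assumes hom: "\<And>k. k \<le> n \<Longrightarrow> homogeneous k (w k)" and k: "k \<le> n"
  shows "norm (w k x) \<le> norm (\<Sum>k\<le>n. w k x)"
proof (rule norm_le_componentwise_cart)
  fix I
  show "norm (w k x $ I) \<le> norm ((\<Sum>k\<le>n. w k x) $ I)"
  proof (cases "card I = k")
    case True
    have "(\<Sum>k\<le>n. w k x) $ I = (\<Sum>m\<le>n. w m x $ I)" by simp
    also have "\<dots> = (\<Sum>m\<le>n. if m = k then w k x $ I else 0)"
    proof (rule sum.cong)
      fix m assume "m \<in> {..n}"
      then show "w m x $ I = (if m = k then w k x $ I else 0)"
        using hom[of m] True by (auto simp: homogeneous_def)
    qed simp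
    finally show ?thesis using k by (simp add: sum.delta)
  next
    case False then show ?thesis using hom[OF k] by (simp add: homogeneous_def)
  qed
qed

text \<open>The estimates are stated on a cell \<open>T\<close> around the simplex: the basis forms
  of \<open>T\<close> need not remain independent when restricted to one of its simplices, so the
  integral has to extend over all of \<open>T\<close>.\<close>

lemma fe_local_representative:
  fixes e :: "'n::{finite,linorder} \<Rightarrow> 'n point" and K :: "macro_type \<Rightarrow> 'n macro_datum set"
  assumes h: "h > 0" and cc: "cellular_complex e \<T>" and ref: "simplicial_refinement e \<T> \<S>"
    and u: "u \<in> fe_space e \<T> X" and \<sigma>: "\<sigma> \<in> \<S>" "interior \<sigma> \<noteq> {}"
    and scaled: "\<And>T. T \<in> \<T> \<Longrightarrow> \<exists>\<tau>\<in>Types. \<exists>D\<in>K \<tau>. scaled_macro_element \<T> \<S> X h T \<tau> D"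
    and types: "\<And>\<tau>. \<tau> \<in> Types \<Longrightarrow> is_macro_type \<tau> \<and> compact_macro_family \<tau> (K \<tau>)"
    and R: "\<And>Cs N \<nu> f c. (Cs, N) \<in> Types \<Longrightarrow> (\<nu>, f) \<in> K (Cs, N) \<Longrightarrow> c \<in> Cs \<Longrightarrow> realization \<nu> c \<subseteq> cball 0 R"
    and B0: "B \<ge> 0" and C0: "C \<ge> 0"
    and B: "\<And>Cs N \<nu> f c k i x. (Cs, N) \<in> Types \<Longrightarrow> (\<nu>, f) \<in> K (Cs, N) \<Longrightarrow> c \<in> Cs \<Longrightarrow> k \<le> CARD('n) \<Longrightarrow>
      i < N c k \<Longrightarrow> x \<in> cball 0 R \<Longrightarrow> norm (f c k i x) \<le> B"
    and L: "\<And>Cs N \<nu> f c k i x y. (Cs, N) \<in> Types \<Longrightarrow> (\<nu>, f) \<in> K (Cs, N) \<Longrightarrow> c \<in> Cs \<Longrightarrow> k \<le> CARD('n) \<Longrightarrow>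
      i < N c k \<Longrightarrow> x \<in> cball 0 R \<Longrightarrow> y \<in> cball 0 R \<Longrightarrow> norm (f c k i x - f c k i y) \<le> B * norm (x - y)"
    and C: "\<And>Cs N \<nu> f c k b. (Cs, N) \<in> Types \<Longrightarrow> (\<nu>, f) \<in> K (Cs, N) \<Longrightarrow> c \<in> Cs \<Longrightarrow> k \<le> CARD('n) \<Longrightarrow>
      covered_by_full_simplices \<nu> c \<Longrightarrow> ennreal ((\<Sum>i<N c k. \<bar>b i\<bar>)\<^sup>2) \<le> ennreal C *
      (\<integral>\<^sup>+x\<in>interior (realization \<nu> c). ennreal ((norm (\<Sum>i<N c k. b i *\<^sub>R f c k i x))\<^sup>2) \<partial>lborel)"
  shows "\<exists>v A T. \<sigma> \<subseteq> T \<and> (\<forall>x\<in>T. \<forall>y\<in>T. dist x y \<le> 2 * R * h) \<and> 0 \<le> A \<and>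
    (AE x in lborel. x \<in> interior T \<longrightarrow> u x = v x) \<and>
    (\<forall>x\<in>T. norm (v x) \<le> A) \<and> (\<forall>x\<in>T. \<forall>y\<in>T. norm (v x - v y) \<le> A * (norm (x - y) / h)) \<and>
    ennreal (A\<^sup>2 * h ^ CARD('n)) \<le> ennreal ((real (Suc CARD('n)))\<^sup>2 * (B\<^sup>2 * C)) * (\<integral>\<^sup>+x\<in>interior T. ennreal ((norm (u x))\<^sup>2) \<partial>lborel)"
proof -
  obtain T where T: "T \<in> \<T>" "\<sigma> \<subseteq> T" using ref \<sigma>(1) by (auto simp: simplicial_refinement_def)
  have cell: "is_cell T" using cc T(1) by (auto simp: cellular_complex_def)
  have intT: "interior T \<noteq> {}" using interior_mono[OF T(2)] \<sigma>(2) by auto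
  obtain \<tau> D where \<tau>: "\<tau> \<in> Types" "D \<in> K \<tau>" "scaled_macro_element \<T> \<S> X h T \<tau> D"
    using scaled[OF T(1)] by blast
  obtain Cs N \<nu> f where eqs: "\<tau> = (Cs, N)" "D = (\<nu>, f)" by (metis surj_pair)
  note \<tau> = \<tau>[unfolded eqs]
  have ty: "is_macro_type (Cs, N)" "compact_macro_family (Cs, N) (K (Cs, N))" using types[OF \<tau>(1)] by simp_all
  have dat: "is_macro_datum (Cs, N) (\<nu>, f)" using ty(2) \<tau>(2) by (auto simp: compact_macro_family_def)
  obtain a where a: "bij_betw (\<lambda>c. (\<lambda>y. a + h *\<^sub>R y) ` realization \<nu> c) Cs (macro_element \<T> T)"
    "\<And>c k. c \<in> Cs \<Longrightarrow> (\<lambda>u y. h ^ k *\<^sub>R u (a + h *\<^sub>R y)) ` X k ((\<lambda>y. a + h *\<^sub>R y) ` realization \<nu> c) =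
       form_span (N c k) (\<lambda>i. pullback_to (realization \<nu> c) (f c k i))"
    using \<tau>(3) unfolding scaled_macro_element_def Let_def by auto
  \<comment> \<open>A non-empty cell meets itself, so it belongs to its own macro-element and is the
    scaled image of some combinatorial cell.\<close>
  have "T \<noteq> {}" using intT interior_subset by blast
  then have "T \<in> macro_element \<T> T" using T(1) unfolding macro_element_def by blast
  then obtain c where c: "c \<in> Cs" "T = (\<lambda>y. a + h *\<^sub>R y) ` realization \<nu> c"
    using a(1) unfolding bij_betw_def by blast
  define Y where "Y = realization \<nu> c"
  note c = c(1) c(2)[folded Y_def]
  have YR: "Y \<subseteq> cball 0 R" unfolding Y_def by (rule R[OF \<tau>(1,2) c(1)])
  have "is_cell Y" using is_cell_scaling[OF h] cell unfolding c(2) by blast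
  moreover have "interior Y \<noteq> {}"
  proof -
    obtain x where x: "x \<in> interior T" using intT by blast
    then have "x \<in> T" using interior_subset by blast
    then obtain y where "x = a + h *\<^sub>R y" using c(2) by blast
    then show ?thesis using x scaling_interior[OF h, of a y Y] unfolding c(2) by blast
  qed
  ultimately have "Y \<subseteq> closure (interior Y)" by (rule is_cell_subset_closure_interior)
  then have cov: "covered_by_full_simplices \<nu> c"
    unfolding Y_def using ty(1) dat c(1)
    by (intro covered_by_full_simplices_of_pure) (auto simp: is_macro_type_def is_macro_datum_def)
  obtain w where w: "\<And>k. k \<le> CARD('n) \<Longrightarrow> w k \<in> fe_space_deg e \<T> X k" "u = (\<lambda>x. \<Sum>k\<le>CARD('n). w k x)"
    using u unfolding fe_space_def by blast
  have hom: "homogeneous k (w k)" and wm: "w k \<in> borel_measurable borel" if "k \<le> CARD('n)" for k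
    using w(1)[OF that] by (auto simp: fe_space_deg_def)
  define P where "P k v A \<longleftrightarrow> 0 \<le> A \<and> (AE x in lborel. x \<in> interior T \<longrightarrow> w k x = v x) \<and>
    (\<forall>x\<in>T. norm (v x) \<le> A) \<and> (\<forall>x\<in>T. \<forall>y\<in>T. norm (v x - v y) \<le> A * (norm (x - y) / h)) \<and>
    ennreal (A\<^sup>2 * h ^ CARD('n)) \<le> ennreal (B\<^sup>2 * C) * (\<integral>\<^sup>+x\<in>interior T. ennreal ((norm (w k x))\<^sup>2) \<partial>lborel)"
    for k v A
  have "\<exists>v A. P k v A" if k: "k \<le> CARD('n)" for k
  proof -
    obtain \<phi> where \<phi>: "\<phi> T \<in> X k T" "AE x in lborel. x \<in> interior T \<longrightarrow> w k x = \<phi> T x"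
      using w(1)[OF k] T(1) unfolding fe_space_deg_def by blast
    have "(\<lambda>y. h ^ k *\<^sub>R \<phi> T (a + h *\<^sub>R y)) \<in> form_span (N c k) (\<lambda>i. pullback_to Y (f c k i))"
      using a(2)[OF c(1), of k, folded Y_def, folded c(2)] \<phi>(1) by blast
    then obtain b where b: "(\<lambda>y. h ^ k *\<^sub>R \<phi> T (a + h *\<^sub>R y)) = (\<lambda>y. \<Sum>i<N c k. b i *\<^sub>R pullback_to Y (f c k i) y)"
      unfolding form_span_def by blast
    have sm: "smooth (f c k i)" if "i < N c k" for i
      using dat c(1) that by (auto simp: is_macro_datum_def)
    show ?thesis
      unfolding P_def c(2)
    proof (rule scaled_local_form[OF h _ wm[OF k] _ sm B0 _ _ C0])
      show "h ^ k *\<^sub>R \<phi> T (a + h *\<^sub>R y) = (\<Sum>i<N c k. b i *\<^sub>R pullback_to Y (f c k i) y)" for y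
        using b by meson
      show "AE x in lborel. x \<in> interior ((\<lambda>y. a + h *\<^sub>R y) ` Y) \<longrightarrow> w k x = \<phi> T x"
        using \<phi>(2) c(2) by simp
      show "norm (f c k i x) \<le> B" if "i < N c k" "x \<in> Y" for i x
        using B[OF \<tau>(1,2) c(1) k that(1)] that(2) YR by blast
      show "norm (f c k i x - f c k i y) \<le> B * norm (x - y)" if "i < N c k" "x \<in> Y" "y \<in> Y" for i x y
        using L[OF \<tau>(1,2) c(1) k that(1)] that(2,3) YR by blast
      show "ennreal ((\<Sum>i<N c k. \<bar>b i\<bar>)\<^sup>2) \<le> ennreal C *
        (\<integral>\<^sup>+x\<in>interior Y. ennreal ((norm (\<Sum>i<N c k. b i *\<^sub>R f c k i x))\<^sup>2) \<partial>lborel)"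
        unfolding Y_def by (rule C[OF \<tau>(1,2) c(1) k cov])
    qed
  qed
  then obtain v A where "\<And>k. k \<le> CARD('n) \<Longrightarrow> P k (v k) (A k)" by metis
  then have vA: "\<And>k. k \<le> CARD('n) \<Longrightarrow> 0 \<le> A k"
    "\<And>k. k \<le> CARD('n) \<Longrightarrow> AE x in lborel. x \<in> interior T \<longrightarrow> w k x = v k x"
    "\<And>k. k \<le> CARD('n) \<Longrightarrow> \<forall>x\<in>T. norm (v k x) \<le> A k"
    "\<And>k. k \<le> CARD('n) \<Longrightarrow> \<forall>x\<in>T. \<forall>y\<in>T. norm (v k x - v k y) \<le> A k * (norm (x - y) / h)"
    "\<And>k. k \<le> CARD('n) \<Longrightarrow> ennreal ((A k)\<^sup>2 * h ^ CARD('n)) \<le>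
       ennreal (B\<^sup>2 * C) * (\<integral>\<^sup>+x\<in>interior T. ennreal ((norm (w k x))\<^sup>2) \<partial>lborel)"
    unfolding P_def by blast+
  let ?v = "\<lambda>x. \<Sum>k\<le>CARD('n). v k x" and ?A = "\<Sum>k\<le>CARD('n). A k"
  let ?I = "\<integral>\<^sup>+x\<in>interior T. ennreal ((norm (u x))\<^sup>2) \<partial>lborel"
  show ?thesis
  proof (intro exI conjI)
    show "\<sigma> \<subseteq> T" by fact
    show "\<forall>x\<in>T. \<forall>y\<in>T. dist x y \<le> 2 * R * h"
      unfolding c(2)
    proof clarify
      fix x y assume "x \<in> Y" "y \<in> Y"
      then have "norm x \<le> R" "norm y \<le> R" using YR by auto
      then have "norm (x - y) \<le> 2 * R" using norm_triangle_ineq4[of x y] by linarith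
      then show "dist (a + h *\<^sub>R x) (a + h *\<^sub>R y) \<le> 2 * R * h"
        using h by (simp add: dist_norm flip: scaleR_diff_right)
    qed
    show "0 \<le> ?A" using vA(1) by (intro sum_nonneg) auto
    have "AE x in lborel. \<forall>k\<in>{..CARD('n)}. x \<in> interior T \<longrightarrow> w k x = v k x"
      using vA(2) by (subst AE_ball_countable) auto
    then show "AE x in lborel. x \<in> interior T \<longrightarrow> u x = ?v x"
      by eventually_elim (simp add: w(2))
    show "\<forall>x\<in>T. norm (?v x) \<le> ?A"
      using vA(3) by (auto intro!: sum_norm_le)
    show "\<forall>x\<in>T. \<forall>y\<in>T. norm (?v x - ?v y) \<le> ?A * (norm (x - y) / h)"
    proof (intro ballI)
      fix x y assume xy: "x \<in> T" "y \<in> T"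
      have "norm (\<Sum>k\<le>CARD('n). v k x - v k y) \<le> (\<Sum>k\<le>CARD('n). A k * (norm (x - y) / h))"
        using vA(4) xy by (intro sum_norm_le) blast
      then show "norm (?v x - ?v y) \<le> ?A * (norm (x - y) / h)"
        by (simp only: sum_subtractf sum_distrib_right)
    qed
    \<comment> \<open>One factor \<open>Suc CARD('n)\<close> is due to Cauchy-Schwarz for the sum
      over the degrees, the other to bounding each component of fixed degree by the full
      form.\<close>
    have "?A\<^sup>2 \<le> real (Suc CARD('n)) * (\<Sum>k\<le>CARD('n). (A k)\<^sup>2)"
      using sum_squared_le_sum_of_squares[of A "{..CARD('n)}"] by (simp add: mult.commute)
    then have "?A\<^sup>2 * h ^ CARD('n) \<le> real (Suc CARD('n)) * (\<Sum>k\<le>CARD('n). (A k)\<^sup>2) * h ^ CARD('n)"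
      using h by (intro mult_right_mono) auto
    also have "\<dots> = real (Suc CARD('n)) * (\<Sum>k\<le>CARD('n). (A k)\<^sup>2 * h ^ CARD('n))"
      by (simp add: sum_distrib_right mult.assoc)
    finally have "ennreal (?A\<^sup>2 * h ^ CARD('n)) \<le> ennreal (real (Suc CARD('n)) * (\<Sum>k\<le>CARD('n). (A k)\<^sup>2 * h ^ CARD('n)))"
      by (rule ennreal_leI)
    also have "\<dots> = ennreal (real (Suc CARD('n))) * (\<Sum>k\<le>CARD('n). ennreal ((A k)\<^sup>2 * h ^ CARD('n)))"
      using h by (subst ennreal_mult) (auto intro!: sum_nonneg simp: sum_ennreal)
    also have "\<dots> \<le> ennreal (real (Suc CARD('n))) * (\<Sum>k\<le>CARD('n). ennreal (B\<^sup>2 * C) * ?I)"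
    proof (intro mult_left_mono sum_mono)
      fix k assume "k \<in> {..CARD('n)}"
      then have k: "k \<le> CARD('n)" by simp
      have "ennreal (B\<^sup>2 * C) * (\<integral>\<^sup>+x\<in>interior T. ennreal ((norm (w k x))\<^sup>2) \<partial>lborel) \<le> ennreal (B\<^sup>2 * C) * ?I"
        unfolding w(2) using norm_homogeneous_component_le[of "CARD('n)" w k] hom k
        by (intro mult_left_mono nn_integral_mono mult_right_mono ennreal_leI power_mono) auto
      then show "ennreal ((A k)\<^sup>2 * h ^ CARD('n)) \<le> ennreal (B\<^sup>2 * C) * ?I"
        using vA(5)[OF k] by (rule order_trans[rotated])
    qed simp
    also have "\<dots> = ennreal (real (Suc CARD('n))) * (ennreal (real (Suc CARD('n))) * (ennreal (B\<^sup>2 * C) * ?I))"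
      by (simp add: ennreal_of_nat_eq_real_of_nat del: of_nat_Suc)
    also have "\<dots> = ennreal ((real (Suc CARD('n)))\<^sup>2 * (B\<^sup>2 * C)) * ?I"
    proof -
      have q: "ennreal (x\<^sup>2 * y) = ennreal x * (ennreal x * ennreal y)" if "x \<ge> 0" "y \<ge> 0" for x y
        using that by (simp add: ennreal_mult power2_eq_square mult.assoc)
      show ?thesis
        by (subst q) (use C0 in \<open>simp_all only: mult.assoc of_nat_0_le_iff mult_nonneg_nonneg zero_le_power2\<close>)
    qed
    finally show "ennreal (?A\<^sup>2 * h ^ CARD('n)) \<le> ennreal ((real (Suc CARD('n)))\<^sup>2 * (B\<^sup>2 * C)) * ?I" .
  qed
qed

section \<open>Constants common to all types of macro-elements\<close>

lemma macro_families_bounded: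
  fixes K :: "macro_type \<Rightarrow> 'n::{finite,linorder} macro_datum set"
  assumes fin: "finite Types" and types: "\<And>\<tau>. \<tau> \<in> Types \<Longrightarrow> is_macro_type \<tau> \<and> compact_macro_family \<tau> (K \<tau>)"
  obtains R where "R \<ge> 0" "\<And>Cs N \<nu> f c. (Cs, N) \<in> Types \<Longrightarrow> (\<nu>, f) \<in> K (Cs, N) \<Longrightarrow> c \<in> Cs \<Longrightarrow> realization \<nu> c \<subseteq> cball 0 R"
proof -
  have "\<exists>R\<ge>0. \<forall>\<tau>\<in>Types. \<forall>\<nu> f. (\<nu>, f) \<in> K \<tau> \<longrightarrow> (\<forall>c\<in>fst \<tau>. realization \<nu> c \<subseteq> cball 0 R)"
  proof (rule uniform_bound_finite[OF fin])
    fix \<tau> assume \<tau>: "\<tau> \<in> Types"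
    obtain Cs N where eq: "\<tau> = (Cs, N)" by (cases \<tau>)
    show "\<exists>R. \<forall>\<nu> f. (\<nu>, f) \<in> K \<tau> \<longrightarrow> (\<forall>c\<in>fst \<tau>. realization \<nu> c \<subseteq> cball 0 R)"
      using macro_realization_bounded[of Cs N "K \<tau>"] types[OF \<tau>] unfolding eq fst_conv by blast
  next
    fix \<tau> and B B' :: real
    assume "\<forall>\<nu> f. (\<nu>, f) \<in> K \<tau> \<longrightarrow> (\<forall>c\<in>fst \<tau>. realization \<nu> c \<subseteq> cball 0 B)" "B \<le> B'"
    then show "\<forall>\<nu> f. (\<nu>, f) \<in> K \<tau> \<longrightarrow> (\<forall>c\<in>fst \<tau>. realization \<nu> c \<subseteq> cball 0 B')"
      using subset_cball[of B B' "0 :: 'n point"] by (meson order_trans)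
  qed
  then obtain R where R: "R \<ge> 0"
    "\<forall>\<tau>\<in>Types. \<forall>\<nu> f. (\<nu>, f) \<in> K \<tau> \<longrightarrow> (\<forall>c\<in>fst \<tau>. realization \<nu> c \<subseteq> cball 0 R)" by (elim exE conjE)
  show thesis
    by (rule that[OF R(1)]) (use R(2) in force)
qed

lemma macro_families_C1_bounded:
  fixes K :: "macro_type \<Rightarrow> 'n::{finite,linorder} macro_datum set"
  assumes fin: "finite Types" and types: "\<And>\<tau>. \<tau> \<in> Types \<Longrightarrow> is_macro_type \<tau> \<and> compact_macro_family \<tau> (K \<tau>)"
  obtains B where "B \<ge> 0"
    "\<And>Cs N \<nu> f c k i x. (Cs, N) \<in> Types \<Longrightarrow> (\<nu>, f) \<in> K (Cs, N) \<Longrightarrow> c \<in> Cs \<Longrightarrow> k \<le> CARD('n) \<Longrightarrow>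
      i < N c k \<Longrightarrow> x \<in> cball 0 R \<Longrightarrow> norm (f c k i x) \<le> B"
    "\<And>Cs N \<nu> f c k i x y. (Cs, N) \<in> Types \<Longrightarrow> (\<nu>, f) \<in> K (Cs, N) \<Longrightarrow> c \<in> Cs \<Longrightarrow> k \<le> CARD('n) \<Longrightarrow>
      i < N c k \<Longrightarrow> x \<in> cball 0 R \<Longrightarrow> y \<in> cball 0 R \<Longrightarrow> norm (f c k i x - f c k i y) \<le> B * norm (x - y)"
proof -
  \<comment> \<open>Lists of length at most 1 give the values and the first derivatives. Degrees
    stop at the dimension, which keeps the index set finite.\<close>
  let ?I = "SIGMA \<tau>:Types. SIGMA c:fst \<tau>. SIGMA k:{..CARD('n)}. {..<snd \<tau> c k} \<times> insert [] ((\<lambda>j. [j :: 'n]) ` UNIV)"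
  define P where "P = (\<lambda>(\<tau>, c, k, i, is) B. \<forall>D\<in>K \<tau>. \<forall>x\<in>cball 0 R. norm (partial is (snd D c k i) x) \<le> (B :: real))"
  have I: "finite ?I"
    using fin types by (intro finite_SigmaI finite_cartesian_product) (auto simp: is_macro_type_def)
  have ex: "\<exists>B. P t B" if t: "t \<in> ?I" for t
  proof -
    obtain Cs N c k i "is" where eq: "t = ((Cs, N), c, k, i, is)" by (metis surj_pair)
    have "compact_macro_family (Cs, N) (K (Cs, N))" "c \<in> Cs" "i < N c k"
      using t types unfolding eq by auto
    then show ?thesis unfolding P_def eq case_prod_conv by (rule macro_partial_bounded)
  qed
  have mono: "P t B'" if "P t B" "B \<le> B'" for t B B'
    using that unfolding P_def by force
  have "\<exists>B\<ge>0. \<forall>t\<in>?I. P t B" by (rule uniform_bound_finite[OF I ex mono])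
  then obtain B where B: "B \<ge> 0" "\<forall>t\<in>?I. P t B" by (elim exE conjE)
  have PB: "norm (partial is (f c k i) x) \<le> B"
    if "(Cs, N) \<in> Types" "(\<nu>, f) \<in> K (Cs, N)" "c \<in> Cs" "k \<le> CARD('n)" "i < N c k" "x \<in> cball 0 R"
      "is \<in> insert [] ((\<lambda>j. [j :: 'n]) ` UNIV)" for Cs N \<nu> f c k i x "is"
  proof -
    have "((Cs, N), c, k, i, is) \<in> ?I" using that by auto
    from B(2)[rule_format, OF this] show ?thesis using that(2,6) unfolding P_def by force
  qed
  show thesis
  \<comment> \<open>\<open>B\<close> bounds the values and \<open>CARD('n) * B\<close> the Lipschitz
    constants; the sum serves for both.\<close>
  proof (rule that[of "real CARD('n) * B + B"])
    show "real CARD('n) * B + B \<ge> 0" using B(1) by simp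
    fix Cs N c k i and \<nu> :: "nat \<Rightarrow> 'n point" and f :: "comb_cell \<Rightarrow> nat \<Rightarrow> nat \<Rightarrow> 'n form" and x :: "'n point"
    assume h: "(Cs, N) \<in> Types" "(\<nu>, f) \<in> K (Cs, N)" "c \<in> Cs" "k \<le> CARD('n)" "i < N c k" "x \<in> cball 0 R"
    show "norm (f c k i x) \<le> real CARD('n) * B + B"
      using PB[OF h, of "[]"] B(1) by (simp add: add_increasing)
    fix y :: "'n point" assume y: "y \<in> cball 0 R"
    have sm: "smooth (f c k i)"
      using types[OF h(1)] h(2,3,5) unfolding compact_macro_family_def is_macro_datum_def by fastforce
    have "norm (f c k i x - f c k i y) \<le> (CARD('n) * B) * norm (x - y)"
    proof (rule smooth_lipschitz_of_partial_bound[OF sm _ _ h(6) y])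
      show "norm (partial [j] (f c k i) z) \<le> B" if "z \<in> cball 0 R" for j z
        using PB[OF h(1-5) that, of "[j]"] by blast
    qed simp
    also have "\<dots> \<le> (real CARD('n) * B + B) * norm (x - y)"
      using B(1) by (intro mult_right_mono) auto
    finally show "norm (f c k i x - f c k i y) \<le> (real CARD('n) * B + B) * norm (x - y)" .
  qed
qed

lemma macro_families_lower_bound:
  fixes K :: "macro_type \<Rightarrow> 'n::{finite,linorder} macro_datum set"
  assumes fin: "finite Types" and types: "\<And>\<tau>. \<tau> \<in> Types \<Longrightarrow> is_macro_type \<tau> \<and> compact_macro_family \<tau> (K \<tau>)"
  obtains C where "C \<ge> 0"
    "\<And>Cs N \<nu> f c k b. (Cs, N) \<in> Types \<Longrightarrow> (\<nu>, f) \<in> K (Cs, N) \<Longrightarrow> c \<in> Cs \<Longrightarrow> k \<le> CARD('n) \<Longrightarrow>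
      covered_by_full_simplices \<nu> c \<Longrightarrow> ennreal ((\<Sum>i<N c k. \<bar>b i\<bar>)\<^sup>2) \<le> ennreal C *
      (\<integral>\<^sup>+x\<in>interior (realization \<nu> c). ennreal ((norm (\<Sum>i<N c k. b i *\<^sub>R f c k i x))\<^sup>2) \<partial>lborel)"
proof -
  let ?I = "SIGMA \<tau>:Types. fst \<tau> \<times> {..CARD('n)}"
  define P where "P = (\<lambda>(\<tau>, c, k) C. \<forall>\<nu> f b. (\<nu>, f) \<in> K \<tau> \<longrightarrow> covered_by_full_simplices \<nu> c \<longrightarrow>
    ennreal ((\<Sum>i<snd \<tau> c k. \<bar>b i\<bar>)\<^sup>2) \<le> ennreal C *
      (\<integral>\<^sup>+x\<in>interior (realization \<nu> c). ennreal ((norm (\<Sum>i<snd \<tau> c k. b i *\<^sub>R f c k i x))\<^sup>2) \<partial>lborel))"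
  have I: "finite ?I"
    using fin types by (intro finite_SigmaI finite_cartesian_product) (auto simp: is_macro_type_def)
  have ex: "\<exists>C. P t C" if t: "t \<in> ?I" for t
  proof -
    obtain Cs N c k where eq: "t = ((Cs, N), c, k)" by (metis surj_pair)
    have "compact_macro_family (Cs, N) (K (Cs, N))" "is_macro_type (Cs, N)" "c \<in> Cs"
      using t types unfolding eq by auto
    from macro_lower_bound[OF this] show ?thesis unfolding P_def eq case_prod_conv snd_conv by blast
  qed
  have mono: "P t C'" if "P t C" "C \<le> C'" for t C C'
  proof -
    obtain \<tau> c k where eq: "t = (\<tau>, c, k)" by (cases t)
    have "ennreal C * z \<le> ennreal C' * z" for z using that(2) by (intro mult_right_mono ennreal_leI) auto
    then show ?thesis using that(1) unfolding P_def eq case_prod_conv by (meson order_trans)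
  qed
  have "\<exists>C\<ge>0. \<forall>t\<in>?I. P t C" by (rule uniform_bound_finite[OF I ex mono])
  then obtain C where C: "C \<ge> 0" "\<forall>t\<in>?I. P t C" by (elim exE conjE)
  show thesis
  proof (rule that[OF C(1)])
    fix Cs N c k and \<nu> :: "nat \<Rightarrow> 'n point" and f :: "comb_cell \<Rightarrow> nat \<Rightarrow> nat \<Rightarrow> 'n form" and b :: "nat \<Rightarrow> real"
    assume "(Cs, N) \<in> Types" and a: "(\<nu>, f) \<in> K (Cs, N)" and "c \<in> Cs" "k \<le> CARD('n)"
      and cov: "covered_by_full_simplices \<nu> c"
    then have "((Cs, N), c, k) \<in> ?I" by auto
    from C(2)[rule_format, OF this, unfolded P_def case_prod_conv snd_conv, rule_format, OF a cov]
    show "ennreal ((\<Sum>i<N c k. \<bar>b i\<bar>)\<^sup>2) \<le> ennreal C *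
      (\<integral>\<^sup>+x\<in>interior (realization \<nu> c). ennreal ((norm (\<Sum>i<N c k. b i *\<^sub>R f c k i x))\<^sup>2) \<partial>lborel)" .
  qed
qed

lemma fe_space_measurable_periodic:
  assumes "u \<in> fe_space e \<T> X"
  shows "u \<in> borel_measurable borel" "periodic e u"
proof -
  obtain w where w: "\<And>k. k \<le> CARD('a) \<Longrightarrow> w k \<in> fe_space_deg e \<T> X k" "u = (\<lambda>x. \<Sum>k\<le>CARD('a). w k x)"
    using assms unfolding fe_space_def by blast
  have *: "w k \<in> borel_measurable borel" "periodic e (w k)" if "k \<le> CARD('a)" for k
    using w(1)[OF that] by (auto simp: fe_space_deg_def)
  show "u \<in> borel_measurable borel" unfolding w(2) using *(1) by (intro borel_measurable_sum) auto
  show "periodic e u" unfolding w(2) periodic_def using *(2) by (auto simp: periodic_def intro!: sum.cong)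
qed

theorem proposition5p4:
  fixes e :: "'n::{finite,linorder} \<Rightarrow> 'n point"
    and \<T> \<S> :: "nat \<Rightarrow> ('n point) set set"
    and h :: "nat \<Rightarrow> real"
    and X :: "nat \<Rightarrow> nat \<Rightarrow> ('n point) set \<Rightarrow> 'n form set"
    and p :: nat
    and s :: real
  assumes "lattice_basis e"
    and "\<And>j. cellular_complex e (\<T> j)"
    and "\<And>j. mesh_width e (\<T> j) (h j)"
    and "\<And>j. h j > 0"
    and "h \<longlonglongrightarrow> 0"
    and "\<And>j. simplicial_refinement e (\<T> j) (\<S> j)"
    and "quasi_uniform \<T> \<S> h"
    and "\<And>j. fe_system e (\<T> j) (X j)"
    and "\<And>j. compatible_system (\<T> j) (X j)"
    and "compact_macro_elements \<T> \<S> X h"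
    and "\<And>j. contains_polynomials p (\<T> j) (X j)"
    and "\<And>j. fe_space e (\<T> j) (X j) \<subseteq> ext_deriv_domain e"
    and "0 < s" and "s < 1 / 2"
  shows "\<exists>M::real. \<forall>j. \<forall>u\<in>fe_space e (\<T> j) (X j).
           slobodetskij e s u \<le> ennreal (M * h j powr (- s)) * L2_norm e u"
proof -
  note e = assms(1) and cc = assms(2) and h = assms(4) and ref = assms(6)
  obtain Types and K :: "macro_type \<Rightarrow> 'n macro_datum set" where fin: "finite Types"
    and "\<forall>\<tau>\<in>Types. is_macro_type \<tau> \<and> compact_macro_family \<tau> (K \<tau>)"
    and "\<forall>j. \<forall>T\<in>\<T> j. \<exists>\<tau>\<in>Types. \<exists>D\<in>K \<tau>. scaled_macro_element (\<T> j) (\<S> j) (X j) (h j) T \<tau> D"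
    using assms(10) unfolding compact_macro_elements_def by (elim exE conjE)
  then have types: "\<And>\<tau>. \<tau> \<in> Types \<Longrightarrow> is_macro_type \<tau> \<and> compact_macro_family \<tau> (K \<tau>)"
    and scaled: "\<And>j T. T \<in> \<T> j \<Longrightarrow> \<exists>\<tau>\<in>Types. \<exists>D\<in>K \<tau>. scaled_macro_element (\<T> j) (\<S> j) (X j) (h j) T \<tau> D"
    by simp_all
  obtain R where R: "R \<ge> 0" "\<And>Cs N \<nu> f c. (Cs, N) \<in> Types \<Longrightarrow> (\<nu>, f) \<in> K (Cs, N) \<Longrightarrow> c \<in> Cs \<Longrightarrow> realization \<nu> c \<subseteq> cball 0 R"
    using macro_families_bounded[OF fin types] by blast
  obtain B where B: "B \<ge> 0"
    "\<And>Cs N \<nu> f c k i x. (Cs, N) \<in> Types \<Longrightarrow> (\<nu>, f) \<in> K (Cs, N) \<Longrightarrow> c \<in> Cs \<Longrightarrow> k \<le> CARD('n) \<Longrightarrow>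
      i < N c k \<Longrightarrow> x \<in> cball 0 R \<Longrightarrow> norm (f c k i x) \<le> B"
    "\<And>Cs N \<nu> f c k i x y. (Cs, N) \<in> Types \<Longrightarrow> (\<nu>, f) \<in> K (Cs, N) \<Longrightarrow> c \<in> Cs \<Longrightarrow> k \<le> CARD('n) \<Longrightarrow>
      i < N c k \<Longrightarrow> x \<in> cball 0 R \<Longrightarrow> y \<in> cball 0 R \<Longrightarrow> norm (f c k i x - f c k i y) \<le> B * norm (x - y)"
    using macro_families_C1_bounded[OF fin types, of R] by blast
  obtain C where C: "C \<ge> 0"
    "\<And>Cs N \<nu> f c k b. (Cs, N) \<in> Types \<Longrightarrow> (\<nu>, f) \<in> K (Cs, N) \<Longrightarrow> c \<in> Cs \<Longrightarrow> k \<le> CARD('n) \<Longrightarrow>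
      covered_by_full_simplices \<nu> c \<Longrightarrow> ennreal ((\<Sum>i<N c k. \<bar>b i\<bar>)\<^sup>2) \<le> ennreal C *
      (\<integral>\<^sup>+x\<in>interior (realization \<nu> c). ennreal ((norm (\<Sum>i<N c k. b i *\<^sub>R f c k i x))\<^sup>2) \<partial>lborel)"
    using macro_families_lower_bound[OF fin types] by blast
  obtain \<kappa> where \<kappa>: "\<kappa> > 0" "\<And>j \<sigma>. \<sigma> \<in> \<S> j \<Longrightarrow> aff_dim \<sigma> = int CARD('n) \<Longrightarrow>
      h j \<le> \<kappa> * diameter \<sigma> \<and> (\<exists>x. cball x (diameter \<sigma> / \<kappa>) \<subseteq> \<sigma>)"
    using assms(7) unfolding quasi_uniform_def by blast
  \<comment> \<open>A common bound \<open>H\<close> for the mesh widths fixes in advance the ball on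
    which periodic integrals are compared, so that \<open>N\<close> is independent of
    \<open>j\<close>.\<close>
  have "Bseq h" using assms(5) by (rule convergent_imp_Bseq[OF convergentI])
  then obtain H where H: "\<And>j. h j \<le> H"
    using h unfolding Bseq_def by (metis abs_of_pos real_norm_def)
  obtain D where "\<forall>x\<in>fundamental_domain e. norm x \<le> D"
    using fundamental_domain_bounded[of e] unfolding bounded_iff by (elim exE)
  then have D: "fundamental_domain e \<subseteq> cball 0 D" by auto
  \<comment> \<open>A cell has diameter at most \<open>2 * R * h j\<close>, so a ball of that radius
    about a point of the simplex contains it; the added 1 keeps \<open>R'\<close> positive. In
    \<open>r\<close>, one factor \<open>1 / \<kappa>\<close> relates the inscribed ball to the
    diameter of the simplex and the other relates this diameter to \<open>h j\<close>.\<close>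
  define R' where "R' = 2 * R + 1"
  define r where "r = 1 / \<kappa>\<^sup>2"
  have R': "R' > 0" and r: "r > 0" using R(1) \<kappa>(1) by (auto simp: R'_def r_def)
  obtain N where N: "N \<ge> 0" "\<And>g. g \<in> borel_measurable borel \<Longrightarrow> periodic e g \<Longrightarrow>
      (\<integral>\<^sup>+x\<in>cball 0 (D + H + 2 * R' * H). g x \<partial>lborel) \<le> ennreal N * (\<integral>\<^sup>+x\<in>fundamental_domain e. g x \<partial>lborel)"
    using nn_integral_periodic_bounded[OF e, of "D + H + 2 * R' * H"] by blast
  obtain C2 where C2: "C2 \<ge> 0" "\<And>h. h > 0 \<Longrightarrow>
    (\<integral>\<^sup>+z. ennreal (norm z powr (- (real DIM('n point) + 2 * s)) * min 1 (norm z / h)) \<partial>(lborel :: 'n point measure))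
      \<le> ennreal (C2 * h powr (- 2 * s))"
    using nn_integral_kernel_le[OF assms(13,14), where 'a = "'n point"] by blast
  define C' where "C' = (real (Suc CARD('n)))\<^sup>2 * (B\<^sup>2 * C)"
  have C': "C' \<ge> 0" using C(1) by (simp add: C'_def)
  define K' where "K' = 4 + (1 + 4 * CARD('n) / r) * unit_ball_vol CARD('n) * R' ^ CARD('n) * C' * ((R' + r) / r) ^ CARD('n) * N"
  have K': "K' \<ge> 0" using C' R' r N(1) by (simp add: K'_def)
  show ?thesis
  proof (intro exI allI ballI)
    fix j u assume u: "u \<in> fe_space e (\<T> j) (X j)"
    note um = fe_space_measurable_periodic[OF u]
    have tri: "periodic_triangulation e (\<S> j)" using ref[of j] by (simp add: simplicial_refinement_def)
    define \<Sigma> where "\<Sigma> = {\<sigma>\<in>\<S> j. aff_dim \<sigma> = int CARD('n)}"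
    have "\<exists>x. cball x (r * h j) \<subseteq> \<sigma>" if \<sigma>: "\<sigma> \<in> \<Sigma>" for \<sigma>
    proof -
      obtain x where x: "h j \<le> \<kappa> * diameter \<sigma>" "cball x (diameter \<sigma> / \<kappa>) \<subseteq> \<sigma>"
        using \<kappa>(2) \<sigma> unfolding \<Sigma>_def by blast
      have "r * h j \<le> diameter \<sigma> / \<kappa>"
        using x(1) \<kappa>(1) by (simp add: r_def field_simps power2_eq_square)
      then have "cball x (r * h j) \<subseteq> cball x (diameter \<sigma> / \<kappa>)" by (rule subset_cball)
      then show ?thesis using x(2) by blast
    qed
    then obtain c where c: "\<And>\<sigma>. \<sigma> \<in> \<Sigma> \<Longrightarrow> cball (c \<sigma>) (r * h j) \<subseteq> \<sigma>" by metis
    have rh: "r * h j > 0" using r h by simp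
    have c\<sigma>: "c \<sigma> \<in> \<sigma>" if "\<sigma> \<in> \<Sigma>" for \<sigma> using c[OF that] rh by (metis centre_in_cball less_imp_le subsetD)
    have ballint: "ball (c \<sigma>) (r * h j) \<subseteq> interior \<sigma>" if "\<sigma> \<in> \<Sigma>" for \<sigma>
      using c[OF that] ball_subset_cball by (intro interior_maximal) blast+
    have int: "interior \<sigma> \<noteq> {}" if "\<sigma> \<in> \<Sigma>" for \<sigma>
      using ballint[OF that] rh by (metis centre_in_ball empty_iff subsetD)
    define P where "P \<sigma> v A \<longleftrightarrow> \<sigma> \<subseteq> cball (c \<sigma>) (R' * h j) \<and>
      (AE x in lborel. x \<in> \<sigma> \<longrightarrow> u x = v x) \<and> (\<forall>x\<in>\<sigma>. norm (v x) \<le> A) \<and>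
      (\<forall>x\<in>\<sigma>. \<forall>y\<in>\<sigma>. norm (v x - v y) \<le> A * (norm (x - y) / h j)) \<and>
      ennreal (A\<^sup>2 * h j ^ CARD('n)) \<le> ennreal C' * (\<integral>\<^sup>+x\<in>cball (c \<sigma>) (R' * h j). ennreal ((norm (u x))\<^sup>2) \<partial>lborel)"
      for \<sigma> v A
    have "\<exists>v A. P \<sigma> v A" if \<sigma>: "\<sigma> \<in> \<Sigma>" for \<sigma>
    proof -
      have \<sigma>': "\<sigma> \<in> \<S> j" using \<sigma> by (simp add: \<Sigma>_def)
      have "\<exists>v A T. \<sigma> \<subseteq> T \<and> (\<forall>x\<in>T. \<forall>y\<in>T. dist x y \<le> 2 * R * h j) \<and> 0 \<le> A \<and>
        (AE x in lborel. x \<in> interior T \<longrightarrow> u x = v x) \<and>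
        (\<forall>x\<in>T. norm (v x) \<le> A) \<and> (\<forall>x\<in>T. \<forall>y\<in>T. norm (v x - v y) \<le> A * (norm (x - y) / h j)) \<and>
        ennreal (A\<^sup>2 * h j ^ CARD('n)) \<le> ennreal C' * (\<integral>\<^sup>+x\<in>interior T. ennreal ((norm (u x))\<^sup>2) \<partial>lborel)"
        unfolding C'_def
        by (rule fe_local_representative[where Types = Types and K = K, OF h[of j] cc[of j] ref[of j] u \<sigma>' int[OF \<sigma>]])
          (fact scaled types R(2) B C)+
      then obtain v A T where T: "\<sigma> \<subseteq> T" "\<forall>x\<in>T. \<forall>y\<in>T. dist x y \<le> 2 * R * h j"
        "AE x in lborel. x \<in> interior T \<longrightarrow> u x = v x"
        "\<forall>x\<in>T. norm (v x) \<le> A" "\<forall>x\<in>T. \<forall>y\<in>T. norm (v x - v y) \<le> A * (norm (x - y) / h j)"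
        "ennreal (A\<^sup>2 * h j ^ CARD('n)) \<le> ennreal C' * (\<integral>\<^sup>+x\<in>interior T. ennreal ((norm (u x))\<^sup>2) \<partial>lborel)"
        by (elim exE conjE)
      have TR: "T \<subseteq> cball (c \<sigma>) (R' * h j)"
      proof
        fix x assume "x \<in> T"
        then have "dist (c \<sigma>) x \<le> 2 * R * h j" using T(1,2) c\<sigma>[OF \<sigma>] by blast
        also have "\<dots> \<le> R' * h j" using h[of j] by (simp add: R'_def)
        finally show "x \<in> cball (c \<sigma>) (R' * h j)" by simp
      qed
      \<comment> \<open>The representative agrees with \<open>u\<close> almost everywhere in the
        interior of the cell; the points of \<sigma> outside that interior lie on the frontier of
        \<sigma>, which is null by convexity.\<close>
      have "negligible (frontier \<sigma>)"
        using periodic_triangulation_simplex[OF tri \<sigma>'] by (simp add: negligible_convex_frontier)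
      then have "AE x in lborel. x \<notin> frontier \<sigma>" by (intro AE_not_in_negligible) (auto simp: borel_closed)
      with T(3) have ae: "AE x in lborel. x \<in> \<sigma> \<longrightarrow> u x = v x"
      proof eventually_elim
        case (elim x)
        then show ?case
          using interior_mono[OF T(1)] closure_subset[of \<sigma>] unfolding frontier_def by blast
      qed
      have "(\<integral>\<^sup>+x\<in>interior T. ennreal ((norm (u x))\<^sup>2) \<partial>lborel) \<le>
        (\<integral>\<^sup>+x\<in>cball (c \<sigma>) (R' * h j). ennreal ((norm (u x))\<^sup>2) \<partial>lborel)"
        using TR interior_subset[of T] by (intro nn_integral_mono mult_left_mono) (auto simp: indicator_def)
      then have "ennreal C' * (\<integral>\<^sup>+x\<in>interior T. ennreal ((norm (u x))\<^sup>2) \<partial>lborel) \<le>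
        ennreal C' * (\<integral>\<^sup>+x\<in>cball (c \<sigma>) (R' * h j). ennreal ((norm (u x))\<^sup>2) \<partial>lborel)"
        by (intro mult_left_mono) auto
      with T(6) have inv: "ennreal (A\<^sup>2 * h j ^ CARD('n)) \<le> ennreal C' * (\<integral>\<^sup>+x\<in>cball (c \<sigma>) (R' * h j). ennreal ((norm (u x))\<^sup>2) \<partial>lborel)"
        by (rule order_trans)
      show ?thesis unfolding P_def using T(1,4,5) TR ae inv by blast
    qed
    then obtain v A where "\<And>\<sigma>. \<sigma> \<in> \<Sigma> \<Longrightarrow> P \<sigma> (v \<sigma>) (A \<sigma>)" by metis
    then have vA: "\<And>\<sigma>. \<sigma> \<in> \<Sigma> \<Longrightarrow> \<sigma> \<subseteq> cball (c \<sigma>) (R' * h j)"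
      "\<And>\<sigma>. \<sigma> \<in> \<Sigma> \<Longrightarrow> AE x in lborel. x \<in> \<sigma> \<longrightarrow> u x = v \<sigma> x"
      "\<And>\<sigma> x. \<sigma> \<in> \<Sigma> \<Longrightarrow> x \<in> \<sigma> \<Longrightarrow> norm (v \<sigma> x) \<le> A \<sigma>"
      "\<And>\<sigma> x y. \<sigma> \<in> \<Sigma> \<Longrightarrow> x \<in> \<sigma> \<Longrightarrow> y \<in> \<sigma> \<Longrightarrow> norm (v \<sigma> x - v \<sigma> y) \<le> A \<sigma> * (norm (x - y) / h j)"
      "\<And>\<sigma>. \<sigma> \<in> \<Sigma> \<Longrightarrow> ennreal ((A \<sigma>)\<^sup>2 * h j ^ CARD('n)) \<le> ennreal C' * (\<integral>\<^sup>+x\<in>cball (c \<sigma>) (R' * h j). ennreal ((norm (u x))\<^sup>2) \<partial>lborel)"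
      unfolding P_def by blast+
    have \<Sigma>: "countable \<Sigma>" "\<And>\<sigma>. \<sigma> \<in> \<Sigma> \<Longrightarrow> convex \<sigma>" "\<And>\<sigma>. \<sigma> \<in> \<Sigma> \<Longrightarrow> compact \<sigma>"
      using countable_periodic_family[of e "\<S> j"] tri periodic_triangulation_simplex[OF tri]
      by (auto simp: \<Sigma>_def periodic_triangulation_def)
    have disj: "ball (c \<sigma>) (r * h j) \<inter> ball (c \<tau>) (r * h j) = {}" if "\<sigma> \<in> \<Sigma>" "\<tau> \<in> \<Sigma>" "\<sigma> \<noteq> \<tau>" for \<sigma> \<tau>
    proof -
      have "interior \<sigma> \<inter> interior \<tau> = {}"
        using that by (intro full_simplices_disjoint[OF tri]) (auto simp: \<Sigma>_def)
      then show ?thesis using ballint[OF that(1)] ballint[OF that(2)] by blast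
    qed
    have cover: "AE x in lborel. \<exists>\<sigma>\<in>\<Sigma>. x \<in> \<sigma>"
      unfolding \<Sigma>_def by (rule AE_in_full_simplex[OF tri])
    have trans: "(\<integral>\<^sup>+x\<in>fundamental_domain e. ennreal ((norm (u (x + z) - u x))\<^sup>2) \<partial>lborel) \<le>
      ennreal (K' * min 1 (norm z / h j)) * (\<integral>\<^sup>+x\<in>fundamental_domain e. ennreal ((norm (u x))\<^sup>2) \<partial>lborel)" for z
      by (rule translation_estimate[OF e um h H r R' C' N(1) D N(2) \<Sigma> c vA(1) disj cover vA(2-5) K'_def])
    \<comment> \<open>\<open>K'\<close> and \<open>C2\<close> were fixed before \<open>j\<close> and
      \<open>u\<close>, so the square root is a valid choice of \<open>M\<close>.\<close>
    show "slobodetskij e s u \<le> ennreal (sqrt (2 powr (real CARD('n) + 2 * s) * K' * C2) * h j powr (- s)) * L2_norm e u"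
      using C2(2)[OF h, of j]
      by (intro slobodetskij_le_of_translation_estimate[OF e um h assms(13) K' C2(1) trans]) simp
  qed
qed

end
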